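(* Let $T>0$ and $\mathcal D=[-T,T]^d$. Let $\mathcal P_0$ and $\mathcal P_1$ denote two measures on the paths of a $p$-dimensional stationary zero-mean Gaussian random field on $\mathcal D$, with matrix covariance functions $C^{(i)}$ and spectral density matrices $F^{(i)}$ under $\mathcal P_i$, $i=0,1$. Suppose there exist positive constants $c_1,c_2$ and real-valued positive functions $\phi_1,\dots,\phi_p$ on $\mathbb R^d$ with $(\phi_1,\dots,\phi_p)^T\in\mathcal W_{\mathcal D}$ (defined in the context) such that $\sup_{j,\omega}\phi_j(\omega)\le M$ for some $M>0$ and, with $\Phi(\omega)=\mathrm{diag}(\phi_1^2(\omega),\dots,\phi_p^2(\omega))$, $$c_1\Phi(\omega)\le F^{(i)}(\omega)\le c_2\Phi(\omega)\qquad\text{for all }\omega\in\mathbb R^d,\ i=0,1.$$ Then $\mathcal P_0\equiv\mathcal P_1$ if $$\int_{\mathbb R^d}\Big\|\Phi(\omega)^{-1/2}\big(F^{(1)}(\omega)-F^{(0)}(\omega)\big)\Phi(\omega)^{-1/2}\Big\|^2d\omega<\infty .$$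
   Context: Spectral density matrix: $C^{(i)}_{jk}(h)=\int_{\mathbb R^d}\exp(\iota h^T\omega)F^{(i)}_{jk}(\omega)\,d\omega$ with all $F^{(i)}_{jk}$ integrable, $\iota=\sqrt{-1}$. Fourier transform: $\mathcal F(g)(\omega)=(2\pi)^{-d}\int_{\mathbb R^d}\exp(-\iota h^T\omega)g(h)\,dh$. $\mathcal W_{\mathcal D}$ is the set of functions $u=(u_1,\dots,u_p)^T:\mathbb R^d\to\mathbb C^p$ such that each $u_j=\mathcal F(g_j)$ for some square-integrable function $g_j$ on $\mathbb R^d$ that vanishes outside $\mathcal D$. Matrix inequalities are in the Loewner (positive semidefinite) order; $\|\cdot\|$ is the matrix operator norm. $\mathcal P_0\equiv\mathcal P_1$ means mutual absolute continuity, on the $\sigma$-algebra generated by point evaluations on $\mathcal D$. *)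

theory Defs
  imports "HOL-Probability.Probability"
begin

definition spectral_density_matrix ::
  "(real^'d \<Rightarrow> real^'p^'p) \<Rightarrow> (real^'d \<Rightarrow> complex^'p^'p) \<Rightarrow> bool" where
  "spectral_density_matrix C F \<longleftrightarrow>
     (\<forall>j k. integrable lebesgue (\<lambda>\<omega>. F \<omega> $ j $ k)) \<and>
     (\<forall>h j k. complex_of_real (C h $ j $ k) =
        (LINT \<omega>|lebesgue. exp (\<i> * complex_of_real (h \<bullet> \<omega>)) * F \<omega> $ j $ k))"

definition fourier :: "(real^'d \<Rightarrow> complex) \<Rightarrow> real^'d \<Rightarrow> complex" where
  "fourier g \<omega> = complex_of_real (1 / (2 * pi) ^ CARD('d)) *
     (LINT h|lebesgue. exp (- \<i> * complex_of_real (h \<bullet> \<omega>)) * g h)"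

definition square_integrable :: "(real^'d \<Rightarrow> complex) \<Rightarrow> bool" where
  "square_integrable g \<longleftrightarrow>
     g \<in> borel_measurable lebesgue \<and> integrable lebesgue (\<lambda>h. (norm (g h))\<^sup>2)"

definition W_space :: "(real^'d) set \<Rightarrow> (real^'d \<Rightarrow> complex^'p) set" where
  "W_space D = {u. \<forall>j. \<exists>g. square_integrable g \<and> (\<forall>h. h \<notin> D \<longrightarrow> g h = 0) \<and>
                        (\<forall>\<omega>. u \<omega> $ j = fourier g \<omega>)}"

definition hermitian :: "complex^'p^'p \<Rightarrow> bool" where
  "hermitian A \<longleftrightarrow> (\<forall>j k. A $ j $ k = cnj (A $ k $ j))"

definition psd :: "complex^'p^'p \<Rightarrow> bool" where
  "psd A \<longleftrightarrow> hermitian A \<and>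
     (\<forall>x :: complex^'p. 0 \<le> Re (\<Sum>j\<in>UNIV. cnj (x $ j) * (A *v x) $ j))"

definition loewner_le :: "complex^'p^'p \<Rightarrow> complex^'p^'p \<Rightarrow> bool" where
  "loewner_le A B \<longleftrightarrow> psd (B - A)"

definition diag :: "('p \<Rightarrow> real) \<Rightarrow> complex^'p^'p" where
  "diag v = (\<chi> j k. if j = k then complex_of_real (v j) else 0)"

definition Phi :: "(real^'d \<Rightarrow> real^'p) \<Rightarrow> real^'d \<Rightarrow> complex^'p^'p" where
  "Phi \<phi> \<omega> = diag (\<lambda>j. (\<phi> \<omega> $ j)\<^sup>2)"

text \<open>
  The power \<open>-1/2\<close> of the diagonal matrix \<open>Phi \<phi> \<omega>\<close> is taken entrywise on the diagonal, which is
  meaningful when all components of \<open>\<phi> \<omega>\<close> are positive.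
\<close>

definition Phi_inv_sqrt :: "(real^'d \<Rightarrow> real^'p) \<Rightarrow> real^'d \<Rightarrow> complex^'p^'p" where
  "Phi_inv_sqrt \<phi> \<omega> = diag (\<lambda>j. ((\<phi> \<omega> $ j)\<^sup>2) powr (-1/2))"

text \<open>
  The operator norm is induced by the norm of \<^typ>\<open>complex^'p\<close>, i.e. the Hermitian norm.
\<close>

definition matrix_norm :: "complex^'p^'p \<Rightarrow> real" where
  "matrix_norm A = onorm (\<lambda>x :: complex^'p. A *v x)"

text \<open>
  A univariate Gaussian law is the law of \<open>m + s * N\<close> with \<open>N\<close> standard normal; \<open>s = 0\<close> is allowed,
  so point masses count as Gaussian. Path space is the product space \<open>D \<rightarrow> \<real>\<^sup>p\<close>, whose
  \<open>\<sigma>\<close>-algebra is the one generated by the point evaluations \<open>z \<mapsto> z s\<close> for \<open>s \<in> D\<close>.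
\<close>

definition gaussian_rv :: "'a measure \<Rightarrow> ('a \<Rightarrow> real) \<Rightarrow> bool" where
  "gaussian_rv M X \<longleftrightarrow> X \<in> borel_measurable M \<and>
     (\<exists>m s. distr M borel X = distr std_normal_distribution borel (\<lambda>x. m + s * x))"

definition path_space :: "(real^'d) set \<Rightarrow> (real^'d \<Rightarrow> real^'p) measure" where
  "path_space D = (\<Pi>\<^sub>M s\<in>D. borel)"

text \<open>
  Joint Gaussianity of all finite-dimensional distributions, expressed through real linear
  combinations of the values \<open>z s $ j\<close>.
\<close>

definition gaussian_field :: "(real^'d) set \<Rightarrow> (real^'d \<Rightarrow> real^'p) measure \<Rightarrow> bool" where
  "gaussian_field D P \<longleftrightarrow> prob_space P \<and> sets P = sets (path_space D) \<and>
     (\<forall>S a. finite S \<longrightarrow> S \<subseteq> D \<longrightarrow> gaussian_rv P (\<lambda>z. \<Sum>s\<in>S. \<Sum>j\<in>UNIV. a s j * z s $ j))"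

definition zero_mean :: "(real^'d) set \<Rightarrow> (real^'d \<Rightarrow> real^'p) measure \<Rightarrow> bool" where
  "zero_mean D P \<longleftrightarrow> (\<forall>s\<in>D. \<forall>j. (LINT z|P. z s $ j) = 0)"

definition covariance :: "'a measure \<Rightarrow> ('a \<Rightarrow> real) \<Rightarrow> ('a \<Rightarrow> real) \<Rightarrow> real" where
  "covariance M X Y = (LINT x|M. (X x - (LINT y|M. X y)) * (Y x - (LINT y|M. Y y)))"

text \<open>
  Dependence of the covariance on the lag alone; with a constant mean this is stationarity
  (strict stationarity in the Gaussian case). The sign convention for the lag
  is \<open>Cov (z s $ j) (z t $ k) = C (s - t) $ j $ k\<close>.
\<close>

definition stationary_covariance ::
  "(real^'d) set \<Rightarrow> (real^'d \<Rightarrow> real^'p) measure \<Rightarrow> (real^'d \<Rightarrow> real^'p^'p) \<Rightarrow> bool" where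
  "stationary_covariance D P C \<longleftrightarrow>
     (\<forall>s\<in>D. \<forall>t\<in>D. \<forall>j k. covariance P (\<lambda>z. z s $ j) (\<lambda>z. z t $ k) = C (s - t) $ j $ k)"

definition stationary_zero_mean_gaussian_field ::
  "(real^'d) set \<Rightarrow> (real^'d \<Rightarrow> real^'p) measure \<Rightarrow> (real^'d \<Rightarrow> real^'p^'p) \<Rightarrow> bool" where
  "stationary_zero_mean_gaussian_field D P C \<longleftrightarrow>
     gaussian_field D P \<and> zero_mean D P \<and> stationary_covariance D P C"

definition equivalent_measures :: "'a measure \<Rightarrow> 'a measure \<Rightarrow> bool" where
  "equivalent_measures P Q \<longleftrightarrow>
     sets P = sets Q \<and> absolutely_continuous P Q \<and> absolutely_continuous Q P"

end

theory Submission
  imports Defs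
begin

text \<open>
  Let \<open>V\<close> be the space of finite linear functionals of the field. Under \<open>P\<^sub>i\<close> the covariance of two
  functionals is the integral of \<open>v* F\<^sub>i u\<close> for trigonometric polynomials \<open>v\<close>, \<open>u\<close> with frequencies
  in \<open>D\<close>, so the two covariance forms on \<open>V\<close> are comparable. Their difference is the integral of
  \<open>w* G w'\<close> with \<open>G = \<Phi>\<^bsup>-1/2\<^esup> (F\<^sub>1 - F\<^sub>0) \<Phi>\<^bsup>-1/2\<^esup>\<close> and \<open>w = \<Phi>\<^bsup>1/2\<^esup> v\<close>. Since \<open>\<phi>\<^sub>j\<close> is the Fourier
  transform of a function living on \<open>D\<close>, the components of \<open>w\<close> are band-limited to \<open>D + D\<close>, hence
  reproduced by convolution with a square integrable kernel. So \<open>\<Sum> |w\<^sub>k(\<omega>)|\<^sup>2\<close> is bounded uniformly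
  in \<open>\<omega>\<close> for every system that is orthonormal under \<open>P\<^sub>0\<close>, and with Bessel's inequality the difference of
  the covariance forms has Hilbert-Schmidt norm bounded by a multiple of the integral of \<open>\<parallel>G\<parallel>\<^sup>2\<close>.

  For finitely many functionals, orthonormalise first under \<open>P\<^sub>0\<close> and then, step by step, under \<open>P\<^sub>1\<close>.
  The likelihood ratio becomes a product of one-dimensional Gaussian ratios, and its relative entropy is
  bounded by the Hilbert-Schmidt norm, uniformly in the number of functionals. Hence \<open>P\<^sub>1\<close> of a cylinder set is
  small whenever \<open>P\<^sub>0\<close> of it is small, and this passes to the generated \<open>\<sigma>\<close>-algebra by approximation.
\<close>

section \<open>A reproducing kernel for band-limited functions\<close>

text \<open>The proof rests on a cancellation. In the log likelihood ratio of two Gaussian vectors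
  the first-order parts of the trace and of the log-determinant cancel, so relative entropy is
  quadratic in the perturbation of the covariance. This is why a square integral of the normalised
  difference suffices, provided the perturbed variances stay away from zero, which the Loewner
  bounds ensure. Orthonormalising one functional at a time replaces determinants by scalar
  logarithms and keeps all arguments on finite systems: no completion of \<open>V\<close> and no
  operator on it is formed.

  A bound on \<open>w(\<omega>)\<close> that is uniform in the size of the system requires point
  evaluation to be continuous in the L^2 norm; the kernel serves this purpose. The sinc kernel also
  reproduces band-limited functions but is not absolutely integrable, which would block the exchange
  of integrals. The slack between \<open>L\<close> and \<open>2L\<close> in the trapezoid makes the
  kernel decay like \<open>1 / x^2\<close>. Exponents and supports both lie in
  \<open>[-T, T]^d\<close>, so the band is \<open>[-2T, 2T]^d\<close> and
  \<open>L = 2T\<close>.\<close>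

definition fejer_quotient :: "real \<Rightarrow> real" where
  "fejer_quotient x = (1 - cos x) / x\<^sup>2"

lemma fejer_quotient_measurable [measurable]: "fejer_quotient \<in> borel_measurable borel"
  unfolding fejer_quotient_def by measurable

lemma fejer_quotient_nonneg: "0 \<le> fejer_quotient x"
  by (simp add: fejer_quotient_def)

lemma one_minus_cos_le: "1 - cos x \<le> x\<^sup>2 / 2" for x :: real
proof -
  have "(sin (x / 2))\<^sup>2 \<le> (x / 2)\<^sup>2"
    using abs_sin_x_le_abs_x[of "x / 2"] abs_le_square_iff by blast
  then show ?thesis
    using cos_double_sin[of "x / 2"] by (simp add: power2_eq_square)
qed

text \<open>Near 0 the quadratic bound on \<open>1 - cos x\<close> is used, for
  \<open>x^2 > 1\<close> the bound by 2. The constant 4 comes from the second case, where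
  \<open>1 + x^2\<close> is at most \<open>2 x^2\<close>.\<close>

lemma fejer_quotient_le: "fejer_quotient x \<le> 4 * inverse (1 + x\<^sup>2)"
proof (cases "x = 0")
  case False
  note half = one_minus_cos_le[of x]
  have "(1 - cos x) * (1 + x\<^sup>2) \<le> 4 * x\<^sup>2"
  proof (cases "x\<^sup>2 \<le> 1")
    case True
    have "(1 - cos x) * (1 + x\<^sup>2) \<le> (x\<^sup>2 / 2) * 2"
      using True half by (intro mult_mono) auto
    then show ?thesis using zero_le_power2[of x] by linarith
  next
    case False
    have "(1 - cos x) * (1 + x\<^sup>2) \<le> 2 * (2 * x\<^sup>2)"
      using False cos_ge_minus_one[of x] by (intro mult_mono) auto
    then show ?thesis by simp
  qed
  then show ?thesis
    using False by (simp add: fejer_quotient_def field_simps add_pos_nonneg)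
qed (simp add: fejer_quotient_def)

lemma integrable_fejer_quotient: "integrable lborel fejer_quotient"
proof (rule Bochner_Integration.integrable_bound)
  show "integrable lborel (\<lambda>x::real. 4 * inverse (1 + x\<^sup>2))"
    using integrable_inverse_1_plus_square by (simp add: set_integrable_def einterval_def)
qed (auto simp: fejer_quotient_le fejer_quotient_nonneg)

text \<open>The integral equals \<pi>. It is carried along as an abstract normalising constant whose
  positivity is what the kernel relies on.\<close>

definition fejer_const :: real where
  "fejer_const = (LINT x|lborel. fejer_quotient x)"

lemma fejer_const_pos: "fejer_const > 0"
proof -
  have "fejer_const \<noteq> 0"
  proof
    assume "fejer_const = 0"
    then have "AE x in lborel. fejer_quotient x = 0"
      unfolding fejer_const_def
      using integral_nonneg_eq_0_iff_AE[OF integrable_fejer_quotient] fejer_quotient_nonneg by auto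
    then have "AE x in lborel. x \<notin> {0<..<1::real}"
    proof eventually_elim
      case (elim x)
      then have "x = 0 \<or> cos x = cos 0"
        by (auto simp: fejer_quotient_def)
      then show ?case
        using cos_monotone_0_pi[of 0 x] pi_gt3 by fastforce
    qed
    then show False
      by (subst (asm) AE_iff_measurable[where N="{0<..<1}"]) auto
  qed
  moreover have "fejer_const \<ge> 0"
    unfolding fejer_const_def by (simp add: Bochner_Integration.integral_nonneg fejer_quotient_nonneg)
  ultimately show ?thesis by simp
qed

text \<open>The substitution costs \<open>1 / \<bar>a\<bar>\<close> from the measure and gains
  \<open>a^2\<close> from the quotient. The result is a multiple of \<open>\<bar>a\<bar>\<close>, so
  linear combinations of such integrals produce piecewise linear functions of the frequency, in
  particular a trapezoid.\<close>

lemma has_integral_fejer_scaled: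
  "has_bochner_integral lborel (\<lambda>x. (1 - cos (a * x)) / x\<^sup>2) (\<bar>a\<bar> * fejer_const)"
proof (cases "a = 0")
  case False
  have "has_bochner_integral lborel fejer_quotient fejer_const"
    by (simp add: has_bochner_integral_iff fejer_const_def integrable_fejer_quotient)
  then have "has_bochner_integral lborel (\<lambda>x. fejer_quotient (0 + a * x)) (fejer_const /\<^sub>R \<bar>a\<bar>)"
    using False by (subst (asm) lborel_has_bochner_integral_real_affine_iff[of a _ _ 0]) auto
  then have "has_bochner_integral lborel (\<lambda>x. a\<^sup>2 * fejer_quotient (0 + a * x)) (a\<^sup>2 * (fejer_const /\<^sub>R \<bar>a\<bar>))"
    by (intro has_bochner_integral_mult_right)
  moreover have "a\<^sup>2 * (fejer_const /\<^sub>R \<bar>a\<bar>) = \<bar>a\<bar> * fejer_const"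
    using False by (auto simp: field_simps power2_eq_square abs_if)
  moreover have "(\<lambda>x. a\<^sup>2 * fejer_quotient (0 + a * x)) = (\<lambda>x. (1 - cos (a * x)) / x\<^sup>2)"
    using False by (auto simp: fejer_quotient_def power_mult_distrib)
  ultimately show ?thesis by metis
qed (simp add: has_bochner_integral_zero)

text \<open>
  A de la Vallee Poussin kernel: its Fourier transform is the trapezoid that equals \<open>1\<close> on
  \<open>[-L, L]\<close> and vanishes outside \<open>[-2L, 2L]\<close>.
\<close>

definition vp_kernel :: "real \<Rightarrow> real \<Rightarrow> real" where
  "vp_kernel L x = (cos (L * x) - cos (2 * L * x)) / x\<^sup>2 / (L * fejer_const)"

lemma vp_kernel_measurable [measurable]: "vp_kernel L \<in> borel_measurable borel"
  unfolding vp_kernel_def by measurable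

lemma integrable_vp_kernel: "integrable lborel (vp_kernel L)"
proof -
  have "integrable lborel (\<lambda>x. ((1 - cos ((2 * L) * x)) / x\<^sup>2 - (1 - cos (L * x)) / x\<^sup>2) / (L * fejer_const))"
    by (intro integrable_divide Bochner_Integration.integrable_diff
        integrable.intros[OF has_integral_fejer_scaled])
  moreover have "(\<lambda>x. ((1 - cos ((2 * L) * x)) / x\<^sup>2 - (1 - cos (L * x)) / x\<^sup>2) / (L * fejer_const)) = vp_kernel L"
    by (rule ext) (simp add: vp_kernel_def diff_divide_distrib)
  ultimately show ?thesis by simp
qed

text \<open>The numerator is of order \<open>x^2\<close> at the origin. Boundedness together with
  integrability will give square integrability of the kernel.\<close>

lemma vp_kernel_bounded: "\<exists>K. \<forall>x. \<bar>vp_kernel L x\<bar> \<le> K"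
proof (intro exI allI)
  fix x :: real
  define t where "t = L\<^sup>2 * x\<^sup>2"
  have t: "0 \<le> t" "(L * x)\<^sup>2 = t" "(2 * L * x)\<^sup>2 = 4 * t"
    by (simp_all add: t_def power_mult_distrib)
  have "\<bar>cos (L * x) - cos (2 * L * x)\<bar> \<le> 4 * t"
    using one_minus_cos_le[of "L * x"] one_minus_cos_le[of "2 * L * x"] t
      cos_le_one[of "L * x"] cos_le_one[of "2 * L * x"] by linarith
  then have "\<bar>cos (L * x) - cos (2 * L * x)\<bar> \<le> 4 * L\<^sup>2 * x\<^sup>2"
    by (simp add: t_def)
  then have "\<bar>(cos (L * x) - cos (2 * L * x)) / x\<^sup>2\<bar> \<le> 4 * L\<^sup>2"
    by (cases "x = 0") (auto simp: field_simps)
  then show "\<bar>vp_kernel L x\<bar> \<le> 4 * L\<^sup>2 / \<bar>L * fejer_const\<bar>"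
    unfolding vp_kernel_def abs_divide by (intro divide_right_mono) auto
qed

text \<open>The product of cosines splits into cosines at the frequencies
  \<open>2L \<plusminus> h\<close> and \<open>L \<plusminus> h\<close>, so the integral is a
  combination of four absolute values. For \<open>\<bar>h\<bar> \<le> L\<close> each of them opens
  with a positive sign, \<open>h\<close> cancels, and the plateau of the trapezoid appears.\<close>

lemma integral_cos_vp_kernel:
  assumes "\<bar>h\<bar> \<le> L" "0 < L"
  shows "has_bochner_integral lborel (\<lambda>x. cos (h * x) * vp_kernel L x) 1"
proof -
  let ?q = "\<lambda>a x. (1 - cos (a * x)) / x\<^sup>2"
  have "has_bochner_integral lborel
     (\<lambda>x. (?q (2 * L + h) x + ?q (2 * L - h) x - ?q (L + h) x - ?q (L - h) x) / (2 * L * fejer_const))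
     ((\<bar>2 * L + h\<bar> * fejer_const + \<bar>2 * L - h\<bar> * fejer_const
        - \<bar>L + h\<bar> * fejer_const - \<bar>L - h\<bar> * fejer_const) / (2 * L * fejer_const))"
    by (intro has_bochner_integral_divide has_bochner_integral_diff has_bochner_integral_add
        has_integral_fejer_scaled)
  moreover have "(\<bar>2 * L + h\<bar> * fejer_const + \<bar>2 * L - h\<bar> * fejer_const
        - \<bar>L + h\<bar> * fejer_const - \<bar>L - h\<bar> * fejer_const) / (2 * L * fejer_const) = 1"
  proof -
    have "\<bar>2 * L + h\<bar> = 2 * L + h" "\<bar>2 * L - h\<bar> = 2 * L - h" "\<bar>L + h\<bar> = L + h" "\<bar>L - h\<bar> = L - h"
      using assms by auto
    then show ?thesis
      using assms fejer_const_pos by (simp add: field_simps)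
  qed
  moreover have "(\<lambda>x. (?q (2 * L + h) x + ?q (2 * L - h) x - ?q (L + h) x - ?q (L - h) x) / (2 * L * fejer_const))
     = (\<lambda>x. cos (h * x) * vp_kernel L x)"
  proof
    fix x
    have "cos ((L + h) * x) + cos ((L - h) * x) = 2 * cos (h * x) * cos (L * x)"
      "cos ((2 * L + h) * x) + cos ((2 * L - h) * x) = 2 * cos (h * x) * cos (2 * L * x)"
      by (simp_all add: distrib_right left_diff_distrib cos_add cos_diff)
    then have "?q (2 * L + h) x + ?q (2 * L - h) x - ?q (L + h) x - ?q (L - h) x
      = 2 * (cos (h * x) * (cos (L * x) - cos (2 * L * x))) / x\<^sup>2"
      by (simp add: add_divide_distrib[symmetric] diff_divide_distrib[symmetric] algebra_simps)
    then show "(?q (2 * L + h) x + ?q (2 * L - h) x - ?q (L + h) x - ?q (L - h) x) / (2 * L * fejer_const)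
      = cos (h * x) * vp_kernel L x"
      by (simp add: vp_kernel_def)
  qed
  ultimately show ?thesis by simp
qed

lemma fourier_vp_kernel:
  assumes "\<bar>h\<bar> \<le> L" "0 < L"
  shows "(LINT x|lborel. exp (\<i> * complex_of_real (h * x)) * complex_of_real (vp_kernel L x)) = 1"
proof -
  have ci: "integrable lborel (\<lambda>x. cos (h * x) * vp_kernel L x)"
    and c1: "(LINT x|lborel. cos (h * x) * vp_kernel L x) = 1"
    using integral_cos_vp_kernel[OF assms] by (auto simp: has_bochner_integral_iff)
  have si: "integrable lborel (\<lambda>x. sin (h * x) * vp_kernel L x)"
    by (rule Bochner_Integration.integrable_bound[OF integrable_vp_kernel[of L]])
      (auto simp: abs_mult intro!: mult_left_le_one_le)
  \<comment> \<open>Reflection \<open>x \<mapsto> -x\<close>: the kernel is even and the sine is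
    odd.\<close>
  have "(LINT x|lborel. sin (h * x) * vp_kernel L x) = (LINT x|lborel. sin (h * (0 + -1 * x)) * vp_kernel L (0 + -1 * x))"
    by (subst lborel_integral_real_affine[where c="-1" and t=0]) auto
  also have "\<dots> = - (LINT x|lborel. sin (h * x) * vp_kernel L x)"
    by (simp add: vp_kernel_def)
  finally have s0: "(LINT x|lborel. sin (h * x) * vp_kernel L x) = 0" by simp
  have "(\<lambda>x. exp (\<i> * complex_of_real (h * x)) * complex_of_real (vp_kernel L x))
      = (\<lambda>x. complex_of_real (cos (h * x) * vp_kernel L x) + \<i> * complex_of_real (sin (h * x) * vp_kernel L x))"
    by (auto simp: exp_Euler sin_of_real[symmetric] cos_of_real[symmetric] algebra_simps)
  then show ?thesis
    using ci si c1 s0 by (simp del: of_real_mult)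
qed

section \<open>The kernel in several dimensions\<close>

lemma lborel_integral_prod_Basis:
  fixes f :: "'a::euclidean_space \<Rightarrow> real \<Rightarrow> 'b::{real_normed_field,banach,second_countable_topology}"
  assumes f: "\<And>b. b \<in> Basis \<Longrightarrow> integrable lborel (f b)"
  shows "integrable lborel (\<lambda>x. \<Prod>b\<in>Basis. f b (x \<bullet> b))"
    and "(LINT x|lborel. (\<Prod>b\<in>Basis. f b (x \<bullet> b))) = (\<Prod>b\<in>Basis. LINT x|lborel. f b x)"
proof -
  interpret product_sigma_finite "\<lambda>_::'a. lborel::real measure" ..
  let ?S = "\<lambda>y. \<Sum>b\<in>Basis. y b *\<^sub>R (b::'a)"
  have f': "f b \<in> borel_measurable borel" if "b \<in> Basis" for b
    using borel_measurable_integrable[OF f[OF that]] by simp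
  have meas: "(\<lambda>x. \<Prod>b\<in>Basis. f b (x \<bullet> b)) \<in> borel_measurable borel"
    by (intro borel_measurable_prod measurable_compose[OF _ f']) auto
  have S: "?S \<in> (\<Pi>\<^sub>M b\<in>Basis. lborel) \<rightarrow>\<^sub>M borel"
    by measurable
  have *: "(\<Prod>b\<in>Basis. f b (?S y \<bullet> b)) = (\<Prod>b\<in>Basis. f b (y b))" for y
    by (intro prod.cong) auto
  show "integrable lborel (\<lambda>x. \<Prod>b\<in>Basis. f b (x \<bullet> b))"
    by (subst lborel_eq, subst integrable_distr_eq[OF S meas], unfold *)
      (intro product_integrable_prod f, auto)
  show "(LINT x|lborel. (\<Prod>b\<in>Basis. f b (x \<bullet> b))) = (\<Prod>b\<in>Basis. LINT x|lborel. f b x)"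
    by (subst lborel_eq, subst integral_distr[OF S meas], unfold *)
      (intro product_integral_prod f, auto)
qed

definition vp_kernel_prod :: "real \<Rightarrow> 'a::euclidean_space \<Rightarrow> real" where
  "vp_kernel_prod L x = (\<Prod>b\<in>Basis. vp_kernel L (x \<bullet> b))"

lemma vp_kernel_prod_measurable [measurable]: "vp_kernel_prod L \<in> borel_measurable borel"
  unfolding vp_kernel_prod_def by measurable

lemma integrable_vp_kernel_prod: "integrable lborel (vp_kernel_prod L)"
  unfolding vp_kernel_prod_def
  by (intro lborel_integral_prod_Basis integrable_vp_kernel)

lemma vp_kernel_prod_bounded: "\<exists>K. \<forall>x::'a::euclidean_space. \<bar>vp_kernel_prod L x\<bar> \<le> K"
proof -
  obtain K where K: "\<bar>vp_kernel L x\<bar> \<le> K" for x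
    using vp_kernel_bounded by blast
  have "\<bar>vp_kernel_prod L x\<bar> \<le> (\<Prod>b\<in>(Basis::'a set). K)" for x :: 'a
    unfolding vp_kernel_prod_def abs_prod by (intro prod_mono) (auto simp: K)
  then show ?thesis by blast
qed

lemma integrable_vp_kernel_prod_power2: "integrable lborel (\<lambda>x::'a::euclidean_space. (vp_kernel_prod L x)\<^sup>2)"
proof -
  obtain K where K: "\<bar>vp_kernel_prod L x\<bar> \<le> K" for x :: 'a
    using vp_kernel_prod_bounded by blast
  have "norm ((vp_kernel_prod L x)\<^sup>2) \<le> norm (K * vp_kernel_prod L x)" for x :: 'a
    using mult_right_mono[of "\<bar>vp_kernel_prod L x\<bar>" "\<bar>K\<bar>" "\<bar>vp_kernel_prod L x\<bar>"] K[of x]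
    by (simp add: power2_eq_square abs_mult)
  then show ?thesis
    by (intro Bochner_Integration.integrable_bound[OF integrable_mult_right[OF integrable_vp_kernel_prod[of L], of K]]) auto
qed

text \<open>The exponential of an inner product is a product over the coordinates, so the integral
  factorises. The condition on \<open>h\<close> concerns each coordinate separately, which fits a
  cube as the domain.\<close>

lemma fourier_vp_kernel_prod:
  fixes h :: "'a::euclidean_space"
  assumes "\<And>b. b \<in> Basis \<Longrightarrow> \<bar>h \<bullet> b\<bar> \<le> L" "0 < L"
  shows "(LINT x|lborel. exp (\<i> * complex_of_real (h \<bullet> x)) * complex_of_real (vp_kernel_prod L x)) = 1"
proof -
  let ?f = "\<lambda>b x. exp (\<i> * complex_of_real ((h \<bullet> b) * x)) * complex_of_real (vp_kernel L x)"
  have f: "integrable lborel (?f b)" for b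
    by (rule Bochner_Integration.integrable_bound[OF integrable_vp_kernel[of L]]) (auto simp: norm_mult)
  have "exp (\<i> * complex_of_real (h \<bullet> x)) * complex_of_real (vp_kernel_prod L x) = (\<Prod>b\<in>Basis. ?f b (x \<bullet> b))" for x
    unfolding vp_kernel_prod_def prod.distrib of_real_prod
    by (subst euclidean_inner) (simp add: exp_sum sum_distrib_left)
  then show ?thesis
    using assms by (simp only: lborel_integral_prod_Basis(2)[of ?f, OF f]) (simp add: fourier_vp_kernel del: of_real_mult)
qed

text \<open>After translation by \<open>\<omega>\<close> this is the Fourier transform of the kernel
  at \<open>- u\<close>, which lies on the plateau: characters with frequency in the cube are fixed
  by integration against the translated kernel.\<close>

lemma reproducing_exp:
  fixes u \<omega> :: "'a::euclidean_space"
  assumes "\<And>b. b \<in> Basis \<Longrightarrow> \<bar>u \<bullet> b\<bar> \<le> L" "0 < L"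
  shows "(LINT \<eta>|lborel. exp (- \<i> * complex_of_real (u \<bullet> \<eta>)) * complex_of_real (vp_kernel_prod L (\<eta> - \<omega>)))
    = exp (- \<i> * complex_of_real (u \<bullet> \<omega>))"
proof -
  let ?f = "\<lambda>\<eta>. exp (- \<i> * complex_of_real (u \<bullet> \<eta>)) * complex_of_real (vp_kernel_prod L (\<eta> - \<omega>))"
  have "(LINT \<eta>|lborel. ?f \<eta>) = (LINT \<eta>|distr lborel borel ((+) \<omega>). ?f \<eta>)"
    by (simp add: lborel_distr_plus)
  also have "\<dots> = (LINT x|lborel. ?f (\<omega> + x))"
    by (rule integral_distr) auto
  also have "\<dots> = (LINT x|lborel. exp (- \<i> * complex_of_real (u \<bullet> \<omega>)) *
      (exp (\<i> * complex_of_real ((- u) \<bullet> x)) * complex_of_real (vp_kernel_prod L x)))"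
    by (intro Bochner_Integration.integral_cong) (simp_all add: inner_add_right distrib_left exp_diff exp_minus field_simps)
  also have "\<dots> = exp (- \<i> * complex_of_real (u \<bullet> \<omega>)) * 1"
    using assms by (subst integral_mult_right_zero, subst fourier_vp_kernel_prod) auto
  finally show ?thesis by simp
qed


section \<open>Functions reproduced by the kernel\<close>

lemma Cauchy_Schwarz_integral:
  fixes f h :: "'a \<Rightarrow> complex"
  assumes [measurable]: "f \<in> borel_measurable M" "h \<in> borel_measurable M"
    and f: "integrable M (\<lambda>x. (norm (f x))\<^sup>2)" and h: "integrable M (\<lambda>x. (norm (h x))\<^sup>2)"
  shows "integrable M (\<lambda>x. f x * h x)"
    and "(norm (LINT x|M. f x * h x))\<^sup>2 \<le> (LINT x|M. (norm (f x))\<^sup>2) * (LINT x|M. (norm (h x))\<^sup>2)"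
proof -
  show int: "integrable M (\<lambda>x. f x * h x)"
  proof (rule Bochner_Integration.integrable_bound[OF Bochner_Integration.integrable_add[OF f h]])
    have "norm (f x * h x) \<le> norm ((norm (f x))\<^sup>2 + (norm (h x))\<^sup>2)" for x
    proof -
      have "0 \<le> norm (f x) * norm (h x)" "2 * norm (f x) * norm (h x) \<le> (norm (f x))\<^sup>2 + (norm (h x))\<^sup>2"
        by (auto simp: sum_squares_bound)
      then show ?thesis
        unfolding norm_mult real_norm_def by linarith
    qed
    then show "AE x in M. norm (f x * h x) \<le> norm ((norm (f x))\<^sup>2 + (norm (h x))\<^sup>2)" by simp
  qed measurable
  have "ennreal ((norm (LINT x|M. f x * h x))\<^sup>2) \<le> ennreal ((LINT x|M. norm (f x * h x))\<^sup>2)"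
    by (intro ennreal_leI power_mono integral_norm_bound) auto
  also have "\<dots> = (\<integral>\<^sup>+x. ennreal (norm (f x)) * ennreal (norm (h x)) \<partial>M)\<^sup>2"
    using int by (simp add: ennreal_power[symmetric] nn_integral_eq_integral ennreal_mult[symmetric] norm_mult
        integrable_norm[of M "\<lambda>x. f x * h x", unfolded norm_mult])
  also have "\<dots> \<le> (\<integral>\<^sup>+x. (ennreal (norm (f x)))\<^sup>2 \<partial>M) * (\<integral>\<^sup>+x. (ennreal (norm (h x)))\<^sup>2 \<partial>M)"
    by (rule Cauchy_Schwarz_nn_integral) measurable
  also have "\<dots> = ennreal ((LINT x|M. (norm (f x))\<^sup>2) * (LINT x|M. (norm (h x))\<^sup>2))"
    using f h by (simp add: ennreal_power nn_integral_eq_integral ennreal_mult)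
  finally show "(norm (LINT x|M. f x * h x))\<^sup>2 \<le> (LINT x|M. (norm (f x))\<^sup>2) * (LINT x|M. (norm (h x))\<^sup>2)"
    by (subst (asm) ennreal_le_iff) (auto intro!: mult_nonneg_nonneg)
qed

text \<open>The identity is required at every \<open>\<omega>\<close>, not only almost everywhere,
  because pointwise bounds are to be drawn from it. Integrability of the product is part of the
  property.\<close>

definition reproduced :: "real \<Rightarrow> ('a::euclidean_space \<Rightarrow> complex) \<Rightarrow> bool" where
  "reproduced L w \<longleftrightarrow> (\<forall>\<omega>. has_bochner_integral lborel
     (\<lambda>\<eta>. w \<eta> * complex_of_real (vp_kernel_prod L (\<eta> - \<omega>))) (w \<omega>))"

lemma reproduced_lincomb:
  assumes "\<And>i. i \<in> I \<Longrightarrow> reproduced L (w i)"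
  shows "reproduced L (\<lambda>\<omega>. \<Sum>i\<in>I. \<alpha> i * w i \<omega>)"
  unfolding reproduced_def sum_distrib_right mult.assoc
  using assms by (auto simp: reproduced_def intro!: has_bochner_integral_sum has_bochner_integral_mult_right)

lemma integral_vp_kernel_prod_shift:
  fixes \<omega> :: "'a::euclidean_space"
  shows "integrable lborel (\<lambda>\<eta>. vp_kernel_prod L (\<eta> - \<omega>))"
  "integrable lborel (\<lambda>\<eta>::'a::euclidean_space. (vp_kernel_prod L (\<eta> - \<omega>))\<^sup>2)"
  "(LINT \<eta>|lborel. (vp_kernel_prod L (\<eta> - \<omega>))\<^sup>2) = (LINT \<eta>::'a::euclidean_space|lborel. (vp_kernel_prod L \<eta>)\<^sup>2)"
proof -
  have d: "lborel = distr lborel borel ((+) \<omega>)"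
    by (simp add: lborel_distr_plus)
  show "integrable lborel (\<lambda>\<eta>. vp_kernel_prod L (\<eta> - \<omega>))"
    "integrable lborel (\<lambda>\<eta>. (vp_kernel_prod L (\<eta> - \<omega>))\<^sup>2)"
    by (subst d, subst integrable_distr_eq, auto simp: integrable_vp_kernel_prod integrable_vp_kernel_prod_power2)+
  show "(LINT \<eta>|lborel. (vp_kernel_prod L (\<eta> - \<omega>))\<^sup>2) = (LINT \<eta>::'a|lborel. (vp_kernel_prod L \<eta>)\<^sup>2)"
  proof -
    have "(LINT \<eta>|lborel. (vp_kernel_prod L (\<eta> - \<omega>))\<^sup>2)
      = (LINT \<eta>|distr lborel borel ((+) \<omega>). (vp_kernel_prod L (\<eta> - \<omega>))\<^sup>2)"
      by (simp add: lborel_distr_plus)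
    then show ?thesis
      by (subst (asm) integral_distr) auto
  qed
qed

text \<open>Cauchy-Schwarz for the reproducing identity. By translation invariance the L^2 norm of
  the shifted kernel does not depend on \<open>\<omega>\<close>, so one constant serves all
  points.\<close>

lemma reproduced_norm_bound:
  fixes w :: "'a::euclidean_space \<Rightarrow> complex"
  assumes w: "reproduced L w" and [measurable]: "w \<in> borel_measurable borel"
    and int: "integrable lborel (\<lambda>\<eta>. (norm (w \<eta>))\<^sup>2)"
  shows "(norm (w \<omega>))\<^sup>2 \<le> (LINT \<eta>::'a|lborel. (vp_kernel_prod L \<eta>)\<^sup>2) * (LINT \<eta>|lborel. (norm (w \<eta>))\<^sup>2)"
proof -
  have "w \<omega> = (LINT \<eta>|lborel. w \<eta> * complex_of_real (vp_kernel_prod L (\<eta> - \<omega>)))"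
    using w by (simp add: reproduced_def has_bochner_integral_iff)
  then show ?thesis
    using Cauchy_Schwarz_integral(2)[of w lborel "\<lambda>\<eta>. complex_of_real (vp_kernel_prod L (\<eta> - \<omega>))", OF _ _ int]
    by (simp add: integral_vp_kernel_prod_shift mult.commute)
qed

text \<open>A Borel version is needed for joint measurability in the Fubini argument on products of
  \<open>lborel\<close>. Since \<open>\<bar>z\<bar> \<le> \<bar>z\<bar>^2 + 1\<close> and
  \<open>D\<close> has finite measure, square integrability yields integrability.\<close>

lemma square_integrable_borel_version:
  fixes g :: "real^'d \<Rightarrow> complex"
  assumes g: "square_integrable g" and supp: "\<And>h. h \<notin> D \<Longrightarrow> g h = 0"
    and D: "D \<in> sets borel" "emeasure lborel D < \<infinity>"
  obtains g' where "g' \<in> borel_measurable borel" "integrable lborel g'" "\<And>h. h \<notin> D \<Longrightarrow> g' h = 0"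
    "\<And>\<omega>. fourier g \<omega> = complex_of_real (1 / (2 * pi) ^ CARD('d)) *
       (LINT h|lborel. exp (- \<i> * complex_of_real (h \<bullet> \<omega>)) * g' h)"
proof -
  have gm: "g \<in> borel_measurable lebesgue" and g2: "integrable lebesgue (\<lambda>h. (norm (g h))\<^sup>2)"
    using g by (auto simp: square_integrable_def)
  obtain g1 where g1 [measurable]: "g1 \<in> borel_measurable lborel" and AE1: "AE x in lborel. Re (g x) = g1 x"
    using completion_ex_borel_measurable_real[of "\<lambda>x. Re (g x)" lborel] gm by auto
  obtain g2 where g2' [measurable]: "g2 \<in> borel_measurable lborel" and AE2: "AE x in lborel. Im (g x) = g2 x"
    using completion_ex_borel_measurable_real[of "\<lambda>x. Im (g x)" lborel] gm by auto
  define g' where "g' h = indicator D h *\<^sub>R (complex_of_real (g1 h) + \<i> * complex_of_real (g2 h))" for h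
  have [measurable]: "D \<in> sets lborel" using D by simp
  have g'm: "g' \<in> borel_measurable lborel"
    unfolding g'_def by measurable
  have "AE h in lborel. g h = g' h"
    using AE1 AE2
  proof eventually_elim
    case (elim h)
    then show ?case
      using supp[of h] by (cases "h \<in> D") (auto simp: g'_def complex_eq_iff)
  qed
  then have AE: "AE h in lebesgue. g h = g' h"
    by (rule AE_completion)
  have g'l: "g' \<in> borel_measurable lebesgue"
    using g'm by (rule measurable_completion)
  have "integrable lebesgue (\<lambda>h. (norm (g' h))\<^sup>2)"
    using g2 by (rule integrable_cong_AE_imp) (use AE g'l in auto)
  then have sq: "integrable lborel (\<lambda>h. (norm (g' h))\<^sup>2)"
    using g'm by (subst (asm) integrable_completion) auto
  have int: "integrable lborel g'"
  proof (rule Bochner_Integration.integrable_bound[OF Bochner_Integration.integrable_add[OF sq]])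
    show "integrable lborel (indicator D :: _ \<Rightarrow> real)"
      using D by simp
    have "norm (g' h) \<le> norm ((norm (g' h))\<^sup>2 + indicator D h)" for h
    proof (cases "h \<in> D")
      case True
      have "norm (g' h) \<le> (norm (g' h))\<^sup>2 + 1"
        using sum_squares_bound[of "norm (g' h)" 1] norm_ge_zero[of "g' h"] by (simp only: power_one mult_1_right)
      then show ?thesis using True by simp
    qed (simp add: g'_def)
    then show "AE h in lborel. norm (g' h) \<le> norm ((norm (g' h))\<^sup>2 + indicator D h)"
      by simp
  qed (fact g'm)
  have "fourier g \<omega> = complex_of_real (1 / (2 * pi) ^ CARD('d)) *
       (LINT h|lborel. exp (- \<i> * complex_of_real (h \<bullet> \<omega>)) * g' h)" for \<omega>
  proof -
    have e: "(\<lambda>h. exp (- \<i> * complex_of_real (h \<bullet> \<omega>))) \<in> borel_measurable lborel"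
      by simp
    have "(LINT h|lebesgue. exp (- \<i> * complex_of_real (h \<bullet> \<omega>)) * g h)
      = (LINT h|lebesgue. exp (- \<i> * complex_of_real (h \<bullet> \<omega>)) * g' h)"
      by (intro integral_cong_AE borel_measurable_times measurable_completion[OF e] gm g'l) (use AE in auto)
    also have "\<dots> = (LINT h|lborel. exp (- \<i> * complex_of_real (h \<bullet> \<omega>)) * g' h)"
      by (intro integral_completion borel_measurable_times e g'm)
    finally show ?thesis by (simp add: fourier_def)
  qed
  moreover have "g' h = 0" if "h \<notin> D" for h
    using that by (simp add: g'_def)
  ultimately show ?thesis
    using that[of g'] int g'm by simp
qed

text \<open>The product is a superposition, with weight \<open>g h\<close>, of the characters with
  frequency \<open>s + h\<close>. Both \<open>s\<close> and \<open>h\<close> lie in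
  \<open>D\<close>, so each coordinate of \<open>s + h\<close> is at most \<open>2 * T\<close> in
  absolute value and every character is reproduced; Fubini moves the kernel inside the
  superposition.\<close>

lemma reproduced_fourier_exp:
  fixes g :: "real^'d \<Rightarrow> complex"
  assumes g: "square_integrable g" and supp: "\<And>h. h \<notin> D \<Longrightarrow> g h = 0"
    and D: "D = {s. \<forall>i. s $ i \<in> {-T..T}}" and T: "0 < T" and s: "s \<in> D"
  shows "fourier g \<in> borel_measurable borel"
    and "reproduced (2 * T) (\<lambda>\<omega>. fourier g \<omega> * exp (- \<i> * complex_of_real (s \<bullet> \<omega>)))"
proof -
  have Dbox: "D = cbox (\<chi> i. - T) (\<chi> i. T)"
    by (auto simp: D mem_box_cart)
  have D': "D \<in> sets borel" "emeasure lborel D < \<infinity>"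
    unfolding Dbox using emeasure_lborel_cbox_finite by auto
  obtain g' where g'm [measurable]: "g' \<in> borel_measurable borel" and g'i: "integrable lborel g'"
    and g'0: "\<And>h. h \<notin> D \<Longrightarrow> g' h = 0"
    and four: "\<And>\<omega>. fourier g \<omega> = complex_of_real (1 / (2 * pi) ^ CARD('d)) *
       (LINT h|lborel. exp (- \<i> * complex_of_real (h \<bullet> \<omega>)) * g' h)"
    by (rule square_integrable_borel_version[OF g supp D']) auto
  define c where "c = complex_of_real (1 / (2 * pi) ^ CARD('d))"
  have four': "fourier g = (\<lambda>\<omega>. c * (LINT h|lborel. exp (- \<i> * complex_of_real (h \<bullet> \<omega>)) * g' h))"
    by (simp add: fun_eq_iff four c_def)
  show meas [measurable]: "fourier g \<in> borel_measurable borel"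
    unfolding four' by measurable
  have bound: "norm (fourier g \<omega>) \<le> norm c * (LINT h|lborel. norm (g' h))" for \<omega>
  proof -
    have "norm (LINT h|lborel. exp (- \<i> * complex_of_real (h \<bullet> \<omega>)) * g' h)
      \<le> (LINT h|lborel. norm (exp (- \<i> * complex_of_real (h \<bullet> \<omega>)) * g' h))"
      by (rule integral_norm_bound)
    then show ?thesis
      by (simp add: four' norm_mult mult_left_mono)
  qed
  show "reproduced (2 * T) (\<lambda>\<omega>. fourier g \<omega> * exp (- \<i> * complex_of_real (s \<bullet> \<omega>)))"
    unfolding reproduced_def
  proof
    fix \<omega> :: "real^'d"
    let ?k = "\<lambda>\<eta>. complex_of_real (vp_kernel_prod (2 * T) (\<eta> - \<omega>))"
    let ?e = "\<lambda>u \<eta>::real^'d. exp (- \<i> * complex_of_real (u \<bullet> \<eta>))"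
    let ?F = "\<lambda>h \<eta>. g' h * (?e (s + h) \<eta> * ?k \<eta>)"
    have ki: "integrable lborel (\<lambda>\<eta>. norm (?k \<eta>))"
      using integral_vp_kernel_prod_shift(1)[of "2 * T" \<omega>] by simp
    \<comment> \<open>The exponential has modulus 1, so in absolute value the integrand is a product
      of an integrable function of \<open>h\<close> and an integrable function of
      \<open>\<eta>\<close>.\<close>
    have Fi: "integrable (lborel \<Otimes>\<^sub>M lborel) (case_prod ?F)"
    proof (rule lborel_pair.Fubini_integrable)
      show "integrable lborel (\<lambda>h. LINT \<eta>|lborel. norm (case (h, \<eta>) of (h, \<eta>) \<Rightarrow> ?F h \<eta>))"
        using g'i by (simp add: norm_mult)
      show "AE h in lborel. integrable lborel (\<lambda>\<eta>. case (h, \<eta>) of (h, \<eta>) \<Rightarrow> ?F h \<eta>)"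
      proof (rule AE_I2)
        fix h
        have "integrable lborel (\<lambda>\<eta>. ?e (s + h) \<eta> * ?k \<eta>)"
          by (rule Bochner_Integration.integrable_bound[OF ki]) (auto simp: norm_mult)
        then show "integrable lborel (\<lambda>\<eta>. case (h, \<eta>) of (h, \<eta>) \<Rightarrow> ?F h \<eta>)"
          by simp
      qed
    qed measurable
    have inner: "(LINT \<eta>|lborel. ?F h \<eta>) = g' h * ?e (s + h) \<omega>" for h
    proof (cases "h \<in> D")
      case True
      have "\<bar>(s + h) \<bullet> b\<bar> \<le> 2 * T" if b: "b \<in> Basis" for b
      proof -
        obtain i where bi: "b = axis i 1"
          using b by (auto simp: Basis_vec_def)
        have "\<bar>s $ i\<bar> \<le> T" "\<bar>h $ i\<bar> \<le> T"
          using s True unfolding D by (auto simp: abs_le_iff minus_le_iff)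
        then show ?thesis by (simp add: bi inner_axis inner_add_left)
      qed
      then have "(LINT \<eta>|lborel. ?e (s + h) \<eta> * ?k \<eta>) = ?e (s + h) \<omega>"
        using T by (intro reproducing_exp) auto
      then show ?thesis
        by (simp only: integral_mult_right_zero)
    qed (simp add: g'0)
    have outer: "fourier g \<eta> * ?e s \<eta> * ?k \<eta> = c * (LINT h|lborel. ?F h \<eta>)" for \<eta>
    proof -
      have "(LINT h|lborel. ?F h \<eta>) = (LINT h|lborel. (?e h \<eta> * g' h) * (?e s \<eta> * ?k \<eta>))"
        by (intro Bochner_Integration.integral_cong)
          (simp_all add: inner_add_left distrib_left exp_diff exp_minus field_simps)
      also have "\<dots> = (LINT h|lborel. ?e h \<eta> * g' h) * (?e s \<eta> * ?k \<eta>)"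
        by (rule integral_mult_left_zero)
      finally show ?thesis by (simp add: four')
    qed
    have "integrable lborel (\<lambda>\<eta>. fourier g \<eta> * ?e s \<eta> * ?k \<eta>)"
    proof (rule Bochner_Integration.integrable_bound[OF integrable_mult_right[OF ki]], rule_tac [2] AE_I2)
      fix \<eta> show "norm (fourier g \<eta> * ?e s \<eta> * ?k \<eta>)
        \<le> norm ((norm c * (LINT h|lborel. norm (g' h))) * norm (?k \<eta>))"
        using mult_right_mono[OF bound[of \<eta>] norm_ge_zero[of "?k \<eta>"]] by (simp add: norm_mult)
    qed measurable
    moreover have "(LINT \<eta>|lborel. fourier g \<eta> * ?e s \<eta> * ?k \<eta>) = fourier g \<omega> * ?e s \<omega>"
    proof -
      have "(LINT \<eta>|lborel. fourier g \<eta> * ?e s \<eta> * ?k \<eta>) = c * (LINT \<eta>|lborel. (LINT h|lborel. ?F h \<eta>))"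
        unfolding outer by (rule integral_mult_right_zero)
      also have "(LINT \<eta>|lborel. (LINT h|lborel. ?F h \<eta>)) = (LINT h|lborel. (LINT \<eta>|lborel. ?F h \<eta>))"
        by (rule lborel_pair.Fubini_integral[OF Fi])
      also have "\<dots> = (LINT h|lborel. (?e h \<omega> * g' h) * ?e s \<omega>)"
        unfolding inner
        by (intro Bochner_Integration.integral_cong)
          (simp_all add: inner_add_left distrib_left exp_diff exp_minus field_simps)
      also have "\<dots> = (LINT h|lborel. ?e h \<omega> * g' h) * ?e s \<omega>"
        by (rule integral_mult_left_zero)
      finally show ?thesis by (simp add: four')
    qed
    ultimately show "has_bochner_integral lborel (\<lambda>\<eta>. fourier g \<eta> * ?e s \<eta> * ?k \<eta>) (fourier g \<omega> * ?e s \<omega>)"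
      by (simp add: has_bochner_integral_iff)
  qed
qed

section \<open>The Hilbert-Schmidt bound\<close>

lemma norm_vec_power2: "(norm (x :: complex^'p))\<^sup>2 = (\<Sum>j\<in>UNIV. (norm (x $ j))\<^sup>2)"
  by (simp add: norm_vec_def L2_set_def sum_nonneg)

section \<open>Hermitian forms and the Loewner order\<close>

definition hform :: "complex^'p^'p \<Rightarrow> complex^'p \<Rightarrow> complex^'p \<Rightarrow> complex" where
  "hform A x y = (\<Sum>j\<in>UNIV. \<Sum>k\<in>UNIV. cnj (x $ j) * A $ j $ k * y $ k)"

lemma hform_eq: "hform A x y = (\<Sum>j\<in>UNIV. cnj (x $ j) * (A *v y) $ j)"
  by (simp add: hform_def matrix_vector_mult_def sum_distrib_left mult.assoc)

lemma hform_diff: "hform (A - B) x y = hform A x y - hform B x y"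
  by (simp add: hform_def algebra_simps sum_subtractf)

lemma hform_scaleR: "hform (c *\<^sub>R A) x y = complex_of_real c * hform A x y"
  by (simp add: hform_def sum_distrib_left scaleR_conv_of_real[where 'a=complex] mult_ac)

lemma hform_sum:
  "hform A (\<Sum>k\<in>K. \<alpha> k *s x k) (\<Sum>l\<in>K. \<alpha> l *s x l) = (\<Sum>k\<in>K. \<Sum>l\<in>K. cnj (\<alpha> k) * \<alpha> l * hform A (x k) (x l))"
proof -
  have "hform A (\<Sum>k\<in>K. \<alpha> k *s x k) (\<Sum>l\<in>K. \<alpha> l *s x l)
    = (\<Sum>i\<in>UNIV. \<Sum>j\<in>UNIV. \<Sum>k\<in>K. \<Sum>l\<in>K. cnj (\<alpha> k) * \<alpha> l * (cnj (x k $ i) * A $ i $ j * x l $ j))"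
    unfolding hform_def
    by (intro sum.cong refl) (simp add: cnj_sum sum_distrib_left sum_distrib_right mult_ac)
  also have "\<dots> = (\<Sum>i\<in>UNIV. \<Sum>k\<in>K. \<Sum>j\<in>UNIV. \<Sum>l\<in>K. cnj (\<alpha> k) * \<alpha> l * (cnj (x k $ i) * A $ i $ j * x l $ j))"
    by (intro sum.cong refl, rule sum.swap)
  also have "\<dots> = (\<Sum>k\<in>K. \<Sum>i\<in>UNIV. \<Sum>j\<in>UNIV. \<Sum>l\<in>K. cnj (\<alpha> k) * \<alpha> l * (cnj (x k $ i) * A $ i $ j * x l $ j))"
    by (rule sum.swap)
  also have "\<dots> = (\<Sum>k\<in>K. \<Sum>i\<in>UNIV. \<Sum>l\<in>K. \<Sum>j\<in>UNIV. cnj (\<alpha> k) * \<alpha> l * (cnj (x k $ i) * A $ i $ j * x l $ j))"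
    by (intro sum.cong refl, rule sum.swap)
  also have "\<dots> = (\<Sum>k\<in>K. \<Sum>l\<in>K. \<Sum>i\<in>UNIV. \<Sum>j\<in>UNIV. cnj (\<alpha> k) * \<alpha> l * (cnj (x k $ i) * A $ i $ j * x l $ j))"
    by (intro sum.cong refl, rule sum.swap)
  finally show ?thesis
    by (simp add: hform_def sum_distrib_left)
qed

lemma hform_Phi: "hform (Phi \<phi> \<omega>) x x = complex_of_real (\<Sum>j\<in>UNIV. (\<phi> \<omega> $ j * norm (x $ j))\<^sup>2)"
proof -
  have "hform (Phi \<phi> \<omega>) x x = (\<Sum>j\<in>UNIV. cnj (x $ j) * complex_of_real ((\<phi> \<omega> $ j)\<^sup>2) * x $ j)"
    unfolding hform_def
  proof (rule sum.cong[OF refl])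
    fix j
    have "(\<Sum>k\<in>UNIV. cnj (x $ j) * Phi \<phi> \<omega> $ j $ k * x $ k)
      = (\<Sum>k\<in>UNIV. if k = j then cnj (x $ j) * complex_of_real ((\<phi> \<omega> $ j)\<^sup>2) * x $ j else 0)"
      by (intro sum.cong) (auto simp: Phi_def diag_def)
    then show "(\<Sum>k\<in>UNIV. cnj (x $ j) * Phi \<phi> \<omega> $ j $ k * x $ k) = cnj (x $ j) * complex_of_real ((\<phi> \<omega> $ j)\<^sup>2) * x $ j"
      by simp
  qed
  also have "\<dots> = (\<Sum>j\<in>UNIV. complex_of_real ((\<phi> \<omega> $ j * norm (x $ j))\<^sup>2))"
    by (intro sum.cong refl) (simp only: power_mult_distrib of_real_mult complex_norm_square mult_ac)
  finally show ?thesis by (simp only: of_real_sum)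
qed

lemma psd_hform: "psd A \<Longrightarrow> 0 \<le> Re (hform A x x)"
  by (simp add: psd_def hform_eq)

lemma loewner_le_hform:
  "loewner_le (c *\<^sub>R Phi \<phi> \<omega>) A \<Longrightarrow> c * (\<Sum>j\<in>UNIV. (\<phi> \<omega> $ j * norm (x $ j))\<^sup>2) \<le> Re (hform A x x)"
  "loewner_le A (c *\<^sub>R Phi \<phi> \<omega>) \<Longrightarrow> Re (hform A x x) \<le> c * (\<Sum>j\<in>UNIV. (\<phi> \<omega> $ j * norm (x $ j))\<^sup>2)"
proof -
  have s: "hform (c *\<^sub>R Phi \<phi> \<omega>) x x = complex_of_real (c * (\<Sum>j\<in>UNIV. (\<phi> \<omega> $ j * norm (x $ j))\<^sup>2))"
    by (simp only: hform_scaleR hform_Phi of_real_mult)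
  show "loewner_le (c *\<^sub>R Phi \<phi> \<omega>) A \<Longrightarrow> c * (\<Sum>j\<in>UNIV. (\<phi> \<omega> $ j * norm (x $ j))\<^sup>2) \<le> Re (hform A x x)"
    unfolding loewner_le_def using psd_hform[of "A - c *\<^sub>R Phi \<phi> \<omega>" x]
    by (simp only: hform_diff s minus_complex.sel Re_complex_of_real) simp
  show "loewner_le A (c *\<^sub>R Phi \<phi> \<omega>) \<Longrightarrow> Re (hform A x x) \<le> c * (\<Sum>j\<in>UNIV. (\<phi> \<omega> $ j * norm (x $ j))\<^sup>2)"
    unfolding loewner_le_def using psd_hform[of "c *\<^sub>R Phi \<phi> \<omega> - A" x]
    by (simp only: hform_diff s minus_complex.sel Re_complex_of_real) simp
qed

lemma Cauchy_Schwarz_integral_vec: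
  fixes f h :: "'a \<Rightarrow> complex^'p"
  assumes [measurable]: "\<And>j. (\<lambda>x. f x $ j) \<in> borel_measurable M" "\<And>j. (\<lambda>x. h x $ j) \<in> borel_measurable M"
    and f: "integrable M (\<lambda>x. (norm (f x))\<^sup>2)" and h: "integrable M (\<lambda>x. (norm (h x))\<^sup>2)"
  shows "integrable M (\<lambda>x. \<Sum>j\<in>UNIV. cnj (f x $ j) * h x $ j)"
    and "(norm (LINT x|M. (\<Sum>j\<in>UNIV. cnj (f x $ j) * h x $ j)))\<^sup>2
      \<le> (LINT x|M. (norm (f x))\<^sup>2) * (LINT x|M. (norm (h x))\<^sup>2)"
proof -
  have norm_meas: "(\<lambda>x. norm (k x)) \<in> borel_measurable M" if [measurable]: "\<And>j. (\<lambda>x. k x $ j) \<in> borel_measurable M"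
    for k :: "'a \<Rightarrow> complex^'p"
    unfolding norm_vec_def L2_set_def by measurable
  have [measurable]: "(\<lambda>x. norm (f x)) \<in> borel_measurable M" "(\<lambda>x. norm (h x)) \<in> borel_measurable M"
    by (auto intro!: norm_meas)
  have [measurable]: "(\<lambda>x. cnj (f x $ j)) \<in> borel_measurable M" for j
    by (rule measurable_compose[OF assms(1) borel_measurable_continuous_onI]) (intro continuous_intros)
  let ?F = "\<lambda>x. complex_of_real (norm (f x))" and ?H = "\<lambda>x. complex_of_real (norm (h x))"
  have CS: "integrable M (\<lambda>x. ?F x * ?H x)"
    "(norm (LINT x|M. ?F x * ?H x))\<^sup>2 \<le> (LINT x|M. (norm (f x))\<^sup>2) * (LINT x|M. (norm (h x))\<^sup>2)"
    using Cauchy_Schwarz_integral[of ?F M ?H] f h by auto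
  have int: "integrable M (\<lambda>x. norm (f x) * norm (h x))"
    using integrable_norm[OF CS(1)] by (simp add: norm_mult)
  have pt: "norm (\<Sum>j\<in>UNIV. cnj (f x $ j) * h x $ j) \<le> norm (f x) * norm (h x)" for x
  proof -
    have "norm (\<Sum>j\<in>UNIV. cnj (f x $ j) * h x $ j) \<le> (\<Sum>j\<in>UNIV. \<bar>norm (f x $ j)\<bar> * \<bar>norm (h x $ j)\<bar>)"
      by (intro sum_norm_le) (simp add: norm_mult)
    also have "\<dots> \<le> norm (f x) * norm (h x)"
      unfolding norm_vec_def by (rule L2_set_mult_ineq)
    finally show ?thesis .
  qed
  show int': "integrable M (\<lambda>x. \<Sum>j\<in>UNIV. cnj (f x $ j) * h x $ j)"
    by (rule Bochner_Integration.integrable_bound[OF int]) (auto simp: pt)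
  have "norm (LINT x|M. (\<Sum>j\<in>UNIV. cnj (f x $ j) * h x $ j)) \<le> (LINT x|M. norm (f x) * norm (h x))"
    by (rule order_trans[OF integral_norm_bound integral_mono]) (use int int' pt in auto)
  also have "\<dots> = norm (LINT x|M. ?F x * ?H x)"
    by (simp add: integral_nonneg flip: of_real_mult)
  finally have "(norm (LINT x|M. (\<Sum>j\<in>UNIV. cnj (f x $ j) * h x $ j)))\<^sup>2 \<le> (norm (LINT x|M. ?F x * ?H x))\<^sup>2"
    by (rule power_mono) simp
  then show "(norm (LINT x|M. (\<Sum>j\<in>UNIV. cnj (f x $ j) * h x $ j)))\<^sup>2
      \<le> (LINT x|M. (norm (f x))\<^sup>2) * (LINT x|M. (norm (h x))\<^sup>2)"
    using CS(2) by linarith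
qed

lemma norm_mult_le_matrix_norm: "norm (A *v x) \<le> matrix_norm A * norm (x :: complex^'p)"
proof -
  have "linear ((*v) A)"
  proof (rule linearI)
    show "A *v (r *\<^sub>R y) = r *\<^sub>R (A *v y)" for r y
      by (simp add: matrix_vector_mult_def vec_eq_iff scaleR_sum_right)
  qed (rule matrix_vector_right_distrib)
  then have "bounded_linear ((*v) A)"
    by (simp add: linear_conv_bounded_linear)
  then show ?thesis
    unfolding matrix_norm_def by (rule onorm)
qed

text \<open>Each outer factor cancels one weight \<open>\<phi>\<close>. Positivity of
  \<open>\<phi>\<close> is what identifies
  \<open>((\<phi> \<omega> $ j)\<^sup>2) powr (-1/2)\<close> with
  \<open>1 / \<phi> \<omega> $ j\<close>.\<close>

lemma hform_weighted:
  assumes "\<And>j. \<phi> \<omega> $ j > 0"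
  shows "hform A x y = (\<Sum>j\<in>UNIV. cnj (complex_of_real (\<phi> \<omega> $ j) * x $ j) *
    ((Phi_inv_sqrt \<phi> \<omega> ** A ** Phi_inv_sqrt \<phi> \<omega>) *v (\<chi> j. complex_of_real (\<phi> \<omega> $ j) * y $ j)) $ j)"
proof -
  have inv: "((\<phi> \<omega> $ j)\<^sup>2) powr (-1/2) = 1 / \<phi> \<omega> $ j" for j
  proof -
    have "((\<phi> \<omega> $ j)\<^sup>2) powr (-1/2) = 1 / ((\<phi> \<omega> $ j)\<^sup>2) powr (1/2)"
      using powr_minus_divide[of "(\<phi> \<omega> $ j)\<^sup>2" "1/2"] by simp
    also have "\<dots> = 1 / \<phi> \<omega> $ j"
      using assms[of j] by (simp add: powr_half_sqrt)
    finally show ?thesis .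
  qed
  have d: "(diag f *v z) $ j = complex_of_real (f j) * z $ j" for f :: "'a \<Rightarrow> real" and z j
  proof -
    have "(diag f *v z) $ j = (\<Sum>k\<in>UNIV. if k = j then complex_of_real (f j) * z $ j else 0)"
      unfolding matrix_vector_mult_def vec_lambda_beta by (intro sum.cong) (auto simp: diag_def)
    then show ?thesis by simp
  qed
  have Pd: "Phi_inv_sqrt \<phi> \<omega> = diag (\<lambda>j. 1 / \<phi> \<omega> $ j)"
    by (simp only: Phi_inv_sqrt_def inv)
  have nz: "\<phi> \<omega> $ j \<noteq> 0" for j
    using assms[of j] by simp
  have y: "Phi_inv_sqrt \<phi> \<omega> *v (\<chi> j. complex_of_real (\<phi> \<omega> $ j) * y $ j) = y"
    by (simp add: vec_eq_iff Pd d nz)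
  have "((Phi_inv_sqrt \<phi> \<omega> ** A ** Phi_inv_sqrt \<phi> \<omega>) *v (\<chi> j. complex_of_real (\<phi> \<omega> $ j) * y $ j)) $ j
    = complex_of_real (1 / \<phi> \<omega> $ j) * (A *v y) $ j" for j
    unfolding matrix_vector_mul_assoc[symmetric] y by (simp add: Pd d)
  then show ?thesis
    unfolding hform_eq by (intro sum.cong refl) (simp add: nz)
qed

section \<open>Hilbert-Schmidt norm of the difference of the covariance forms\<close>

lemma borel_imp_lebesgue_measurable:
  "f \<in> borel_measurable borel \<Longrightarrow> f \<in> borel_measurable lebesgue"
  by (rule measurable_completion) simp

text \<open>Orthonormality enters twice. For fixed \<open>l\<close>, the sum over \<open>k\<close>
  is controlled by Bessel's inequality for the system \<open>w\<close>, with constant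
  \<open>1 / c\<close>. The sum over \<open>l\<close> is then taken inside the integral, where the
  pointwise bound on the system gives \<open>\<kappa> / c\<close> for each of the
  \<open>CARD('p)\<close> coordinates.\<close>

lemma hilbert_schmidt_bound:
  fixes F\<^sub>0 F\<^sub>1 :: "real^'d \<Rightarrow> complex^'p^'p" and \<phi> :: "real^'d \<Rightarrow> real^'p"
    and v :: "nat \<Rightarrow> real^'d \<Rightarrow> complex^'p"
  assumes pos: "\<And>\<omega> j. \<phi> \<omega> $ j > 0"
    and \<phi>_meas [measurable]: "\<And>j. (\<lambda>\<omega>. \<phi> \<omega> $ j) \<in> borel_measurable borel"
    and c: "0 < c" and lower: "\<And>\<omega>. loewner_le (c *\<^sub>R Phi \<phi> \<omega>) (F\<^sub>0 \<omega>)"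
    and F0 [measurable]: "\<And>j k. (\<lambda>\<omega>. F\<^sub>0 \<omega> $ j $ k) \<in> borel_measurable lebesgue"
    and F1 [measurable]: "\<And>j k. (\<lambda>\<omega>. F\<^sub>1 \<omega> $ j $ k) \<in> borel_measurable lebesgue"
    and v_meas [measurable]: "\<And>k j. k < n \<Longrightarrow> (\<lambda>\<omega>. v k \<omega> $ j) \<in> borel_measurable borel"
    and rep: "\<And>k j. k < n \<Longrightarrow> reproduced L (\<lambda>\<omega>. complex_of_real (\<phi> \<omega> $ j) * v k \<omega> $ j)"
    and ortho: "\<And>k l. k < n \<Longrightarrow> l < n \<Longrightarrow>
      has_bochner_integral lebesgue (\<lambda>\<omega>. hform (F\<^sub>0 \<omega>) (v k \<omega>) (v l \<omega>)) (of_bool (k = l))"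
    and G: "(\<integral>\<^sup>+\<omega>. ennreal ((matrix_norm (Phi_inv_sqrt \<phi> \<omega> ** (F\<^sub>1 \<omega> - F\<^sub>0 \<omega>) ** Phi_inv_sqrt \<phi> \<omega>))\<^sup>2) \<partial>lebesgue)
      \<le> ennreal I" and I: "0 \<le> I"
  defines "\<kappa> \<equiv> LINT \<omega>::real^'d|lborel. (vp_kernel_prod L \<omega>)\<^sup>2"
  shows "(\<Sum>k<n. \<Sum>l<n. (norm (LINT \<omega>|lebesgue. hform (F\<^sub>1 \<omega> - F\<^sub>0 \<omega>) (v k \<omega>) (v l \<omega>)))\<^sup>2)
    \<le> (1 / c) * ((real CARD('p) * \<kappa> / c) * I)"
proof -
  have \<kappa>: "0 \<le> \<kappa>" by (simp add: \<kappa>_def)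
  have [measurable]: "(\<lambda>\<omega>. \<phi> \<omega> $ j) \<in> borel_measurable lebesgue" for j
    by (rule borel_imp_lebesgue_measurable) simp
  have [measurable]: "(\<lambda>\<omega>. v k \<omega> $ j) \<in> borel_measurable lebesgue" if "k < n" for k j
    by (rule borel_imp_lebesgue_measurable) (use that in simp)
  define w where "w k \<omega> = (\<chi> j. complex_of_real (\<phi> \<omega> $ j) * v k \<omega> $ j)" for k \<omega>
  define G where "G \<omega> = Phi_inv_sqrt \<phi> \<omega> ** (F\<^sub>1 \<omega> - F\<^sub>0 \<omega>) ** Phi_inv_sqrt \<phi> \<omega>" for \<omega>
  define y where "y l \<omega> = G \<omega> *v w l \<omega>" for l \<omega>
  define comb where "comb \<alpha> \<omega> = (\<Sum>k<n. \<alpha> k *s w k \<omega>)" for \<alpha> :: "nat \<Rightarrow> complex" and \<omega>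
  have comb_nth: "comb \<alpha> \<omega> $ j = (\<Sum>k<n. \<alpha> k * w k \<omega> $ j)" for \<alpha> \<omega> j
    by (simp add: comb_def)
  have w_meas: "(\<lambda>\<omega>. w k \<omega> $ j) \<in> borel_measurable borel" if "k < n" for k j
    unfolding w_def vec_lambda_beta using that by measurable
  have comb_borel: "(\<lambda>\<omega>. comb \<alpha> \<omega> $ j) \<in> borel_measurable borel" for \<alpha> j
    unfolding comb_nth by (intro borel_measurable_sum borel_measurable_times w_meas) auto
  have comb_meas: "(\<lambda>\<omega>. comb \<alpha> \<omega> $ j) \<in> borel_measurable lebesgue" for \<alpha> j
    by (rule borel_imp_lebesgue_measurable) (simp add: comb_borel)

  \<comment> \<open>Upper frame bound: the lower Loewner bound puts
    \<open>c * (norm (comb \<alpha> \<omega>))\<^sup>2\<close> below the form of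
    \<open>F\<^sub>0\<close>, and by orthonormality the integral of that form is the sum of the
    squared moduli of the coefficients.\<close>
  have comb_int: "integrable lebesgue (\<lambda>\<omega>. (norm (comb \<alpha> \<omega>))\<^sup>2)"
    and comb_le: "c * (LINT \<omega>|lebesgue. (norm (comb \<alpha> \<omega>))\<^sup>2) \<le> (\<Sum>k<n. (norm (\<alpha> k))\<^sup>2)" for \<alpha>
  proof -
    define x where "x \<omega> = (\<Sum>k<n. \<alpha> k *s v k \<omega>)" for \<omega>
    have "has_bochner_integral lebesgue (\<lambda>\<omega>. \<Sum>k<n. \<Sum>l<n. cnj (\<alpha> k) * \<alpha> l * hform (F\<^sub>0 \<omega>) (v k \<omega>) (v l \<omega>))
      (\<Sum>k<n. \<Sum>l<n. cnj (\<alpha> k) * \<alpha> l * of_bool (k = l))"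
      using ortho by (intro has_bochner_integral_sum has_bochner_integral_mult_right) auto
    moreover have "(\<Sum>k<n. \<Sum>l<n. cnj (\<alpha> k) * \<alpha> l * of_bool (k = l)) = complex_of_real (\<Sum>k<n. (norm (\<alpha> k))\<^sup>2)"
    proof -
      have "(\<Sum>l<n. cnj (\<alpha> k) * \<alpha> l * of_bool (k = l)) = complex_of_real ((norm (\<alpha> k))\<^sup>2)" if "k < n" for k
      proof -
        have "(\<Sum>l<n. cnj (\<alpha> k) * \<alpha> l * of_bool (k = l)) = (\<Sum>l<n. if l = k then cnj (\<alpha> k) * \<alpha> k else 0)"
          by (intro sum.cong) auto
        then show ?thesis
          using that by (simp only: complex_norm_square) (simp add: mult.commute)
      qed
      then show ?thesis by simp
    qed
    ultimately have hb: "has_bochner_integral lebesgue (\<lambda>\<omega>. hform (F\<^sub>0 \<omega>) (x \<omega>) (x \<omega>)) (complex_of_real (\<Sum>k<n. (norm (\<alpha> k))\<^sup>2))"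
      by (simp only: x_def hform_sum)
    have Re_int: "integrable lebesgue (\<lambda>\<omega>. Re (hform (F\<^sub>0 \<omega>) (x \<omega>) (x \<omega>)))"
      using hb by (intro integrable_Re) (rule integrable.intros)
    have Re_eq: "(LINT \<omega>|lebesgue. Re (hform (F\<^sub>0 \<omega>) (x \<omega>) (x \<omega>))) = (\<Sum>k<n. (norm (\<alpha> k))\<^sup>2)"
      using integral_Re[OF integrable.intros[OF hb]] has_bochner_integral_integral_eq[OF hb] by simp
    have pt: "c * (norm (comb \<alpha> \<omega>))\<^sup>2 \<le> Re (hform (F\<^sub>0 \<omega>) (x \<omega>) (x \<omega>))" for \<omega>
    proof -
      have "comb \<alpha> \<omega> $ j = complex_of_real (\<phi> \<omega> $ j) * x \<omega> $ j" for j
        by (simp add: comb_nth w_def x_def sum_distrib_left mult.left_commute)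
      then have "(norm (comb \<alpha> \<omega>))\<^sup>2 = (\<Sum>j\<in>UNIV. (\<phi> \<omega> $ j * norm (x \<omega> $ j))\<^sup>2)"
        using pos[of \<omega>] by (simp add: norm_vec_power2 norm_mult less_imp_le)
      then show ?thesis
        using loewner_le_hform(1)[OF lower, of \<omega> "x \<omega>"] by simp
    qed
    have [measurable]: "(\<lambda>\<omega>. (norm (comb \<alpha> \<omega>))\<^sup>2) \<in> borel_measurable lebesgue"
      unfolding norm_vec_power2 using comb_meas by measurable
    have "integrable lebesgue (\<lambda>\<omega>. c * (norm (comb \<alpha> \<omega>))\<^sup>2)"
      by (rule Bochner_Integration.integrable_bound[OF Re_int])
        (use pt c in \<open>auto simp: abs_mult intro: order_trans[OF _ abs_ge_self]\<close>)
    then show int: "integrable lebesgue (\<lambda>\<omega>. (norm (comb \<alpha> \<omega>))\<^sup>2)"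
      using c by simp
    have "(LINT \<omega>|lebesgue. c * (norm (comb \<alpha> \<omega>))\<^sup>2) \<le> (LINT \<omega>|lebesgue. Re (hform (F\<^sub>0 \<omega>) (x \<omega>) (x \<omega>)))"
      using int Re_int pt by (intro integral_mono) auto
    then show "c * (LINT \<omega>|lebesgue. (norm (comb \<alpha> \<omega>))\<^sup>2) \<le> (\<Sum>k<n. (norm (\<alpha> k))\<^sup>2)"
      by (simp add: Re_eq)
  qed

  have point: "(\<Sum>k<n. (norm (w k \<omega> $ j))\<^sup>2) \<le> \<kappa> / c" for \<omega> j
  proof -
    \<comment> \<open>Extremal coefficients for this fixed \<open>\<omega>\<close> and
      \<open>j\<close>: the combination then takes the value \<open>S\<close> at
      \<open>\<omega>\<close>, while its squared L^2 norm is at most \<open>S / c\<close>. The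
      reproducing bound reads \<open>S\<^sup>2 \<le> \<kappa> * S / c\<close>, and one factor
      \<open>S\<close> is cancelled.\<close>
    define \<alpha> where "\<alpha> k = cnj (w k \<omega> $ j)" for k
    define S where "S = (\<Sum>k<n. (norm (w k \<omega> $ j))\<^sup>2)"
    have S_eq: "comb \<alpha> \<omega> $ j = complex_of_real S"
      unfolding comb_nth S_def \<alpha>_def of_real_sum by (intro sum.cong refl) (simp only: complex_norm_square mult.commute)
    have S0: "0 \<le> S" by (simp add: S_def sum_nonneg)
    have \<alpha>S: "(\<Sum>k<n. (norm (\<alpha> k))\<^sup>2) = S" by (simp add: \<alpha>_def S_def)
    have comp_le: "(norm (comb \<alpha> \<eta> $ j))\<^sup>2 \<le> (norm (comb \<alpha> \<eta>))\<^sup>2" for \<eta>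
      by (rule power_mono[OF Finite_Cartesian_Product.norm_nth_le]) simp
    have meas2: "(\<lambda>\<eta>. (norm (comb \<alpha> \<eta> $ j))\<^sup>2) \<in> borel_measurable lborel"
      using comb_borel by measurable
    have int_j: "integrable lebesgue (\<lambda>\<eta>. (norm (comb \<alpha> \<eta> $ j))\<^sup>2)"
      by (rule Bochner_Integration.integrable_bound[OF comb_int[of \<alpha>]])
        (use comp_le comb_meas in \<open>auto intro!: borel_measurable_power borel_measurable_norm\<close>)
    then have int_jb: "integrable lborel (\<lambda>\<eta>. (norm (comb \<alpha> \<eta> $ j))\<^sup>2)"
      using meas2 by (simp add: integrable_completion)
    have "reproduced L (\<lambda>\<eta>. \<Sum>k<n. \<alpha> k * (complex_of_real (\<phi> \<eta> $ j) * v k \<eta> $ j))"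
      using rep by (intro reproduced_lincomb) auto
    then have "reproduced L (\<lambda>\<eta>. comb \<alpha> \<eta> $ j)"
      by (simp add: comb_nth w_def)
    from reproduced_norm_bound[OF this comb_borel int_jb, of \<omega>]
    have "S\<^sup>2 \<le> \<kappa> * (LINT \<eta>|lborel. (norm (comb \<alpha> \<eta> $ j))\<^sup>2)"
      using S0 by (simp add: S_eq \<kappa>_def)
    also have "(LINT \<eta>|lborel. (norm (comb \<alpha> \<eta> $ j))\<^sup>2) = (LINT \<eta>|lebesgue. (norm (comb \<alpha> \<eta> $ j))\<^sup>2)"
      by (rule integral_completion[OF meas2, symmetric])
    also have "\<kappa> * \<dots> \<le> \<kappa> * (LINT \<eta>|lebesgue. (norm (comb \<alpha> \<eta>))\<^sup>2)"
      using \<kappa> comp_le int_j comb_int by (intro mult_left_mono integral_mono) auto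
    also have "\<dots> \<le> \<kappa> * (S / c)"
      using comb_le[of \<alpha>] c \<kappa> by (intro mult_left_mono) (auto simp: \<alpha>S field_simps)
    finally have "S * S \<le> (\<kappa> / c) * S"
      by (simp add: power2_eq_square)
    then show ?thesis
      using S0 \<kappa> c mult_right_le_imp_le[of S S "\<kappa> / c"] unfolding S_def[symmetric] by (cases "S = 0") auto
  qed
  have w_sum: "(\<Sum>l<n. (norm (w l \<omega>))\<^sup>2) \<le> real CARD('p) * \<kappa> / c" for \<omega>
  proof -
    have "(\<Sum>l<n. (norm (w l \<omega>))\<^sup>2) = (\<Sum>j\<in>UNIV. \<Sum>l<n. (norm (w l \<omega> $ j))\<^sup>2)"
      unfolding norm_vec_power2 by (rule sum.swap)
    also have "\<dots> \<le> (\<Sum>j\<in>(UNIV::'p set). \<kappa> / c)"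
      using point by (rule sum_mono)
    finally show ?thesis by simp
  qed

  have y_meas: "(\<lambda>\<omega>. y l \<omega> $ j) \<in> borel_measurable lebesgue" if "l < n" for l j
    unfolding y_def G_def w_def Phi_inv_sqrt_def diag_def matrix_matrix_mult_def matrix_vector_mult_def
      vec_lambda_beta vector_minus_component
    using that by measurable
  have y_norm_meas: "(\<lambda>\<omega>. (norm (y l \<omega>))\<^sup>2) \<in> borel_measurable lebesgue" if "l < n" for l
    unfolding norm_vec_power2 using y_meas[OF that] by measurable
  define K where "K = real CARD('p) * \<kappa> / c"
  have K: "0 \<le> K" using \<kappa> c by (simp add: K_def)
  have y_le: "(\<Sum>l<n. (norm (y l \<omega>))\<^sup>2) \<le> K * (matrix_norm (G \<omega>))\<^sup>2" for \<omega>
  proof -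
    have "(\<Sum>l<n. (norm (y l \<omega>))\<^sup>2) \<le> (\<Sum>l<n. (matrix_norm (G \<omega>))\<^sup>2 * (norm (w l \<omega>))\<^sup>2)"
      unfolding y_def power_mult_distrib[symmetric]
      by (intro sum_mono power_mono norm_mult_le_matrix_norm) auto
    also have "\<dots> = (matrix_norm (G \<omega>))\<^sup>2 * (\<Sum>l<n. (norm (w l \<omega>))\<^sup>2)"
      by (simp add: sum_distrib_left)
    also have "\<dots> \<le> (matrix_norm (G \<omega>))\<^sup>2 * K"
      using w_sum by (intro mult_left_mono) (auto simp: K_def)
    finally show ?thesis by (simp add: mult.commute)
  qed
  have y_sum_meas: "(\<lambda>\<omega>. \<Sum>l<n. (norm (y l \<omega>))\<^sup>2) \<in> borel_measurable lebesgue"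
    using y_norm_meas by (intro borel_measurable_sum) auto
  \<comment> \<open>The factor \<open>K\<close> is pulled out of the integral of the entrywise
    measurable sum, before the comparison with \<open>matrix_norm\<close>; the latter then enters
    through monotonicity alone. This requires division by \<open>K\<close>, hence the separate case
    \<open>K = 0\<close>.\<close>
  have y_nn: "(\<integral>\<^sup>+\<omega>. ennreal (\<Sum>l<n. (norm (y l \<omega>))\<^sup>2) \<partial>lebesgue) \<le> ennreal (K * I)"
  proof (cases "K = 0")
    case True
    have "(\<Sum>l<n. (norm (y l \<omega>))\<^sup>2) = 0" for \<omega>
      using y_le[of \<omega>] True sum_nonneg[of "{..<n}" "\<lambda>l. (norm (y l \<omega>))\<^sup>2"] by auto
    then show ?thesis by simp
  next
    case False
    then have K': "0 < K" using K by simp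
    have "(\<integral>\<^sup>+\<omega>. ennreal (\<Sum>l<n. (norm (y l \<omega>))\<^sup>2) \<partial>lebesgue)
      = (\<integral>\<^sup>+\<omega>. ennreal K * ennreal ((\<Sum>l<n. (norm (y l \<omega>))\<^sup>2) / K) \<partial>lebesgue)"
      using K' by (intro nn_integral_cong) (simp add: ennreal_mult[symmetric] sum_nonneg)
    also have "\<dots> = ennreal K * (\<integral>\<^sup>+\<omega>. ennreal ((\<Sum>l<n. (norm (y l \<omega>))\<^sup>2) / K) \<partial>lebesgue)"
      using y_sum_meas by (intro nn_integral_cmult) auto
    also have "\<dots> \<le> ennreal K * (\<integral>\<^sup>+\<omega>. ennreal ((matrix_norm (G \<omega>))\<^sup>2) \<partial>lebesgue)"
      using y_le K' by (intro mult_left_mono nn_integral_mono ennreal_leI) (auto simp: field_simps)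
    also have "\<dots> \<le> ennreal K * ennreal I"
      using G by (intro mult_left_mono) (auto simp: G_def)
    finally show ?thesis using K I by (simp add: ennreal_mult)
  qed
  have y_sum_int: "integrable lebesgue (\<lambda>\<omega>. \<Sum>l<n. (norm (y l \<omega>))\<^sup>2)"
    using y_sum_meas y_nn by (intro integrableI_nonneg) (auto simp: sum_nonneg le_less_trans)
  have y_int: "integrable lebesgue (\<lambda>\<omega>. (norm (y l \<omega>))\<^sup>2)" if "l < n" for l
  proof (rule Bochner_Integration.integrable_bound[OF y_sum_int y_norm_meas[OF that]])
    have "(norm (y l \<omega>))\<^sup>2 \<le> (\<Sum>l<n. (norm (y l \<omega>))\<^sup>2)" for \<omega>
      using that by (intro member_le_sum) auto
    then show "AE \<omega> in lebesgue. norm ((norm (y l \<omega>))\<^sup>2) \<le> norm (\<Sum>l<n. (norm (y l \<omega>))\<^sup>2)"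
      by (auto intro: order_trans[OF _ abs_ge_self])
  qed
  have y_total: "(\<Sum>l<n. LINT \<omega>|lebesgue. (norm (y l \<omega>))\<^sup>2) \<le> K * I"
  proof -
    have "ennreal (LINT \<omega>|lebesgue. (\<Sum>l<n. (norm (y l \<omega>))\<^sup>2)) \<le> ennreal (K * I)"
      using y_nn by (subst (asm) nn_integral_eq_integral[OF y_sum_int]) (auto simp: sum_nonneg)
    then have "(LINT \<omega>|lebesgue. (\<Sum>l<n. (norm (y l \<omega>))\<^sup>2)) \<le> K * I"
      using K I by (subst (asm) ennreal_le_iff) auto
    then show ?thesis
      using y_int by (subst (asm) Bochner_Integration.integral_sum) auto
  qed

  have w_comb: "w k \<omega> = comb (\<lambda>i. of_bool (i = k)) \<omega>" if "k < n" for k \<omega>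
  proof -
    have "comb (\<lambda>i. of_bool (i = k)) \<omega> $ j = (\<Sum>i<n. if i = k then w k \<omega> $ j else 0)" for j
      unfolding comb_nth by (intro sum.cong) auto
    then show ?thesis using that by (simp add: vec_eq_iff)
  qed
  have bessel: "(\<Sum>k<n. (norm (LINT \<omega>|lebesgue. (\<Sum>j\<in>UNIV. cnj (w k \<omega> $ j) * y l \<omega> $ j)))\<^sup>2)
    \<le> (1 / c) * (LINT \<omega>|lebesgue. (norm (y l \<omega>))\<^sup>2)" if l: "l < n" for l
  proof -
    \<comment> \<open>The coefficients are tested against themselves: \<open>S\<close> is the inner
      product of \<open>comb \<beta>\<close> with \<open>y l\<close>, and the frame bound gives
      \<open>S\<^sup>2 \<le> (S / c) * E\<close>.\<close>
    define \<beta> where "\<beta> k = (LINT \<omega>|lebesgue. (\<Sum>j\<in>UNIV. cnj (w k \<omega> $ j) * y l \<omega> $ j))" for k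
    define S where "S = (\<Sum>k<n. (norm (\<beta> k))\<^sup>2)"
    define E where "E = (LINT \<omega>|lebesgue. (norm (y l \<omega>))\<^sup>2)"
    have S0: "0 \<le> S" and E0: "0 \<le> E" by (simp_all add: S_def E_def sum_nonneg)
    have wint: "integrable lebesgue (\<lambda>\<omega>. \<Sum>j\<in>UNIV. cnj (w k \<omega> $ j) * y l \<omega> $ j)" if "k < n" for k
      using Cauchy_Schwarz_integral_vec(1)[OF comb_meas y_meas[OF l] comb_int y_int[OF l], of "\<lambda>i. of_bool (i = k)"]
      by (simp add: w_comb[OF that])
    have "complex_of_real S = (\<Sum>k<n. cnj (\<beta> k) * \<beta> k)"
      unfolding S_def of_real_sum by (intro sum.cong refl) (simp only: complex_norm_square mult.commute)
    also have "\<dots> = (LINT \<omega>|lebesgue. (\<Sum>k<n. cnj (\<beta> k) * (\<Sum>j\<in>UNIV. cnj (w k \<omega> $ j) * y l \<omega> $ j)))"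
      using wint by (subst Bochner_Integration.integral_sum) (auto simp: \<beta>_def)
    also have "\<dots> = (LINT \<omega>|lebesgue. (\<Sum>j\<in>UNIV. cnj (comb \<beta> \<omega> $ j) * y l \<omega> $ j))"
    proof (intro Bochner_Integration.integral_cong refl)
      fix \<omega>
      have "(\<Sum>k<n. cnj (\<beta> k) * (\<Sum>j\<in>UNIV. cnj (w k \<omega> $ j) * y l \<omega> $ j))
        = (\<Sum>k<n. \<Sum>j\<in>UNIV. cnj (\<beta> k) * cnj (w k \<omega> $ j) * y l \<omega> $ j)"
        by (simp add: sum_distrib_left mult.assoc)
      also have "\<dots> = (\<Sum>j\<in>UNIV. \<Sum>k<n. cnj (\<beta> k) * cnj (w k \<omega> $ j) * y l \<omega> $ j)"
        by (rule sum.swap)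
      finally show "(\<Sum>k<n. cnj (\<beta> k) * (\<Sum>j\<in>UNIV. cnj (w k \<omega> $ j) * y l \<omega> $ j))
        = (\<Sum>j\<in>UNIV. cnj (comb \<beta> \<omega> $ j) * y l \<omega> $ j)"
        by (simp add: comb_nth cnj_sum sum_distrib_right)
    qed
    finally have "norm (LINT \<omega>|lebesgue. (\<Sum>j\<in>UNIV. cnj (comb \<beta> \<omega> $ j) * y l \<omega> $ j)) = S"
      using S0 by (metis norm_of_real abs_of_nonneg)
    then have "S\<^sup>2 \<le> (LINT \<omega>|lebesgue. (norm (comb \<beta> \<omega>))\<^sup>2) * E"
      using Cauchy_Schwarz_integral_vec(2)[OF comb_meas y_meas[OF l] comb_int y_int[OF l], of \<beta>]
      unfolding E_def by (simp only:)
    also have "\<dots> \<le> (S / c) * E"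
      using comb_le[of \<beta>] c E0 by (intro mult_right_mono) (auto simp: S_def field_simps)
    finally have "S * S \<le> S * (E / c)"
      by (simp add: power2_eq_square)
    then have "S \<le> E / c"
      using S0 E0 c mult_left_le_imp_le[of S S "E / c"] by (cases "S = 0") auto
    then show ?thesis by (simp add: S_def E_def \<beta>_def)
  qed
  have "(\<Sum>k<n. \<Sum>l<n. (norm (LINT \<omega>|lebesgue. hform (F\<^sub>1 \<omega> - F\<^sub>0 \<omega>) (v k \<omega>) (v l \<omega>)))\<^sup>2)
    = (\<Sum>k<n. \<Sum>l<n. (norm (LINT \<omega>|lebesgue. (\<Sum>j\<in>UNIV. cnj (w k \<omega> $ j) * y l \<omega> $ j)))\<^sup>2)"
  proof -
    have "hform (F\<^sub>1 \<omega> - F\<^sub>0 \<omega>) (v k \<omega>) (v l \<omega>) = (\<Sum>j\<in>UNIV. cnj (w k \<omega> $ j) * y l \<omega> $ j)" for k l \<omega>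
      using hform_weighted[of \<phi> \<omega>, OF pos] by (simp add: w_def y_def G_def)
    then show ?thesis by (simp only:)
  qed
  also have "\<dots> = (\<Sum>l<n. \<Sum>k<n. (norm (LINT \<omega>|lebesgue. (\<Sum>j\<in>UNIV. cnj (w k \<omega> $ j) * y l \<omega> $ j)))\<^sup>2)"
    by (rule sum.swap)
  also have "\<dots> \<le> (\<Sum>l<n. (1 / c) * (LINT \<omega>|lebesgue. (norm (y l \<omega>))\<^sup>2))"
    using bessel by (intro sum_mono) auto
  also have "\<dots> = (1 / c) * (\<Sum>l<n. LINT \<omega>|lebesgue. (norm (y l \<omega>))\<^sup>2)"
    by (simp add: sum_distrib_left)
  also have "\<dots> \<le> (1 / c) * (K * I)"
    using y_total c by (intro mult_left_mono) auto
  finally show ?thesis by (simp add: K_def)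
qed

section \<open>Spaces of centred Gaussian random variables\<close>

context prob_space
begin

lemma integrable_bounded [intro]:
  fixes f :: "'a \<Rightarrow> 'b::{banach, second_countable_topology}"
  assumes "f \<in> borel_measurable M" "\<And>x. norm (f x) \<le> C"
  shows "integrable M f"
  using assms by (intro integrable_const_bound[of _ C]) auto

text \<open>
  Adding a large constant to \<open>W\<close> makes it, up to normalisation, a probability density, so the
  uniqueness theorem for characteristic functions applies.
\<close>

lemma real_weight_eq_zero:
  fixes X :: "'a \<Rightarrow> real" and W :: "'a \<Rightarrow> real"
  assumes [measurable]: "X \<in> borel_measurable M" "W \<in> borel_measurable M"
    and bound: "\<And>x. \<bar>W x\<bar> \<le> C"
    and zero: "\<And>t. (LINT x|M. iexp (t * X x) * complex_of_real (W x)) = 0"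
    and A [measurable]: "A \<in> sets borel"
  shows "(LINT x|M. indicator A (X x) * W x) = 0"
proof -
  define K where "K = C + 1"
  have K: "0 < K" "\<bar>W x\<bar> \<le> K" for x
    using bound[of undefined] bound[of x] by (auto simp: K_def)
  define d where "d x = (K + W x) / K" for x
  have d0: "0 \<le> d x" for x
    using K(1) K(2)[of x] by (simp add: d_def)
  have dm [measurable]: "d \<in> borel_measurable M"
    unfolding d_def by measurable
  define N where "N = density M (\<lambda>x. ennreal (d x))"
  have Wi: "integrable M W"
    using bound by (intro integrable_bounded) auto
  have "(LINT x|M. complex_of_real (W x)) = 0"
    using zero[of 0] by simp
  then have W0: "(LINT x|M. W x) = 0"
    by simp
  have di: "integrable M d" and d1: "(LINT x|M. d x) = 1"
    using Wi W0 K(1) unfolding d_def by (simp_all add: prob_space)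
  have "prob_space N"
    by (rule prob_spaceI) (use di d1 d0 in \<open>simp add: N_def emeasure_density nn_integral_eq_integral cong: nn_integral_cong\<close>)
  interpret N: prob_space N by fact
  have XN: "X \<in> borel_measurable N"
    by (simp add: N_def)
  have char_eq: "char (distr N borel X) = char (distr M borel X)"
  proof
    fix t
    have "(LINT x|M. d x *\<^sub>R iexp (t * X x)) = (LINT x|M. iexp (t * X x) + iexp (t * X x) * complex_of_real (W x) / complex_of_real K)"
      using K(1) by (intro Bochner_Integration.integral_cong) (auto simp: d_def scaleR_conv_of_real field_simps)
    also have "\<dots> = (LINT x|M. iexp (t * X x))"
    proof (subst Bochner_Integration.integral_add)
      show "integrable M (\<lambda>x. iexp (t * X x))"
        by (intro integrable_bounded[of _ 1]) auto
      show "integrable M (\<lambda>x. iexp (t * X x) * complex_of_real (W x) / complex_of_real K)"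
        using bound by (intro integrable_divide integrable_bounded[of _ C]) (auto simp: norm_mult)
    qed (use zero[of t] in simp)
    finally show "char (distr N borel X) t = char (distr M borel X) t"
      by (simp add: char_def integral_distr XN integral_density N_def d0)
  qed
  have "distr N borel X = distr M borel X"
    using char_eq by (intro Levy_uniqueness real_distribution_distr N.real_distribution_distr XN) auto
  moreover have "(LINT x|N. indicator A (X x) :: real) = (LINT x|distr N borel X. indicator A x)"
    by (rule integral_distr[OF XN, symmetric]) simp
  moreover have "(LINT x|M. indicator A (X x) :: real) = (LINT x|distr M borel X. indicator A x)"
    by (rule integral_distr[symmetric]) auto
  ultimately have "(LINT x|N. indicator A (X x)) = (LINT x|M. indicator A (X x) :: real)"
    by metis
  then have "(LINT x|M. d x * indicator A (X x)) = (LINT x|M. indicator A (X x) :: real)"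
    by (simp add: integral_density N_def d0)
  moreover have "(LINT x|M. d x * indicator A (X x)) = (LINT x|M. indicator A (X x) + indicator A (X x) * W x / K)"
    using K(1) by (intro Bochner_Integration.integral_cong) (auto simp: d_def field_simps)
  moreover have "\<dots> = (LINT x|M. indicator A (X x)) + (LINT x|M. indicator A (X x) * W x) / K"
  proof (subst Bochner_Integration.integral_add)
    show "integrable M (\<lambda>x. indicator A (X x) :: real)"
      by (intro integrable_bounded[of _ 1]) (auto simp: indicator_def)
    show "integrable M (\<lambda>x. indicator A (X x) * W x / K)"
      using bound order_trans[OF abs_ge_zero bound]
      by (intro integrable_divide integrable_bounded[of _ C]) (auto simp: indicator_def)
  qed simp
  ultimately show ?thesis
    using K(1) by simp
qed

text \<open>Conjugation together with \<open>t \<mapsto> -t\<close> shows that \<open>cnj W\<close>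
  satisfies the same hypothesis, hence so do the real and imaginary parts of
  \<open>W\<close>.\<close>

lemma complex_weight_eq_zero:
  fixes X :: "'a \<Rightarrow> real" and W :: "'a \<Rightarrow> complex"
  assumes [measurable]: "X \<in> borel_measurable M" "W \<in> borel_measurable M"
    and bound: "\<And>x. norm (W x) \<le> C"
    and zero: "\<And>t. (LINT x|M. iexp (t * X x) * W x) = 0"
    and A [measurable]: "A \<in> sets borel"
  shows "(LINT x|M. indicator A (X x) * W x) = 0"
proof -
  have int: "integrable M (\<lambda>x. iexp (t * X x) * W x)" for t
    using bound by (intro integrable_bounded[of _ C]) (auto simp: norm_mult)
  have cnj_eq: "iexp (t * X x) * cnj (W x) = cnj (iexp ((- t) * X x) * W x)" for t x
    by (simp add: exp_cnj)
  have cnj0: "(LINT x|M. iexp (t * X x) * cnj (W x)) = 0" for t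
    using zero[of "- t"] by (simp only: cnj_eq Bochner_Integration.integral_cnj complex_cnj_zero)
  have int': "integrable M (\<lambda>x. iexp (t * X x) * cnj (W x))" for t
    unfolding cnj_eq by (intro integrable_cnj int)
  have bRe: "\<bar>Re (W x)\<bar> \<le> C" and bIm: "\<bar>Im (W x)\<bar> \<le> C" for x
    using abs_Re_le_cmod[of "W x"] abs_Im_le_cmod[of "W x"] bound[of x] by linarith+
  have "(LINT x|M. indicator A (X x) * Re (W x)) = 0"
  proof (rule real_weight_eq_zero[where C=C])
    fix t
    have "(LINT x|M. iexp (t * X x) * complex_of_real (Re (W x)))
      = (LINT x|M. (iexp (t * X x) * W x + iexp (t * X x) * cnj (W x)) / 2)"
      by (intro Bochner_Integration.integral_cong) (auto simp: complex_add_cnj distrib_left[symmetric])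
    then show "(LINT x|M. iexp (t * X x) * complex_of_real (Re (W x))) = 0"
      using int int' by (simp add: zero cnj0 del: of_real_mult)
  qed (use bRe in auto)
  moreover have "(LINT x|M. indicator A (X x) * Im (W x)) = 0"
  proof (rule real_weight_eq_zero[where C=C])
    fix t
    have "(LINT x|M. iexp (t * X x) * complex_of_real (Im (W x)))
      = (LINT x|M. (iexp (t * X x) * W x - iexp (t * X x) * cnj (W x)) / (2 * \<i>))"
    proof (intro Bochner_Integration.integral_cong refl)
      fix x
      have "complex_of_real (Im (W x)) = (W x - cnj (W x)) / (2 * \<i>)"
        by (simp add: complex_diff_cnj field_simps)
      then show "iexp (t * X x) * complex_of_real (Im (W x)) = (iexp (t * X x) * W x - iexp (t * X x) * cnj (W x)) / (2 * \<i>)"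
        by (simp only: right_diff_distrib diff_divide_distrib times_divide_eq_right)
    qed
    then show "(LINT x|M. iexp (t * X x) * complex_of_real (Im (W x))) = 0"
      using int int' by (simp add: zero cnj0 del: of_real_mult)
  qed (use bIm in auto)
  moreover have "integrable M (\<lambda>x. indicator A (X x) * W x)"
    using bound order_trans[OF norm_ge_zero bound] by (intro integrable_bounded[of _ C]) (auto simp: indicator_def)
  from integral_Re[OF this] integral_Im[OF this]
  have "Re (LINT x|M. indicator A (X x) * W x) = (LINT x|M. indicator A (X x) * Re (W x))"
    "Im (LINT x|M. indicator A (X x) * W x) = (LINT x|M. indicator A (X x) * Im (W x))"
    by (auto simp: indicator_def intro!: Bochner_Integration.integral_cong elim!: trans[OF sym])
  ultimately show ?thesis
    by (simp add: complex_eq_iff)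
qed

lemma complex_weight_prod_eq_zero:
  fixes X :: "'i \<Rightarrow> 'a \<Rightarrow> real" and W :: "'a \<Rightarrow> complex"
  assumes "finite I" and "\<And>i. i \<in> I \<Longrightarrow> X i \<in> borel_measurable M" and "W \<in> borel_measurable M"
    and "\<And>x. norm (W x) \<le> C"
    and "\<And>t. (LINT x|M. iexp (\<Sum>i\<in>I. t i * X i x) * W x) = 0"
    and "\<And>i. i \<in> I \<Longrightarrow> A i \<in> sets borel"
  shows "(LINT x|M. (\<Prod>i\<in>I. indicator (A i) (X i x)) * W x) = 0"
  using assms
proof (induction I arbitrary: W rule: finite_induct)
  case empty
  then show ?case by simp
next
  case (insert j I)
  note [measurable] = insert.prems(1)[OF insertI1] insert.prems(1)[OF insertI2] insert.prems(2)
    insert.prems(5)[OF insertI1]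
  have "(LINT x|M. (\<Prod>i\<in>I. indicator (A i) (X i x)) * (indicator (A j) (X j x) * W x)) = 0"
  proof (rule insert.IH)
    fix t
    have "(LINT x|M. indicator (A j) (X j x) * (iexp (\<Sum>i\<in>I. t i * X i x) * W x)) = 0"
    proof (rule complex_weight_eq_zero[where C=C])
      fix s
      have "(\<Sum>i\<in>insert j I. (t(j := s)) i * X i x) = s * X j x + (\<Sum>i\<in>I. t i * X i x)" for x
        using insert.hyps by (auto intro!: sum.cong)
      then show "(LINT x|M. iexp (s * X j x) * (iexp (\<Sum>i\<in>I. t i * X i x) * W x)) = 0"
        using insert.prems(4)[of "t(j := s)"] by (simp add: distrib_left exp_add mult.assoc)
    qed (use insert.prems in \<open>auto simp: norm_mult\<close>)
    then show "(LINT x|M. iexp (\<Sum>i\<in>I. t i * X i x) * (indicator (A j) (X j x) * W x)) = 0"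
      by (simp add: mult.left_commute)
  next
    show "norm (indicator (A j) (X j x) * W x) \<le> C" for x
      using insert.prems(3)[of x] order_trans[OF norm_ge_zero insert.prems(3)[of x]]
      by (auto simp: indicator_def)
  qed (use insert.prems in auto)
  then show ?case
    using insert.hyps by (simp add: mult.assoc mult.left_commute)
qed

end


section \<open>Centred Gaussian variables and their linear spaces\<close>

lemma std_normal_integrable:
  "integrable std_normal_distribution (\<lambda>x. x)" "integrable std_normal_distribution (\<lambda>x. x\<^sup>2)"
  using integrable_std_normal_moment[of 1] integrable_std_normal_moment[of 2]
  by (subst integrable_density, auto)+

lemma std_normal_mean: "(LINT x|std_normal_distribution. x) = 0"
  using integral_std_normal_moment_odd[of 0] by (subst integral_density) auto

lemma std_normal_second_moment: "(LINT x|std_normal_distribution. x\<^sup>2) = 1"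
  using integral_std_normal_moment_even[of 1] by (subst integral_density) (auto simp: fact_2)

text \<open>All moments are read off the standard normal law through the equality of distributions.
  The vanishing mean forces \<open>m = 0\<close>; the scale \<open>s\<close> may be zero or
  negative.\<close>

lemma gaussian_rv_moments:
  assumes "prob_space M" and X: "gaussian_rv M X" and mean: "(LINT x|M. X x) = 0"
  shows "integrable M X" and "integrable M (\<lambda>x. (X x)\<^sup>2)"
    and "\<exists>s. distr M borel X = distr std_normal_distribution borel (\<lambda>x. s * x) \<and> (LINT x|M. (X x)\<^sup>2) = s\<^sup>2"
proof -
  interpret prob_space M by fact
  have Xm [measurable]: "X \<in> borel_measurable M"
    using X by (simp add: gaussian_rv_def)
  obtain m s where law: "distr M borel X = distr std_normal_distribution borel (\<lambda>x. m + s * x)"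
    using X by (auto simp: gaussian_rv_def)
  have transfer: "integrable M (\<lambda>x. f (X x)) \<longleftrightarrow> integrable std_normal_distribution (\<lambda>x. f (m + s * x))"
      "(LINT x|M. f (X x)) = (LINT x|std_normal_distribution. f (m + s * x))"
    if [measurable]: "f \<in> borel_measurable borel" for f :: "real \<Rightarrow> real"
  proof -
    have "integrable M (\<lambda>x. f (X x)) \<longleftrightarrow> integrable (distr M borel X) f"
      by (rule integrable_distr_eq[symmetric]) auto
    also have "\<dots> \<longleftrightarrow> integrable std_normal_distribution (\<lambda>x. f (m + s * x))"
      unfolding law by (rule integrable_distr_eq) auto
    finally show "integrable M (\<lambda>x. f (X x)) \<longleftrightarrow> integrable std_normal_distribution (\<lambda>x. f (m + s * x))" .
    have "(LINT x|M. f (X x)) = (LINT x|distr M borel X. f x)"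
      by (rule integral_distr[symmetric]) auto
    also have "\<dots> = (LINT x|std_normal_distribution. f (m + s * x))"
      unfolding law by (rule integral_distr) auto
    finally show "(LINT x|M. f (X x)) = (LINT x|std_normal_distribution. f (m + s * x))" .
  qed
  have N: "prob_space std_normal_distribution"
    by (rule prob_space_normal_density) simp
  note i = std_normal_integrable and e = std_normal_mean std_normal_second_moment
  have const: "integrable std_normal_distribution (\<lambda>x. m)"
    using prob_space.finite_measure[OF N] by (rule finite_measure.integrable_const)
  have lin: "integrable std_normal_distribution (\<lambda>x. s * x)"
    using i(1) by (rule integrable_mult_right)
  show "integrable M X"
    by (subst transfer(1)[of "\<lambda>x. x"]) (auto intro: Bochner_Integration.integrable_add const lin)
  have "(LINT x|std_normal_distribution. m + s * x) = m"
    using e(1) prob_space.prob_space[OF N]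
    by (subst Bochner_Integration.integral_add[OF const lin]) simp
  then have "m = 0"
    using mean transfer(2)[of "\<lambda>x. x"] by simp
  have pw: "(\<lambda>x::real. x\<^sup>2) \<in> borel_measurable borel"
    by measurable
  have sq: "(m + s * x)\<^sup>2 = s\<^sup>2 * x\<^sup>2" for x
    by (simp add: \<open>m = 0\<close> power_mult_distrib)
  show "integrable M (\<lambda>x. (X x)\<^sup>2)"
    unfolding transfer(1)[OF pw] sq by (rule integrable_mult_right[OF i(2)])
  have "(LINT x|M. (X x)\<^sup>2) = s\<^sup>2"
    unfolding transfer(2)[OF pw] sq integral_mult_right_zero e by simp
  then show "\<exists>s. distr M borel X = distr std_normal_distribution borel (\<lambda>x. s * x) \<and> (LINT x|M. (X x)\<^sup>2) = s\<^sup>2"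
    using law \<open>m = 0\<close> by auto
qed

text \<open>A linear space whose elements are all centred Gaussian: closure under combinations
  encodes joint Gaussianity without any mention of random vectors.\<close>

locale gaussian_space = prob_space M for M :: "'a measure" +
  fixes V :: "('a \<Rightarrow> real) set"
  assumes gaussian: "X \<in> V \<Longrightarrow> gaussian_rv M X"
    and centred: "X \<in> V \<Longrightarrow> (LINT x|M. X x) = 0"
    and V_zero: "(\<lambda>x. 0) \<in> V"
    and V_add: "X \<in> V \<Longrightarrow> Y \<in> V \<Longrightarrow> (\<lambda>x. X x + Y x) \<in> V"
    and V_scale: "X \<in> V \<Longrightarrow> (\<lambda>x. c * X x) \<in> V"
begin

definition cov :: "('a \<Rightarrow> real) \<Rightarrow> ('a \<Rightarrow> real) \<Rightarrow> real" where
  "cov X Y = (LINT x|M. X x * Y x)"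

lemma V_measurable: "X \<in> V \<Longrightarrow> X \<in> borel_measurable M"
  using gaussian by (auto simp: gaussian_rv_def)

lemma V_integrable_mult:
  assumes "X \<in> V" "Y \<in> V"
  shows "integrable M (\<lambda>x. X x * Y x)"
proof (rule Bochner_Integration.integrable_bound)
  show "integrable M (\<lambda>x. (X x)\<^sup>2 + (Y x)\<^sup>2)"
    using assms gaussian_rv_moments(2)[OF prob_space_axioms gaussian centred] by auto
  show "(\<lambda>x. X x * Y x) \<in> borel_measurable M"
    using assms V_measurable by auto
  have "\<bar>a * b\<bar> \<le> a\<^sup>2 + b\<^sup>2" for a b :: real
    using sum_squares_bound[of "\<bar>a\<bar>" "\<bar>b\<bar>"] abs_ge_zero[of "a * b"] unfolding power2_abs abs_mult[of a b] by linarith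
  then show "AE x in M. norm (X x * Y x) \<le> norm ((X x)\<^sup>2 + (Y x)\<^sup>2)"
    by simp
qed

lemma V_sum: "(\<And>i. i \<in> I \<Longrightarrow> X i \<in> V) \<Longrightarrow> (\<lambda>x. \<Sum>i\<in>I. b i * X i x) \<in> V"
proof (induction I rule: infinite_finite_induct)
  case (insert j I)
  then have "(\<lambda>x. b j * X j x + (\<Sum>i\<in>I. b i * X i x)) \<in> V"
    by (intro V_add V_scale insert.IH) auto
  then show ?case using insert.hyps by simp
qed (auto intro: V_zero)

lemma V_diff: "X \<in> V \<Longrightarrow> Y \<in> V \<Longrightarrow> (\<lambda>x. X x - Y x) \<in> V"
  using V_add[of X "\<lambda>x. - 1 * Y x"] V_scale[of Y "- 1"] by simp

lemma cov_commute: "cov X Y = cov Y X"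
  by (simp add: cov_def mult.commute)

lemma cov_scale: "cov (\<lambda>x. b * X x) Y = b * cov X Y"
  by (simp add: cov_def mult.assoc)

lemma cov_add: "X \<in> V \<Longrightarrow> X' \<in> V \<Longrightarrow> Y \<in> V \<Longrightarrow> cov (\<lambda>x. X x + X' x) Y = cov X Y + cov X' Y"
  by (simp add: cov_def distrib_right V_integrable_mult)

lemma cov_diff: "X \<in> V \<Longrightarrow> X' \<in> V \<Longrightarrow> Y \<in> V \<Longrightarrow> cov (\<lambda>x. X x - X' x) Y = cov X Y - cov X' Y"
  by (simp add: cov_def left_diff_distrib V_integrable_mult)

lemma cov_scale_right: "cov X (\<lambda>x. b * Y x) = b * cov X Y"
  using cov_scale[of b Y X] by (simp only: cov_commute)

lemma cov_add_self:
  assumes "X \<in> V" "Y \<in> V"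
  shows "cov (\<lambda>x. X x + Y x) (\<lambda>x. X x + Y x) = cov X X + 2 * cov X Y + cov Y Y"
proof -
  have "(\<lambda>x. (X x + Y x) * (X x + Y x)) = (\<lambda>x. X x * X x + 2 * (X x * Y x) + Y x * Y x)"
    by (auto simp: algebra_simps)
  then show ?thesis
    using assms by (simp add: cov_def V_integrable_mult)
qed

lemma cov_sum:
  assumes "\<And>i. i \<in> I \<Longrightarrow> X i \<in> V" "Y \<in> V"
  shows "cov (\<lambda>x. \<Sum>i\<in>I. b i * X i x) Y = (\<Sum>i\<in>I. b i * cov (X i) Y)"
  using assms by (simp add: cov_def sum_distrib_right mult.assoc V_integrable_mult Bochner_Integration.integral_sum)

lemma cov_self_nonneg: "0 \<le> cov X X"
  by (simp add: cov_def)

lemma cov_self_eq_zeroD: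
  assumes "X \<in> V" "cov X X = 0"
  shows "AE x in M. X x = 0"
  using assms integral_nonneg_eq_0_iff_AE[OF V_integrable_mult[OF assms(1) assms(1)]] by (auto simp: cov_def)

lemma V_law:
  assumes X: "X \<in> V"
  obtains s where "distr M borel X = distr std_normal_distribution borel (\<lambda>x. s * x)" "cov X X = s\<^sup>2"
  using gaussian_rv_moments(3)[OF prob_space_axioms gaussian[OF X] centred[OF X]]
  by (auto simp: cov_def power2_eq_square)

lemma V_char:
  assumes X: "X \<in> V"
  shows "(LINT x|M. iexp (t * X x)) = complex_of_real (exp (- (t\<^sup>2 * cov X X) / 2))"
proof -
  have [measurable]: "X \<in> borel_measurable M" using X by (rule V_measurable)
  obtain s where s: "distr M borel X = distr std_normal_distribution borel (\<lambda>x. s * x)" "cov X X = s\<^sup>2"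
    by (rule V_law[OF X])
  have "(LINT x|M. iexp (t * X x)) = char (distr M borel X) t"
    unfolding char_def by (rule integral_distr[symmetric]) auto
  also have "\<dots> = (LINT x|std_normal_distribution. iexp (t * (s * x)))"
    unfolding char_def s by (rule integral_distr) auto
  also have "\<dots> = char std_normal_distribution (t * s)"
    by (simp add: char_def mult.assoc)
  finally show ?thesis
    by (simp only: char_std_normal_distribution s(2) power_mult_distrib)
qed

lemma V_normal:
  assumes X: "X \<in> V" and pos: "0 < cov X X"
  shows "distr M borel X = density lborel (normal_density 0 (sqrt (cov X X)))"
proof -
  obtain s where s: "distr M borel X = distr std_normal_distribution borel (\<lambda>x. s * x)" "cov X X = s\<^sup>2"
    by (rule V_law[OF X])
  then have "s \<noteq> 0" using pos by auto
  have N: "prob_space std_normal_distribution"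
    by (rule prob_space_normal_density) simp
  have "distributed std_normal_distribution lborel (\<lambda>x. x) std_normal_density"
    by (auto simp: distributed_def intro!: distr_id2)
  from prob_space.normal_density_affine[OF N this _ \<open>s \<noteq> 0\<close>, of 0]
  have "distr std_normal_distribution lborel (\<lambda>x. s * x) = density lborel (normal_density 0 \<bar>s\<bar>)"
    by (simp add: distributed_def)
  moreover have "distr std_normal_distribution lborel (\<lambda>x. s * x) = distr std_normal_distribution borel (\<lambda>x. s * x)"
    by (rule distr_cong) auto
  ultimately show ?thesis
    using s by simp
qed

text \<open>Uncorrelated Gaussian variables are independent. The factorised characteristic function
  is converted into a statement about events in two passes, since the inversion treats the variables
  \<open>X\<close> and the variable \<open>Y\<close> separately.\<close>

lemma V_uncorrelated_prob:
  assumes fin: "finite I" and XV: "\<And>i. i \<in> I \<Longrightarrow> X i \<in> V" and Y: "Y \<in> V"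
    and orth: "\<And>i. i \<in> I \<Longrightarrow> cov (X i) Y = 0"
    and A: "\<And>i. i \<in> I \<Longrightarrow> A i \<in> sets borel" and B: "B \<in> sets borel"
  shows "prob {x\<in>space M. (\<forall>i\<in>I. X i x \<in> A i) \<and> Y x \<in> B}
    = prob {x\<in>space M. \<forall>i\<in>I. X i x \<in> A i} * prob {x\<in>space M. Y x \<in> B}"
proof -
  note [measurable] = V_measurable[OF Y] V_measurable[OF XV] A B
  have [measurable]: "Measurable.pred M (\<lambda>x. \<forall>i\<in>I. X i x \<in> A i)"
    using fin by (intro pred_intros_finite) auto
  define J where "J x = (\<Prod>i\<in>I. indicator (A i) (X i x) :: real)" for x
  have Jm [measurable]: "J \<in> borel_measurable M"
    unfolding J_def by measurable
  have J01: "J x = indicator {x\<in>space M. \<forall>i\<in>I. X i x \<in> A i} x" if "x \<in> space M" for x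
    using that fin by (auto simp: J_def indicator_def prod_zero_iff)
  have J_abs: "\<bar>J x\<bar> \<le> 1" for x
    unfolding J_def abs_prod by (intro prod_le_1) (auto simp: indicator_def)
  define p where "p = (LINT x|M. J x)"
  have p: "p = prob {x\<in>space M. \<forall>i\<in>I. X i x \<in> A i}"
    unfolding p_def by (subst Bochner_Integration.integral_cong[OF refl J01]) auto
  \<comment> \<open>First pass: the weight is the centred exponential of \<open>Y\<close>, and its
    transform against any combination of the \<open>X i\<close> vanishes because variances of
    orthogonal elements add.\<close>
  have char_zero: "(LINT x|M. complex_of_real (J x) * (iexp (s * Y x) - complex_of_real (exp (- (s\<^sup>2 * cov Y Y) / 2)))) = 0" for s
  proof -
    let ?\<phi> = "complex_of_real (exp (- (s\<^sup>2 * cov Y Y) / 2))"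
    have "(LINT x|M. (\<Prod>i\<in>I. indicator (A i) (X i x)) * (iexp (s * Y x) - ?\<phi>)) = 0"
    proof (rule complex_weight_prod_eq_zero[OF fin V_measurable[OF XV]])
      fix t :: "_ \<Rightarrow> real"
      let ?Z = "\<lambda>x. \<Sum>i\<in>I. t i * X i x"
      have Z: "?Z \<in> V" using XV by (rule V_sum)
      have ZY: "cov ?Z Y = 0"
        using XV Y orth by (simp add: cov_sum)
      have sY: "(\<lambda>x. s * Y x) \<in> V" using Y by (rule V_scale)
      have "cov (\<lambda>x. ?Z x + s * Y x) (\<lambda>x. ?Z x + s * Y x) = cov ?Z ?Z + s\<^sup>2 * cov Y Y"
        using ZY cov_scale[of s Y Y] by (simp add: cov_add_self[OF Z sY] cov_scale cov_scale_right power2_eq_square)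
      then have "(LINT x|M. iexp (?Z x + s * Y x)) = (LINT x|M. iexp (?Z x)) * ?\<phi>"
        using V_char[OF V_add[OF Z sY], of 1] V_char[OF Z, of 1]
        by simp (simp add: of_real_mult[symmetric] exp_add[symmetric] diff_divide_distrib del: of_real_mult)
      moreover have "(LINT x|M. iexp (?Z x) * (iexp (s * Y x) - ?\<phi>))
        = (LINT x|M. iexp (?Z x + s * Y x) - iexp (?Z x) * ?\<phi>)"
        by (intro Bochner_Integration.integral_cong) (auto simp: exp_add distrib_left right_diff_distrib)
      moreover have "\<dots> = (LINT x|M. iexp (?Z x + s * Y x)) - (LINT x|M. iexp (?Z x)) * ?\<phi>"
      proof (subst Bochner_Integration.integral_diff)
        show "integrable M (\<lambda>x. iexp (?Z x + s * Y x))" "integrable M (\<lambda>x. iexp (?Z x) * ?\<phi>)"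
          using V_measurable[OF Z]
          by (auto intro!: integrable_bounded[of _ 1] integrable_mult_left)
      qed simp
      ultimately show "(LINT x|M. iexp (?Z x) * (iexp (s * Y x) - ?\<phi>)) = 0"
        by simp
    next
      fix x
      have "norm (iexp (s * Y x) - ?\<phi>) \<le> norm (iexp (s * Y x)) + norm ?\<phi>"
        by (rule norm_triangle_ineq4)
      then show "norm (iexp (s * Y x) - ?\<phi>) \<le> 1 + norm ?\<phi>" by simp
    qed (auto intro: A)
    moreover have "(\<Prod>i\<in>I. indicator (A i) (X i x)) = complex_of_real (J x)" for x
      unfolding J_def of_real_prod by (intro prod.cong) (auto simp: indicator_def)
    ultimately show ?thesis
      by (simp only:)
  qed
  \<comment> \<open>Second pass with the roles exchanged: the centred indicator \<open>J - p\<close>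
    of the event in the \<open>X i\<close> is now the weight, and \<open>Y\<close> is the tested
    variable.\<close>
  have "(LINT x|M. indicator B (Y x) * complex_of_real (J x - p)) = 0"
  proof (rule complex_weight_eq_zero)
    fix s
    let ?\<phi> = "complex_of_real (exp (- (s\<^sup>2 * cov Y Y) / 2))"
    have i1: "integrable M (\<lambda>x. complex_of_real (J x) * iexp (s * Y x))"
      using J_abs by (intro integrable_bounded[of _ 1]) (auto simp: norm_mult)
    have i2: "integrable M (\<lambda>x. complex_of_real (J x))"
      using J_abs by (intro integrable_bounded[of _ 1]) auto
    have i3: "integrable M (\<lambda>x. iexp (s * Y x))"
      by (intro integrable_bounded[of _ 1]) auto
    have "(LINT x|M. complex_of_real (J x) * iexp (s * Y x)) = complex_of_real p * ?\<phi>"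
      using char_zero[of s] i1 i2
      by (simp add: right_diff_distrib p_def del: of_real_mult of_real_exp of_real_power of_real_minus of_real_divide)
    moreover have "(LINT x|M. iexp (s * Y x) * complex_of_real (J x - p))
      = (LINT x|M. complex_of_real (J x) * iexp (s * Y x) - complex_of_real p * iexp (s * Y x))"
      by (intro Bochner_Integration.integral_cong) (auto simp: algebra_simps)
    ultimately show "(LINT x|M. iexp (s * Y x) * complex_of_real (J x - p)) = 0"
      using i1 i3 V_char[OF Y, of s] by (simp del: of_real_mult)
  next
    show "norm (complex_of_real (J x - p)) \<le> 1 + \<bar>p\<bar>" for x
      using J_abs[of x] unfolding norm_of_real by linarith
  qed measurable
  moreover have "indicator B (Y x) * complex_of_real (J x - p) = complex_of_real (indicator B (Y x) * (J x - p))" for x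
    by (simp add: indicator_def)
  ultimately have "complex_of_real (LINT x|M. indicator B (Y x) * (J x - p)) = 0"
    by (simp only: integral_complex_of_real)
  then have z: "(LINT x|M. indicator B (Y x) * (J x - p)) = 0"
    by (simp only: of_real_eq_0_iff)
  have "(LINT x|M. indicator B (Y x) * (J x - p))
     = (LINT x|M. indicator {x\<in>space M. (\<forall>i\<in>I. X i x \<in> A i) \<and> Y x \<in> B} x - p * indicator {x\<in>space M. Y x \<in> B} x)"
    by (intro Bochner_Integration.integral_cong) (auto simp: J01 indicator_def)
  also have "\<dots> = prob {x\<in>space M. (\<forall>i\<in>I. X i x \<in> A i) \<and> Y x \<in> B} - p * prob {x\<in>space M. Y x \<in> B}"
  proof (subst Bochner_Integration.integral_diff)
    show "integrable M (indicat_real {x\<in>space M. (\<forall>i\<in>I. X i x \<in> A i) \<and> Y x \<in> B})"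
      "integrable M (\<lambda>x. p * indicat_real {x\<in>space M. Y x \<in> B} x)"
      by (intro integrable_mult_right integrable_real_indicator; measurable; simp add: emeasure_eq_measure)+
  qed simp
  finally show ?thesis
    using z p by simp
qed

end

section \<open>Orthogonal projection and conditioning\<close>

context gaussian_space
begin

lemma cov_sum_right:
  assumes "\<And>i. i \<in> I \<Longrightarrow> X i \<in> V" "Y \<in> V"
  shows "cov Y (\<lambda>x. \<Sum>i\<in>I. b i * X i x) = (\<Sum>i\<in>I. b i * cov Y (X i))"
  using cov_sum[where I=I and X=X and b=b, OF assms] by (simp only: cov_commute[of Y])

lemma cov_add_right: "Y \<in> V \<Longrightarrow> Y' \<in> V \<Longrightarrow> X \<in> V \<Longrightarrow> cov X (\<lambda>x. Y x + Y' x) = cov X Y + cov X Y'"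
  using cov_add[of Y Y' X] by (simp only: cov_commute[of X])

lemma cov_AE_zero: "AE x in M. Y x = 0 \<Longrightarrow> cov Z Y = 0"
  unfolding cov_def by (rule integral_eq_zero_AE) auto

text \<open>Induction on the number of vectors, without assuming them independent: a projection onto
  the first \<open>n\<close> is corrected along the residual of the next vector.\<close>

lemma V_projection:
  fixes n :: nat
  assumes "\<And>i. i < n \<Longrightarrow> X i \<in> V" "Z \<in> V"
  shows "\<exists>L. \<forall>k<n. cov (\<lambda>x. Z x - (\<Sum>l<n. L l * X l x)) (X k) = 0"
  using assms
proof (induction n arbitrary: Z)
  case 0
  then show ?case by simp
next
  case (Suc n)
  have XV: "X l \<in> V" if "l \<le> n" for l
    using Suc.prems that by simp
  obtain L\<^sub>1 where L1: "\<And>k. k < n \<Longrightarrow> cov (\<lambda>x. X n x - (\<Sum>l<n. L\<^sub>1 l * X l x)) (X k) = 0"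
    using Suc.IH[of "X n"] XV by auto
  obtain L\<^sub>2 where L2: "\<And>k. k < n \<Longrightarrow> cov (\<lambda>x. Z x - (\<Sum>l<n. L\<^sub>2 l * X l x)) (X k) = 0"
    using Suc.IH[of Z] Suc.prems XV by auto
  define Y where "Y x = X n x - (\<Sum>l<n. L\<^sub>1 l * X l x)" for x
  define Z' where "Z' x = Z x - (\<Sum>l<n. L\<^sub>2 l * X l x)" for x
  \<comment> \<open>If \<open>cov Y Y = 0\<close> the quotient is 0 by convention. This is
    consistent, since \<open>Y\<close> then vanishes almost everywhere and \<open>Z'\<close> is
    already orthogonal to it.\<close>
  define \<beta> where "\<beta> = cov Z' Y / cov Y Y"
  define R where "R x = Z' x - \<beta> * Y x" for x
  have Y: "Y \<in> V" and Z': "Z' \<in> V"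
    unfolding Y_def Z'_def using Suc.prems XV by (auto intro!: V_diff V_sum)
  have R: "R \<in> V"
    unfolding R_def using Y Z' by (intro V_diff V_scale)
  have cov_R: "cov R W = cov Z' W - \<beta> * cov Y W" if "W \<in> V" for W
    unfolding R_def using Y Z' that by (simp add: cov_diff V_scale cov_scale)
  have orth: "cov R (X k) = 0" if "k < n" for k
    using that L1[of k] L2[of k] XV[of k] by (simp add: cov_R Y_def[abs_def] Z'_def[abs_def])
  have "cov Y Y = 0 \<Longrightarrow> cov Z' Y = 0"
    by (rule cov_AE_zero[OF cov_self_eq_zeroD[OF Y]])
  then have RY: "cov R Y = 0"
    using Y by (simp add: cov_R \<beta>_def)
  have "X n = (\<lambda>x. Y x + (\<Sum>l<n. L\<^sub>1 l * X l x))"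
    by (simp add: Y_def fun_eq_iff)
  then have "cov R (X n) = cov R (\<lambda>x. Y x + (\<Sum>l<n. L\<^sub>1 l * X l x))"
    by simp
  also have "\<dots> = cov R Y + cov R (\<lambda>x. \<Sum>l<n. L\<^sub>1 l * X l x)"
    using XV by (intro cov_add_right Y R V_sum) auto
  also have "cov R (\<lambda>x. \<Sum>l<n. L\<^sub>1 l * X l x) = (\<Sum>l<n. L\<^sub>1 l * cov R (X l))"
    using XV R by (intro cov_sum_right) auto
  finally have Rn: "cov R (X n) = 0"
    by (simp add: RY orth)
  define L where "L l = (if l = n then \<beta> else L\<^sub>2 l - \<beta> * L\<^sub>1 l)" for l
  have "(\<lambda>x. Z x - (\<Sum>l<Suc n. L l * X l x)) = R"
  proof
    fix x
    have "(\<Sum>l<n. L l * X l x) = (\<Sum>l<n. L\<^sub>2 l * X l x - \<beta> * (L\<^sub>1 l * X l x))"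
      by (intro sum.cong) (auto simp: L_def algebra_simps)
    then show "Z x - (\<Sum>l<Suc n. L l * X l x) = R x"
      by (simp add: R_def Z'_def Y_def L_def sum_subtractf sum_distrib_left algebra_simps)
  qed
  then have "\<forall>k<Suc n. cov (\<lambda>x. Z x - (\<Sum>l<Suc n. L l * X l x)) (X k) = 0"
    using orth Rn by (auto simp: less_Suc_eq)
  then show ?case by (rule exI[of _ L])
qed

text \<open>Extension from boxes to all measurable sets. As set functions of \<open>A\<close> both
  sides are finite measures on the product space: one restricts to the event
  \<open>Y \<in> B\<close>, the other is rescaled by its probability. They agree on the generating
  boxes.\<close>

lemma V_uncorrelated_emeasure:
  assumes fin: "finite I" and XV: "\<And>i. i \<in> I \<Longrightarrow> X i \<in> V" and Y: "Y \<in> V"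
    and orth: "\<And>i. i \<in> I \<Longrightarrow> cov (X i) Y = 0"
    and A: "A \<in> sets (\<Pi>\<^sub>M i\<in>I. borel)" and B: "B \<in> sets borel"
  shows "emeasure M {x\<in>space M. (\<lambda>i\<in>I. X i x) \<in> A \<and> Y x \<in> B}
    = emeasure M {x\<in>space M. (\<lambda>i\<in>I. X i x) \<in> A} * emeasure M {x\<in>space M. Y x \<in> B}"
proof -
  note [measurable] = V_measurable[OF Y] V_measurable[OF XV] A B
  let ?N = "\<Pi>\<^sub>M i\<in>I. borel :: real measure"
  define T where "T x = (\<lambda>i\<in>I. X i x)" for x
  have T [measurable]: "T \<in> M \<rightarrow>\<^sub>M ?N"
    unfolding T_def by (intro measurable_restrict) auto
  define p where "p = emeasure M {x\<in>space M. Y x \<in> B}"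
  let ?P = "distr (density M (\<lambda>x. indicator B (Y x))) ?N T"
  let ?Q = "distr (density M (\<lambda>x. p)) ?N T"
  have P: "emeasure ?P S = emeasure M {x\<in>space M. T x \<in> S \<and> Y x \<in> B}" if [measurable]: "S \<in> sets ?N" for S
  proof -
    have "emeasure ?P S = (\<integral>\<^sup>+x. indicator B (Y x) * indicator (T -` S \<inter> space M) x \<partial>M)"
      by (simp add: emeasure_distr emeasure_density)
    also have "\<dots> = (\<integral>\<^sup>+x. indicator {x\<in>space M. T x \<in> S \<and> Y x \<in> B} x \<partial>M)"
      by (intro nn_integral_cong) (auto simp: indicator_def)
    finally show ?thesis by simp
  qed
  have Q: "emeasure ?Q S = p * emeasure M {x\<in>space M. T x \<in> S}" if [measurable]: "S \<in> sets ?N" for S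
  proof -
    have "emeasure ?Q S = (\<integral>\<^sup>+x. p * indicator (T -` S \<inter> space M) x \<partial>M)"
      by (simp add: emeasure_distr emeasure_density)
    also have "\<dots> = p * emeasure M (T -` S \<inter> space M)"
      by (rule nn_integral_cmult_indicator) measurable
    also have "T -` S \<inter> space M = {x\<in>space M. T x \<in> S}" by auto
    finally show ?thesis .
  qed
  have "?P = ?Q"
  proof (rule measure_eqI_PiM_finite[OF fin, where A="\<lambda>_. space ?N"])
    fix S assume S: "\<And>i. i \<in> I \<Longrightarrow> S i \<in> sets (borel :: real measure)"
    have box: "Pi\<^sub>E I S \<in> sets ?N"
      using fin S by (intro sets_PiM_I_finite) auto
    have in_box: "T x \<in> Pi\<^sub>E I S \<longleftrightarrow> (\<forall>i\<in>I. X i x \<in> S i)" for x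
      by (auto simp: T_def PiE_iff)
    show "emeasure ?P (Pi\<^sub>E I S) = emeasure ?Q (Pi\<^sub>E I S)"
      using V_uncorrelated_prob[where I=I and X=X and A=S and Y=Y and B=B, OF fin XV Y orth S B]
      unfolding P[OF box] Q[OF box] in_box unfolding p_def emeasure_eq_measure
      by (simp add: ennreal_mult[symmetric] mult.commute)
  next
    have "emeasure ?P (space ?N) \<le> 1"
      by (subst P) (auto simp: emeasure_le_1)
    then show "emeasure ?P (space ?N) \<noteq> \<infinity>"
      by (auto simp: top_unique)
  next
    show "range (\<lambda>_::nat. space ?N) \<subseteq> prod_algebra I (\<lambda>i. borel)"
      using fin by (auto simp: space_PiM intro!: prod_algebraI_finite)
  qed auto
  then have "emeasure ?P A = emeasure ?Q A" by simp
  then show ?thesis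
    unfolding P[OF A] Q[OF A] unfolding p_def T_def by (simp add: mult.commute)
qed

text \<open>Independence makes the joint law a product, so \<open>Y\<close> can be integrated out
  against its own normal density with the other variables frozen.\<close>

lemma V_uncorrelated_nn_integral:
  assumes fin: "finite I" and XV: "\<And>i. i \<in> I \<Longrightarrow> X i \<in> V" and Y: "Y \<in> V" and pos: "0 < cov Y Y"
    and orth: "\<And>i. i \<in> I \<Longrightarrow> cov (X i) Y = 0"
    and h [measurable]: "h \<in> borel_measurable ((\<Pi>\<^sub>M i\<in>I. borel) \<Otimes>\<^sub>M borel)"
  shows "(\<integral>\<^sup>+x. h (\<lambda>i\<in>I. X i x, Y x) \<partial>M)
    = (\<integral>\<^sup>+x. (\<integral>\<^sup>+y. ennreal (normal_density 0 (sqrt (cov Y Y)) y) * h (\<lambda>i\<in>I. X i x, y) \<partial>lborel) \<partial>M)"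
proof -
  note [measurable] = V_measurable[OF Y] V_measurable[OF XV]
  let ?N = "\<Pi>\<^sub>M i\<in>I. borel :: real measure"
  define T where "T x = (\<lambda>i\<in>I. X i x)" for x
  have T [measurable]: "T \<in> M \<rightarrow>\<^sub>M ?N"
    unfolding T_def by (intro measurable_restrict) auto
  have sf: "sigma_finite_measure (distr M borel Y)" "sigma_finite_measure (distr M ?N T)"
    by (intro prob_space_imp_sigma_finite prob_space_distr; measurable)+
  interpret S: sigma_finite_measure "distr M borel Y" by fact
  have joint: "distr M ?N T \<Otimes>\<^sub>M distr M borel Y = distr M (?N \<Otimes>\<^sub>M borel) (\<lambda>x. (T x, Y x))"
  proof (rule pair_measure_eqI[OF sf(2,1)])
    fix A B assume "A \<in> sets (distr M ?N T)" "B \<in> sets (distr M borel Y)"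
    then have [measurable]: "A \<in> sets ?N" "B \<in> sets borel" by auto
    have "emeasure (distr M ?N T) A * emeasure (distr M borel Y) B
      = emeasure M {x\<in>space M. T x \<in> A} * emeasure M {x\<in>space M. Y x \<in> B}"
      by (simp add: emeasure_distr vimage_def Int_def conj_commute)
    also have "\<dots> = emeasure M {x\<in>space M. T x \<in> A \<and> Y x \<in> B}"
      unfolding T_def by (rule V_uncorrelated_emeasure[OF fin XV Y orth, symmetric]) auto
    also have "\<dots> = emeasure (distr M (?N \<Otimes>\<^sub>M borel) (\<lambda>x. (T x, Y x))) (A \<times> B)"
      by (subst emeasure_distr) (auto intro!: arg_cong[where f="emeasure M"])
    finally show "emeasure (distr M ?N T) A * emeasure (distr M borel Y) B
      = emeasure (distr M (?N \<Otimes>\<^sub>M borel) (\<lambda>x. (T x, Y x))) (A \<times> B)" .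
  qed simp
  have "(\<integral>\<^sup>+x. h (T x, Y x) \<partial>M) = (\<integral>\<^sup>+z. h z \<partial>distr M (?N \<Otimes>\<^sub>M borel) (\<lambda>x. (T x, Y x)))"
    by (subst nn_integral_distr) auto
  also have "\<dots> = (\<integral>\<^sup>+z. h z \<partial>(distr M ?N T \<Otimes>\<^sub>M distr M borel Y))"
    by (simp only: joint)
  also have "\<dots> = (\<integral>\<^sup>+t. (\<integral>\<^sup>+y. h (t, y) \<partial>distr M borel Y) \<partial>distr M ?N T)"
    by (rule S.nn_integral_fst[symmetric]) simp
  also have "\<dots> = (\<integral>\<^sup>+x. (\<integral>\<^sup>+y. h (T x, y) \<partial>distr M borel Y) \<partial>M)"
    by (rule nn_integral_distr) (auto intro!: S.borel_measurable_nn_integral)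
  also have "\<dots> = (\<integral>\<^sup>+x. (\<integral>\<^sup>+y. ennreal (normal_density 0 (sqrt (cov Y Y)) y) * h (T x, y) \<partial>lborel) \<partial>M)"
    by (intro nn_integral_cong, subst V_normal[OF Y pos], rule nn_integral_density)
      (auto intro: measurable_compose[OF measurable_Pair1'[of _ ?N borel] h] measurable_space[OF T])
  finally show ?thesis by (simp add: T_def)
qed

end

section \<open>Probability bounds from relative entropy\<close>

text \<open>Split at the level \<open>r\<close> of the log density \<open>u\<close>. Below it the
  density is at most \<open>exp r\<close>; above it Markov's inequality applies to the positive part
  of \<open>u\<close>. The mean of the positive part exceeds the mean of \<open>u\<close> by that of
  the negative part, which is at most 1: moved to \<open>P\<close>, its integrand is
  \<open>exp v * max 0 (- v)\<close>, and this never exceeds 1.\<close>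

lemma prob_le_of_log_density:
  assumes P: "prob_space P" and Q: "prob_space Q" and sets: "sets Q = sets P"
    and u [measurable]: "u \<in> borel_measurable N" and T [measurable]: "T \<in> P \<rightarrow>\<^sub>M N"
    and dens: "\<And>h. h \<in> borel_measurable N \<Longrightarrow>
       (\<integral>\<^sup>+x. h (T x) \<partial>Q) = (\<integral>\<^sup>+x. ennreal (exp (u (T x))) * h (T x) \<partial>P)"
    and int: "integrable Q (\<lambda>x. u (T x))" and mean: "(LINT x|Q. u (T x)) \<le> b"
    and S [measurable]: "S \<in> sets N" and r: "0 < r"
  shows "measure Q {x\<in>space P. T x \<in> S} \<le> exp r * measure P {x\<in>space P. T x \<in> S} + (b + 1) / r"
proof -
  interpret P: prob_space P by fact
  interpret Q: prob_space Q by fact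
  note sp = sets_eq_imp_space_eq[OF sets]
  have TQ [measurable]: "T \<in> Q \<rightarrow>\<^sub>M N"
    using T by (simp cong: measurable_cong_sets add: sets)
  let ?A = "{x\<in>space P. T x \<in> S}" and ?L = "{x\<in>space P. T x \<in> S \<and> u (T x) \<le> r}" and ?H = "{x\<in>space P. r < u (T x)}"
  have [measurable]: "?A \<in> sets P" "?L \<in> sets P" "?H \<in> sets P"
    by measurable
  have [measurable]: "?A \<in> sets Q" "?L \<in> sets Q" "?H \<in> sets Q"
    by (simp_all add: sets)
  have "measure Q ?A \<le> measure Q (?L \<union> ?H)"
    by (intro Q.finite_measure_mono) auto
  also have "\<dots> \<le> measure Q ?L + measure Q ?H"
    by (intro measure_subadditive) (auto simp: Q.emeasure_eq_measure)
  finally have split: "measure Q ?A \<le> measure Q ?L + measure Q ?H" .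
  have "emeasure Q ?L = (\<integral>\<^sup>+x. indicator {t\<in>space N. t \<in> S \<and> u t \<le> r} (T x) \<partial>Q)"
  proof -
    have "emeasure Q ?L = (\<integral>\<^sup>+x. indicator ?L x \<partial>Q)"
      by simp
    also have "\<dots> = (\<integral>\<^sup>+x. indicator {t\<in>space N. t \<in> S \<and> u t \<le> r} (T x) \<partial>Q)"
      using measurable_space[OF T] sp by (intro nn_integral_cong) (auto simp: indicator_def)
    finally show ?thesis .
  qed
  also have "\<dots> = (\<integral>\<^sup>+x. ennreal (exp (u (T x))) * indicator {t\<in>space N. t \<in> S \<and> u t \<le> r} (T x) \<partial>P)"
    by (rule dens) measurable
  also have "\<dots> \<le> (\<integral>\<^sup>+x. ennreal (exp r) * indicator ?A x \<partial>P)"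
    by (intro nn_integral_mono) (auto simp: indicator_def intro!: ennreal_leI)
  also have "\<dots> = ennreal (exp r) * emeasure P ?A"
    by (rule nn_integral_cmult_indicator) measurable
  finally have low: "measure Q ?L \<le> exp r * measure P ?A"
    by (simp add: Q.emeasure_eq_measure P.emeasure_eq_measure ennreal_mult[symmetric])
  have neg_int: "integrable Q (\<lambda>x. max 0 (- u (T x)))" and pos_int: "integrable Q (\<lambda>x. max 0 (u (T x)))"
    using int by auto
  have "(\<integral>\<^sup>+x. ennreal (max 0 (- u (T x))) \<partial>Q) = (\<integral>\<^sup>+x. ennreal (exp (u (T x))) * ennreal (max 0 (- u (T x))) \<partial>P)"
    by (rule dens[of "\<lambda>t. ennreal (max 0 (- u t))"]) measurable
  also have "\<dots> \<le> (\<integral>\<^sup>+x. 1 \<partial>P)"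
  proof (intro nn_integral_mono)
    fix x
    have "exp (v) * max 0 (- v) \<le> 1" for v :: real
    proof (cases "v \<le> 0")
      case True
      have "exp v * (- v) \<le> exp v * exp (- v)"
        using exp_ge_add_one_self[of "- v"] by (intro mult_left_mono) auto
      then show ?thesis using True by (simp add: exp_minus)
    qed simp
    then have "ennreal (exp (u (T x)) * max 0 (- u (T x))) \<le> ennreal 1"
      by (rule ennreal_leI)
    then show "ennreal (exp (u (T x))) * ennreal (max 0 (- u (T x))) \<le> 1"
      by (subst ennreal_mult[symmetric]) (simp_all only: exp_ge_zero max.cobounded1 ennreal_1)
  qed
  finally have neg: "(LINT x|Q. max 0 (- u (T x))) \<le> 1"
    by (subst (asm) nn_integral_eq_integral[OF neg_int]) (simp_all add: P.emeasure_space_1)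
  have "r * measure Q ?H = (LINT x|Q. r * indicator ?H x)"
    using sp by simp
  also have "\<dots> \<le> (LINT x|Q. max 0 (u (T x)))"
  proof (rule integral_mono[OF _ pos_int])
    show "integrable Q (\<lambda>x. r * indicator ?H x)"
      by (intro integrable_mult_right integrable_real_indicator) (auto simp: Q.emeasure_eq_measure)
  qed (use r in \<open>auto simp: indicator_def\<close>)
  also have "\<dots> = (LINT x|Q. u (T x) + max 0 (- u (T x)))"
    by (intro Bochner_Integration.integral_cong) auto
  also have "\<dots> \<le> b + 1"
    using int neg_int mean neg by simp
  finally have "measure Q ?H \<le> (b + 1) / r"
    using r by (simp add: field_simps)
  then show ?thesis
    using split low by linarith
qed

section \<open>Pairs of Gaussian laws\<close>

text \<open>Gram-Schmidt. Residuals of zero variance are dropped, so \<open>n\<close> may be smaller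
  than the size of \<open>F\<close>, and elements of \<open>F\<close> are recovered only up to a
  remainder of zero variance.\<close>

lemma (in gaussian_space) V_orthonormal_basis:
  assumes "finite F" "F \<subseteq> V"
  shows "\<exists>(n::nat) X. (\<forall>k<n. X k \<in> V) \<and> (\<forall>k<n. \<forall>l<n. cov (X k) (X l) = of_bool (k = l)) \<and>
    (\<forall>Z\<in>F. \<exists>b. cov (\<lambda>x. Z x - (\<Sum>k<n. b k * X k x)) (\<lambda>x. Z x - (\<Sum>k<n. b k * X k x)) = 0)"
  using assms
proof (induction F rule: finite_induct)
  case empty
  show ?case by (intro exI[of _ 0]) auto
next
  case (insert Z F)
  then have "F \<subseteq> V" by simp
  obtain n :: nat and X where IH: "\<forall>k<n. X k \<in> V" "\<forall>k<n. \<forall>l<n. cov (X k) (X l) = of_bool (k = l)"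
    "\<forall>Z\<in>F. \<exists>b. cov (\<lambda>x. Z x - (\<Sum>k<n. b k * X k x)) (\<lambda>x. Z x - (\<Sum>k<n. b k * X k x)) = 0"
    using insert.IH[OF \<open>F \<subseteq> V\<close>] by blast
  have XV: "\<And>k. k < n \<Longrightarrow> X k \<in> V"
    and orth: "\<And>k l. k < n \<Longrightarrow> l < n \<Longrightarrow> cov (X k) (X l) = of_bool (k = l)"
    and span: "\<And>Z. Z \<in> F \<Longrightarrow> \<exists>b. cov (\<lambda>x. Z x - (\<Sum>k<n. b k * X k x)) (\<lambda>x. Z x - (\<Sum>k<n. b k * X k x)) = 0"
    using IH by auto
  have Z: "Z \<in> V" using insert.prems by simp
  obtain L where L: "\<And>k. k < n \<Longrightarrow> cov (\<lambda>x. Z x - (\<Sum>l<n. L l * X l x)) (X k) = 0"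
    using V_projection[of n X Z] XV Z by auto
  define R where "R x = Z x - (\<Sum>l<n. L l * X l x)" for x
  have R: "R \<in> V"
    unfolding R_def using Z XV by (auto intro!: V_diff V_sum)
  show ?case
  proof (cases "cov R R = 0")
    case True
    then have "\<exists>b. cov (\<lambda>x. Z x - (\<Sum>k<n. b k * X k x)) (\<lambda>x. Z x - (\<Sum>k<n. b k * X k x)) = 0"
      unfolding R_def by blast
    then show ?thesis
      using XV orth span by (intro exI[of _ n] exI[of _ X]) auto
  next
    case False
    then have pos: "0 < cov R R" using cov_self_nonneg[of R] by simp
    define d where "d = sqrt (cov R R)"
    have d: "0 < d" "d * d = cov R R" using pos by (simp_all add: d_def)
    define X' where "X' k = (if k = n then (\<lambda>x. (1 / d) * R x) else X k)" for k
    have X'V: "X' k \<in> V" if "k < Suc n" for k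
      using that XV R by (auto simp: X'_def less_Suc_eq intro!: V_scale[where c="1 / d", simplified])
    have RX: "cov R (X k) = 0" "cov (X k) R = 0" if "k < n" for k
      using L[OF that] by (simp_all add: R_def[abs_def] cov_commute)
    have orth': "cov (X' k) (X' l) = of_bool (k = l)" if "k < Suc n" "l < Suc n" for k l
      using that orth[of k l] RX[of k] RX[of l] d
      by (auto simp: X'_def less_Suc_eq cov_scale[where b="1 / d", simplified] cov_scale_right[where b="1 / d", simplified]
          divide_simps)
    have "\<exists>b. cov (\<lambda>x. W x - (\<Sum>k<Suc n. b k * X' k x)) (\<lambda>x. W x - (\<Sum>k<Suc n. b k * X' k x)) = 0"
      if "W \<in> insert Z F" for W
    proof (cases "W = Z")
      case True
      have "(\<lambda>x. Z x - (\<Sum>k<Suc n. (if k = n then d else L k) * X' k x)) = (\<lambda>x. 0)"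
        using d(1) by (auto simp: X'_def R_def fun_eq_iff)
      then show ?thesis
        unfolding True by (intro exI[of _ "\<lambda>k. if k = n then d else L k"]) (simp add: cov_def)
    next
      case False
      then obtain b where b: "cov (\<lambda>x. W x - (\<Sum>k<n. b k * X k x)) (\<lambda>x. W x - (\<Sum>k<n. b k * X k x)) = 0"
        using span[of W] \<open>W \<in> insert Z F\<close> by auto
      have "(\<lambda>x. W x - (\<Sum>k<Suc n. (if k = n then 0 else b k) * X' k x)) = (\<lambda>x. W x - (\<Sum>k<n. b k * X k x))"
        by (auto simp: X'_def fun_eq_iff)
      then show ?thesis
        using b by (intro exI[of _ "\<lambda>k. if k = n then 0 else b k"]) simp
    qed
    then show ?thesis
      using X'V orth' by (intro exI[of _ "Suc n"] exI[of _ X']) blast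
  qed
qed

section \<open>Log likelihood ratios of finite systems\<close>

text \<open>Here \<open>q\<close> is a variance, \<open>m\<close> the part explained by earlier
  variables and \<open>v\<close> the residual part. With \<open>t = v - 1\<close> the linear terms
  cancel and \<open>m + t\<^sup>2 / c\<close> remains. The term \<open>m\<close> is already of
  second order, being at most \<open>s / c\<close>; in \<open>t = (q - 1) - m\<close> the square of
  \<open>m\<close> is bounded by \<open>m \<le> s / c\<close> times
  \<open>m \<le> 1 / c\<close>.\<close>

lemma entropy_step_bound:
  fixes c m q s v :: real
  assumes c: "0 < c" and v: "v = q - m" "c \<le> v" and q: "q \<le> 1 / c" and m: "0 \<le> m" "m \<le> s / c"
  shows "(q - 1 - ln v) / 2 \<le> (1 / c + 1 / c ^ 3) * ((q - 1)\<^sup>2 + s)"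
proof -
  define t where "t = v - 1"
  have v0: "0 < v" using c v by simp
  have "- ln v \<le> 1 / v - 1"
    using ln_le_minus_one[of "1 / v"] v0 by (simp add: ln_div)
  also have "1 / v - 1 = - t + t\<^sup>2 / v"
    using v0 by (simp add: t_def field_simps power2_eq_square)
  also have "\<dots> \<le> - t + t\<^sup>2 / c"
    using v0 v c by (auto intro!: divide_left_mono)
  finally have "- ln v \<le> - t + t\<^sup>2 / c" .
  then have "(q - 1 - ln v) / 2 \<le> (m + t\<^sup>2 / c) / 2"
  proof -
    assume "- ln v \<le> - t + t\<^sup>2 / c"
    moreover have "q - 1 = t + m" using v by (simp add: t_def)
    ultimately have "q - 1 - ln v \<le> m + t\<^sup>2 / c" by linarith
    then show ?thesis by (rule divide_right_mono) simp
  qed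
  also have "\<dots> \<le> (s / c + (2 * (q - 1)\<^sup>2 + 2 * (s / c * (1 / c))) / c) / 2"
  proof -
    have "m\<^sup>2 \<le> s / c * (1 / c)"
      unfolding power2_eq_square using m v v0 q c by (intro mult_mono) auto
    moreover have "t\<^sup>2 \<le> 2 * (q - 1)\<^sup>2 + 2 * m\<^sup>2"
    proof -
      have t: "t = (q - 1) - m" using v by (simp add: t_def)
      have "0 \<le> ((q - 1) + m)\<^sup>2" by simp
      then show ?thesis unfolding t by (simp add: power2_eq_square algebra_simps)
    qed
    ultimately have "t\<^sup>2 \<le> 2 * (q - 1)\<^sup>2 + 2 * (s / c * (1 / c))"
      by linarith
    then show ?thesis
      using m c by (intro divide_right_mono add_mono) auto
  qed
  also have "\<dots> = (1 / c) * (s / 2) + (1 / c) * (q - 1)\<^sup>2 + (1 / c ^ 3) * s"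
    using c by (simp add: field_simps power3_eq_cube power2_eq_square)
  also have "\<dots> \<le> (1 / c) * s + (1 / c) * (q - 1)\<^sup>2 + (1 / c ^ 3) * s + (1 / c ^ 3) * (q - 1)\<^sup>2"
  proof -
    have "0 \<le> s" using m c by (metis order_trans zero_le_divide_iff not_less_iff_gr_or_eq order_less_le)
    then have "(1 / c) * (s / 2) \<le> (1 / c) * s"
      using c by (intro mult_left_mono) auto
    moreover have "0 \<le> (1 / c ^ 3) * (q - 1)\<^sup>2"
      using c by simp
    ultimately show ?thesis by linarith
  qed
  also have "\<dots> = (1 / c + 1 / c ^ 3) * ((q - 1)\<^sup>2 + s)"
    by (simp add: distrib_left distrib_right)
  finally show ?thesis .
qed

text \<open>The exponent is the log likelihood ratio of the normal law with mean \<open>a\<close>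
  and variance \<open>v\<close> against the standard one.\<close>

lemma normal_density_exp_tilt:
  assumes "0 < v"
  shows "std_normal_density y * exp (- ln (sqrt v) - (y - a)\<^sup>2 / (2 * v) + y\<^sup>2 / 2) = normal_density a (sqrt v) y"
proof -
  have "exp (- y\<^sup>2 / 2) * exp (- ln (sqrt v) - (y - a)\<^sup>2 / (2 * v) + y\<^sup>2 / 2) = exp (- ln (sqrt v)) * exp (- (y - a)\<^sup>2 / (2 * v))"
    by (simp add: exp_add[symmetric])
  then show ?thesis
    using assms by (simp add: std_normal_density_def normal_density_def exp_minus real_sqrt_mult field_simps)
qed

text \<open>\<open>hs\<close> bounds the Hilbert-Schmidt distance of the \<open>Q\<close>-covariance
  from the identity in \<open>P\<close>-orthonormal coordinates. \<open>B\<close> must serve finite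
  systems of every length \<open>n\<close>; this uniformity carries the passage to the full
  \<sigma>-algebra.\<close>

locale gaussian_pair = P: gaussian_space P V + Q: gaussian_space Q V
  for P Q :: "'a measure" and V :: "('a \<Rightarrow> real) set" +
  fixes c B :: real
  assumes sets_Q: "sets Q = sets P"
    and c_pos: "0 < c"
    and cov_le1: "X \<in> V \<Longrightarrow> c * P.cov X X \<le> Q.cov X X"
    and cov_le2: "X \<in> V \<Longrightarrow> c * Q.cov X X \<le> P.cov X X"
    and hs: "(\<And>k. k < (n::nat) \<Longrightarrow> Z k \<in> V) \<Longrightarrow>
      (\<And>k l. k < n \<Longrightarrow> l < n \<Longrightarrow> P.cov (Z k) (Z l) = of_bool (k = l)) \<Longrightarrow>
      (\<Sum>k<n. \<Sum>l<n. (Q.cov (Z k) (Z l) - of_bool (k = l))\<^sup>2) \<le> B"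
begin

text \<open>Chain rule for relative entropy. Under \<open>P\<close> the next variable is standard
  normal and independent of the earlier ones; under \<open>Q\<close> it is normal around its
  projection onto them, with constant residual variance. Each step multiplies the density by a ratio
  of one-dimensional normal densities, and pairs of distinct indices contribute once, with
  \<open>l < k\<close>.\<close>

lemma log_density:
  fixes n :: nat
  assumes "\<And>k. k < n \<Longrightarrow> X k \<in> V"
    and "\<And>k l. k < n \<Longrightarrow> l < n \<Longrightarrow> P.cov (X k) (X l) = of_bool (k = l)"
  shows "\<exists>u\<in>borel_measurable (\<Pi>\<^sub>M k\<in>{..<n}. borel).
    (\<forall>h\<in>borel_measurable (\<Pi>\<^sub>M k\<in>{..<n}. borel).
      (\<integral>\<^sup>+x. h (\<lambda>k\<in>{..<n}. X k x) \<partial>Q)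
        = (\<integral>\<^sup>+x. ennreal (exp (u (\<lambda>k\<in>{..<n}. X k x))) * h (\<lambda>k\<in>{..<n}. X k x) \<partial>P)) \<and>
    integrable Q (\<lambda>x. u (\<lambda>k\<in>{..<n}. X k x)) \<and>
    (LINT x|Q. u (\<lambda>k\<in>{..<n}. X k x))
      \<le> (1 / c + 1 / c ^ 3) * (\<Sum>k<n. (Q.cov (X k) (X k) - 1)\<^sup>2 + (\<Sum>l<k. (Q.cov (X k) (X l))\<^sup>2))"
  using assms
proof (induction n)
  case 0
  show ?case
    by (intro bexI[of _ "\<lambda>_. 0"])
      (auto simp: P.emeasure_space_1 Q.emeasure_space_1 restrict_def)
next
  case (Suc n)
  have XV: "X k \<in> V" if "k \<le> n" for k
    using Suc.prems(1) that by simp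
  have orth: "P.cov (X k) (X l) = of_bool (k = l)" if "k \<le> n" "l \<le> n" for k l
    using Suc.prems(2) that by simp
  define N where "N m = (\<Pi>\<^sub>M k\<in>{..<m}. borel :: real measure)" for m :: nat
  define T where "T m x = (\<lambda>k\<in>{..<m}. X k x)" for m :: nat and x
  have IH: "\<exists>u\<in>borel_measurable (N n).
    (\<forall>h\<in>borel_measurable (N n). (\<integral>\<^sup>+x. h (T n x) \<partial>Q) = (\<integral>\<^sup>+x. ennreal (exp (u (T n x))) * h (T n x) \<partial>P)) \<and>
    integrable Q (\<lambda>x. u (T n x)) \<and> (LINT x|Q. u (T n x))
      \<le> (1 / c + 1 / c ^ 3) * (\<Sum>k<n. (Q.cov (X k) (X k) - 1)\<^sup>2 + (\<Sum>l<k. (Q.cov (X k) (X l))\<^sup>2))"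
    unfolding N_def T_def by (rule Suc.IH) (simp_all add: XV orth)
  obtain u where u [measurable]: "u \<in> borel_measurable (N n)"
    and dens: "\<And>h. h \<in> borel_measurable (N n) \<Longrightarrow>
      (\<integral>\<^sup>+x. h (T n x) \<partial>Q) = (\<integral>\<^sup>+x. ennreal (exp (u (T n x))) * h (T n x) \<partial>P)"
    and uint: "integrable Q (\<lambda>x. u (T n x))"
    and umean: "(LINT x|Q. u (T n x))
      \<le> (1 / c + 1 / c ^ 3) * (\<Sum>k<n. (Q.cov (X k) (X k) - 1)\<^sup>2 + (\<Sum>l<k. (Q.cov (X k) (X l))\<^sup>2))"
    using IH by blast
  have XP [measurable]: "X k \<in> borel_measurable P" and XQ [measurable]: "X k \<in> borel_measurable Q" if "k \<le> n" for k
    using P.V_measurable[OF XV[OF that]] Q.V_measurable[OF XV[OF that]] by auto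
  have TP [measurable]: "T n \<in> P \<rightarrow>\<^sub>M N n" and TQ [measurable]: "T n \<in> Q \<rightarrow>\<^sub>M N n"
    unfolding T_def N_def by (auto intro!: measurable_restrict XP XQ)
  \<comment> \<open>Projection with respect to \<open>Q\<close>: \<open>\<mu>\<close> will be the
    conditional mean of \<open>X n\<close> given the earlier variables, and \<open>Y\<close> the
    independent residual.\<close>
  obtain L where L: "\<And>k. k < n \<Longrightarrow> Q.cov (\<lambda>x. X n x - (\<Sum>l<n. L l * X l x)) (X k) = 0"
    using Q.V_projection[of n X "X n"] XV by auto
  define \<mu> where "\<mu> x = (\<Sum>l<n. L l * X l x)" for x
  define Y where "Y x = X n x - \<mu> x" for x
  have \<mu>V: "\<mu> \<in> V" unfolding \<mu>_def using XV by (intro P.V_sum) auto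
  have YV: "Y \<in> V" unfolding Y_def using XV \<mu>V by (intro P.V_diff) auto
  have Xn: "X n = (\<lambda>x. Y x + \<mu> x)"
    by (simp add: Y_def fun_eq_iff)
  have YX: "Q.cov Y (X k) = 0" if "k < n" for k
    using L[OF that] by (simp add: Y_def[abs_def] \<mu>_def)
  have Y\<mu>: "Q.cov Y \<mu> = 0"
    unfolding \<mu>_def using YX XV YV by (subst Q.cov_sum_right) auto
  define q v m s where "q = Q.cov (X n) (X n)" and "v = Q.cov Y Y" and "m = Q.cov \<mu> \<mu>"
    and "s = (\<Sum>l<n. (Q.cov (X n) (X l))\<^sup>2)"
  have q_eq: "q = v + m"
    unfolding q_def Xn Q.cov_add_self[OF YV \<mu>V] by (simp add: Y\<mu> v_def m_def)
  \<comment> \<open>Under \<open>P\<close> the correction \<open>\<mu>\<close> is orthogonal to the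
    unit vector \<open>X n\<close>, so subtracting it cannot decrease the variance:
    \<open>P.cov Y Y\<close> is at least 1. Comparability turns this into \<open>c \<le> v\<close>,
    which keeps the logarithm bounded below.\<close>
  have "P.cov (X n) \<mu> = 0"
    unfolding \<mu>_def using XV orth by (subst P.cov_sum_right) auto
  moreover have "Y = (\<lambda>x. X n x + - 1 * \<mu> x)"
    by (simp add: Y_def fun_eq_iff)
  ultimately have "P.cov Y Y = 1 + P.cov (\<lambda>x. - 1 * \<mu> x) (\<lambda>x. - 1 * \<mu> x)"
    using P.cov_add_self[OF XV[of n] P.V_scale[OF \<mu>V, of "- 1"]] orth[of n n]
    by (simp only: P.cov_scale_right) simp
  then have "1 \<le> P.cov Y Y"
    using P.cov_self_nonneg[of "\<lambda>x. - 1 * \<mu> x"] by linarith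
  then have "c * 1 \<le> c * P.cov Y Y"
    using c_pos by (intro mult_left_mono) auto
  then have vc: "c \<le> v"
    using cov_le1[OF YV] by (simp add: v_def)
  then have v0: "0 < v" using c_pos by simp
  have m0: "0 \<le> m" by (simp add: m_def Q.cov_self_nonneg)
  \<comment> \<open>The explained variance is linear in the coefficients \<open>L\<close>, so
    Cauchy-Schwarz bounds \<open>m\<^sup>2\<close> by their square sum times \<open>s\<close>. The
    \<open>L l\<close> are also the \<open>P\<close>-coordinates of \<open>\<mu>\<close>, so
    comparability bounds their square sum by \<open>m / c\<close>; one factor \<open>m\<close> then
    cancels.\<close>
  have "m = Q.cov (X n) \<mu>"
    unfolding Xn using Q.cov_add[OF YV \<mu>V \<mu>V] by (simp add: Y\<mu> m_def)
  also have "\<dots> = (\<Sum>l<n. L l * Q.cov (X n) (X l))"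
    unfolding \<mu>_def using XV by (intro Q.cov_sum_right) auto
  finally have "m\<^sup>2 \<le> (\<Sum>l<n. (L l)\<^sup>2) * s"
    using Cauchy_Schwarz_ineq_sum[of L "\<lambda>l. Q.cov (X n) (X l)" "{..<n}"] by (simp add: s_def)
  moreover have "c * (\<Sum>l<n. (L l)\<^sup>2) \<le> m"
  proof -
    have "P.cov \<mu> (X l) = L l" if "l < n" for l
    proof -
      have "P.cov \<mu> (X l) = (\<Sum>i<n. L i * of_bool (i = l))"
        unfolding \<mu>_def using XV that orth by (subst P.cov_sum) auto
      also have "\<dots> = (\<Sum>i<n. if i = l then L i else 0)"
        by (intro sum.cong) auto
      finally show ?thesis using that by simp
    qed
    moreover have "P.cov \<mu> \<mu> = (\<Sum>l<n. L l * P.cov \<mu> (X l))"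
    proof -
      have "\<mu> = (\<lambda>x. \<Sum>l<n. L l * X l x)" by (simp add: \<mu>_def fun_eq_iff)
      moreover have "P.cov \<mu> (\<lambda>x. \<Sum>l<n. L l * X l x) = (\<Sum>l<n. L l * P.cov \<mu> (X l))"
        using XV \<mu>V by (intro P.cov_sum_right) auto
      ultimately show ?thesis by simp
    qed
    ultimately have "P.cov \<mu> \<mu> = (\<Sum>l<n. (L l)\<^sup>2)"
      by (simp add: power2_eq_square)
    then show ?thesis
      using cov_le1[OF \<mu>V] by (simp add: m_def)
  qed
  moreover have s0: "0 \<le> s" by (simp add: s_def sum_nonneg)
  ultimately have "c * m\<^sup>2 \<le> m * s"
    using c_pos mult_right_mono[of "c * (\<Sum>l<n. (L l)\<^sup>2)" m s]
    by (smt (verit) mult.assoc mult_left_mono)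
  then have ms: "m \<le> s / c"
    using c_pos m0 s0 by (cases "m = 0") (auto simp: field_simps power2_eq_square)
  have qc: "q \<le> 1 / c"
    using cov_le2[OF XV[of n]] orth[of n n] c_pos by (simp add: q_def field_simps)
  have step: "(q - 1 - ln v) / 2 \<le> (1 / c + 1 / c ^ 3) * ((q - 1)\<^sup>2 + s)"
    using c_pos q_eq vc qc m0 ms by (intro entropy_step_bound) auto

  define a where "a t = (\<Sum>l<n. L l * t l)" for t :: "nat \<Rightarrow> real"
  have comp [measurable]: "(\<lambda>t. t l) \<in> borel_measurable (N k)" if "l < k" for l k
    unfolding N_def using that by (intro measurable_component_singleton) auto
  have a [measurable]: "a \<in> borel_measurable (N n)"
    unfolding a_def by (intro borel_measurable_sum borel_measurable_times) auto
  have aT: "a (T n x) = \<mu> x" for x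
    by (simp add: a_def T_def \<mu>_def)
  have TSuc: "T (Suc n) x = (T n x)(n := X n x)" for x
    by (auto simp: T_def restrict_def fun_eq_iff less_Suc_eq)
  have upd: "(\<lambda>(t, y). t(n := y)) \<in> N n \<Otimes>\<^sub>M borel \<rightarrow>\<^sub>M N (Suc n)"
    unfolding N_def lessThan_Suc by (rule measurable_add_dim)
  \<comment> \<open>The previous exponent plus the log ratio of the conditional law of the new
    variable under \<open>Q\<close>, with mean \<open>a t\<close> and variance \<open>v\<close>, to
    the standard normal law.\<close>
  define w where "w t y = u t - ln (sqrt v) - (y - a t)\<^sup>2 / (2 * v) + y\<^sup>2 / 2" for t y
  \<comment> \<open>Restriction returns the point to the product over \<open>{..<n}\<close>, the
    space on which \<open>u\<close> is known to be measurable.\<close>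
  define u' where "u' t = w (restrict t {..<n}) (t n)" for t
  have res: "(\<lambda>t. restrict t {..<n}) \<in> N (Suc n) \<rightarrow>\<^sub>M N n"
    unfolding N_def by (rule measurable_restrict_subset) auto
  have u' [measurable]: "u' \<in> borel_measurable (N (Suc n))"
    unfolding u'_def w_def using measurable_compose[OF res u] measurable_compose[OF res a] comp[of n "Suc n"]
    by (intro borel_measurable_add borel_measurable_diff borel_measurable_divide borel_measurable_power) auto
  have u'T: "u' (T (Suc n) x) = w (T n x) (X n x)" for x
    unfolding u'_def TSuc by (intro arg_cong2[where f=w]) (auto simp: T_def restrict_def fun_eq_iff)
  have dens': "\<forall>h\<in>borel_measurable (N (Suc n)). (\<integral>\<^sup>+x. h (T (Suc n) x) \<partial>Q)
    = (\<integral>\<^sup>+x. ennreal (exp (u' (T (Suc n) x))) * h (T (Suc n) x) \<partial>P)"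
  proof
    fix h :: "(nat \<Rightarrow> real) \<Rightarrow> ennreal" assume h [measurable]: "h \<in> borel_measurable (N (Suc n))"
    have hu [measurable]: "(\<lambda>(t, y). h (t(n := y))) \<in> borel_measurable (N n \<Otimes>\<^sub>M borel)"
      using measurable_compose[OF upd h] by (simp add: case_prod_unfold)
    have hu2: "(\<lambda>(t, y). h (t(n := a t + y))) \<in> borel_measurable (N n \<Otimes>\<^sub>M borel)"
    proof -
      have "(\<lambda>(t, y). (t, a t + y)) \<in> N n \<Otimes>\<^sub>M borel \<rightarrow>\<^sub>M N n \<Otimes>\<^sub>M borel"
        by measurable
      from measurable_compose[OF this hu] show ?thesis by (simp add: case_prod_unfold)
    qed
    \<comment> \<open>\<open>H t\<close> averages \<open>h\<close> over the last coordinate,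
      conditionally on \<open>t\<close> under \<open>Q\<close>. It depends on the first
      \<open>n\<close> variables only, so the induction hypothesis moves it from \<open>Q\<close> to
      \<open>P\<close>; there the tilted normal density is rewritten as the standard one times a
      likelihood ratio, and the integral is folded back into \<open>X n\<close>.\<close>
    define H where "H t = (\<integral>\<^sup>+y. ennreal (normal_density (a t) (sqrt v) y) * h (t(n := y)) \<partial>lborel)" for t
    have nd: "(\<lambda>(t, y). normal_density (a t) (sqrt v) y) \<in> borel_measurable (N n \<Otimes>\<^sub>M borel)"
      unfolding normal_density_def by measurable
    have Hm [measurable]: "H \<in> borel_measurable (N n)"
      unfolding H_def using nd hu
      by (intro lborel.borel_measurable_nn_integral) (simp add: case_prod_unfold)
    have h_sec: "(\<lambda>y. h (t(n := y))) \<in> borel_measurable borel" if "t \<in> space (N n)" for t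
      using measurable_compose[OF measurable_Pair1'[OF that] hu] by simp
    have H_shift: "H t = (\<integral>\<^sup>+y. ennreal (normal_density 0 (sqrt v) y) * h (t(n := a t + y)) \<partial>lborel)"
      if "t \<in> space (N n)" for t
      unfolding H_def using h_sec[OF that]
      by (subst nn_integral_real_affine[where c=1 and t="a t"]) (auto simp: normal_density_def)
    have "(\<integral>\<^sup>+x. h (T (Suc n) x) \<partial>Q) = (\<integral>\<^sup>+x. (\<lambda>(t, y). h (t(n := a t + y))) (T n x, Y x) \<partial>Q)"
      by (intro nn_integral_cong) (simp add: TSuc aT Xn add.commute)
    also have "\<dots> = (\<integral>\<^sup>+x. (\<integral>\<^sup>+y. ennreal (normal_density 0 (sqrt v) y) * h ((T n x)(n := a (T n x) + y)) \<partial>lborel) \<partial>Q)"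
      unfolding v_def T_def
      by (subst Q.V_uncorrelated_nn_integral) (use XV YV YX v0 hu2 in \<open>auto simp: v_def Q.cov_commute N_def\<close>)
    also have "\<dots> = (\<integral>\<^sup>+x. H (T n x) \<partial>Q)"
      using measurable_space[OF TQ] by (intro nn_integral_cong) (simp add: H_shift)
    also have "\<dots> = (\<integral>\<^sup>+x. ennreal (exp (u (T n x))) * H (T n x) \<partial>P)"
      by (rule dens) measurable
    also have "\<dots> = (\<integral>\<^sup>+x. (\<integral>\<^sup>+y. ennreal (std_normal_density y) *
        (ennreal (exp (w (T n x) y)) * h ((T n x)(n := y))) \<partial>lborel) \<partial>P)"
    proof (intro nn_integral_cong)
      fix x assume "x \<in> space P"
      then have sp: "T n x \<in> space (N n)" using measurable_space[OF TP] by simp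
      have "ennreal (exp (u t)) * (ennreal (normal_density (a t) (sqrt v) y) * z)
        = ennreal (std_normal_density y) * (ennreal (exp (w t y)) * z)" for t y z
      proof -
        have "exp (u t) * normal_density (a t) (sqrt v) y = std_normal_density y * exp (w t y)"
        proof -
          have "exp (w t y) = exp (u t) * exp (- ln (sqrt v) - (y - a t)\<^sup>2 / (2 * v) + y\<^sup>2 / 2)"
            by (simp add: w_def exp_add[symmetric])
          then show ?thesis
            unfolding normal_density_exp_tilt[OF v0, symmetric] by (simp only: mult.left_commute)
        qed
        then show ?thesis
          by (simp add: ennreal_mult[symmetric] mult.assoc[symmetric] normal_density_nonneg)
      qed
      then show "ennreal (exp (u (T n x))) * H (T n x) = (\<integral>\<^sup>+y. ennreal (std_normal_density y) *
        (ennreal (exp (w (T n x) y)) * h ((T n x)(n := y))) \<partial>lborel)"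
        unfolding H_def using h_sec[OF sp] by (subst nn_integral_cmult[symmetric]) auto
    qed
    also have "\<dots> = (\<integral>\<^sup>+x. (\<lambda>(t, y). ennreal (exp (w t y)) * h (t(n := y))) (T n x, X n x) \<partial>P)"
    proof -
      have "(\<lambda>(t, y). ennreal (exp (w t y)) * h (t(n := y))) \<in> borel_measurable (N n \<Otimes>\<^sub>M borel)"
        unfolding w_def using hu by (simp add: case_prod_unfold)
      then show ?thesis
        unfolding T_def using orth[of n n]
        by (subst P.V_uncorrelated_nn_integral) (use XV orth in \<open>auto simp: N_def\<close>)
    qed
    finally show "(\<integral>\<^sup>+x. h (T (Suc n) x) \<partial>Q)
      = (\<integral>\<^sup>+x. ennreal (exp (u' (T (Suc n) x))) * h (T (Suc n) x) \<partial>P)"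
      by (simp add: TSuc[symmetric] u'T)
  qed
  have YY: "integrable Q (\<lambda>x. Y x * Y x)" and XX: "integrable Q (\<lambda>x. X n x * X n x)"
    using YV XV by (auto intro!: Q.V_integrable_mult)
  have u'_eq: "u' (T (Suc n) x) = u (T n x) - ln (sqrt v) - (Y x * Y x) / (2 * v) + (X n x * X n x) / 2" for x
    by (simp add: u'T w_def aT Y_def power2_eq_square)
  have int': "integrable Q (\<lambda>x. u' (T (Suc n) x))"
    unfolding u'_eq using uint YY XX by auto
  have mean': "(LINT x|Q. u' (T (Suc n) x)) \<le> (1 / c + 1 / c ^ 3) *
    (\<Sum>k<Suc n. (Q.cov (X k) (X k) - 1)\<^sup>2 + (\<Sum>l<k. (Q.cov (X k) (X l))\<^sup>2))"
  proof -
    \<comment> \<open>Under \<open>Q\<close> the square of \<open>Y\<close> has mean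
      \<open>v\<close> and that of \<open>X n\<close> has mean \<open>q\<close>, so the quadratic
      terms contribute \<open>-1/2\<close> and \<open>q/2\<close>.\<close>
    have "(LINT x|Q. u' (T (Suc n) x)) = (LINT x|Q. u (T n x)) - ln (sqrt v) - v / (2 * v) + q / 2"
      unfolding u'_eq using uint YY XX by (simp add: v_def q_def Q.cov_def Q.prob_space)
    also have "\<dots> = (LINT x|Q. u (T n x)) + (q - 1 - ln v) / 2"
      using v0 by (simp add: ln_sqrt field_simps)
    finally show ?thesis
    proof -
      have "(1 / c + 1 / c ^ 3) * (\<Sum>k<Suc n. (Q.cov (X k) (X k) - 1)\<^sup>2 + (\<Sum>l<k. (Q.cov (X k) (X l))\<^sup>2))
        = (1 / c + 1 / c ^ 3) * (\<Sum>k<n. (Q.cov (X k) (X k) - 1)\<^sup>2 + (\<Sum>l<k. (Q.cov (X k) (X l))\<^sup>2))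
          + (1 / c + 1 / c ^ 3) * ((q - 1)\<^sup>2 + s)"
        unfolding sum.lessThan_Suc q_def s_def by (rule distrib_left)
      moreover assume "(LINT x|Q. u' (T (Suc n) x)) = (LINT x|Q. u (T n x)) + (q - 1 - ln v) / 2"
      ultimately show ?thesis using umean step by linarith
    qed
  qed
  show ?case
    using conjI[OF dens' conjI[OF int' mean']] u' unfolding N_def T_def by (rule bexI)
qed

end

section \<open>Passage from an algebra to the generated sigma-algebra\<close>

text \<open>One set has to serve both measures at once, so the induction carries both estimates
  together. For a countable union, half of \<open>e\<close> pays for truncation to finitely many
  sets and half for approximating those.\<close>

lemma sigma_sets_approx:
  assumes G: "algebra \<Omega> G" and P: "finite_measure P" and Q: "finite_measure Q"
    and sets_P: "sets P = sigma_sets \<Omega> G" and sets_Q: "sets Q = sets P"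
    and A: "A \<in> sets P" and e: "0 < e"
  shows "\<exists>C\<in>G. measure P (sym_diff A C) < e \<and> measure Q (sym_diff A C) < e"
proof -
  interpret algebra \<Omega> G by fact
  interpret P: finite_measure P by fact
  interpret Q: finite_measure Q by fact
  have G_P: "C \<in> sets P" if "C \<in> G" for C
    using that by (simp add: sets_P)
  have space_P: "space P = \<Omega>"
    using sets_P space_closed by (metis sets.sets_into_space sets.top sigma_sets_into_sp sigma_sets_top subset_antisym)
  have "A \<in> sigma_sets \<Omega> G" using A by (simp add: sets_P)
  then show ?thesis using e
  proof (induction A arbitrary: e rule: sigma_sets.induct)
    case (Basic a)
    then show ?case by (intro bexI[of _ a]) auto
  next
    case Empty
    then show ?case by (intro bexI[of _ "{}"]) auto
  next
    case (Compl a)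
    then obtain C where C: "C \<in> G" "measure P (sym_diff a C) < e" "measure Q (sym_diff a C) < e"
      by blast
    have "a \<subseteq> \<Omega>" using sigma_sets_into_sp[OF space_closed Compl.hyps] .
    moreover have "C \<subseteq> \<Omega>" using C(1) space_closed by auto
    ultimately have "sym_diff (\<Omega> - a) (\<Omega> - C) = sym_diff a C" by auto
    then show ?case
      using C by (intro bexI[of _ "\<Omega> - C"]) auto
  next
    case (Union a)
    have a_sets: "a i \<in> sets P" for i
      using Union.hyps by (simp add: sets_P)
    let ?U = "\<lambda>n. \<Union>i<n. a i" and ?A = "\<Union>i. a i"
    have lim: "(\<lambda>n. measure R (?U n)) \<longlonglongrightarrow> measure R ?A" if "finite_measure R" "sets R = sets P" for R
    proof -
      interpret R: finite_measure R by fact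
      have "incseq ?U"
        by (intro incseq_SucI UN_mono) auto
      then have "(\<lambda>n. measure R (?U n)) \<longlonglongrightarrow> measure R (\<Union>n. ?U n)"
        using a_sets that by (intro R.finite_Lim_measure_incseq) auto
      moreover have "(\<Union>n. ?U n) = ?A" by auto
      ultimately show ?thesis by simp
    qed
    have ev: "eventually (\<lambda>n. measure R ?A - e / 2 < measure R (?U n)) sequentially"
      if "finite_measure R" "sets R = sets P" for R
      using lim[OF that] Union.prems by (intro order_tendstoD(1)) auto
    have "eventually (\<lambda>n. measure P ?A - e / 2 < measure P (?U n) \<and> measure Q ?A - e / 2 < measure Q (?U n)) sequentially"
      by (intro eventually_conj ev P Q sets_Q refl)
    then obtain n where n: "measure P ?A - e / 2 < measure P (?U n)" "measure Q ?A - e / 2 < measure Q (?U n)"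
      by (auto simp: eventually_sequentially)
    \<comment> \<open>The increment by one keeps \<open>d\<close> well defined and positive for
      \<open>n = 0\<close>.\<close>
    define d where "d = e / (2 * (real n + 1))"
    have d: "0 < d" "real n * d \<le> e / 2"
      using Union.prems by (auto simp: d_def field_simps)
    have "\<forall>i. \<exists>C\<in>G. measure P (sym_diff (a i) C) < d \<and> measure Q (sym_diff (a i) C) < d"
      using Union.IH d by auto
    then obtain C where C: "\<And>i. C i \<in> G" "\<And>i. measure P (sym_diff (a i) (C i)) < d" "\<And>i. measure Q (sym_diff (a i) (C i)) < d"
      by metis
    have bound: "measure R (sym_diff ?A (\<Union>i<n. C i)) < e"
      if R: "finite_measure R" and sets_R: "sets R = sets P" and nR: "measure R ?A - e / 2 < measure R (?U n)"
        and CR: "\<And>i. measure R (sym_diff (a i) (C i)) < d" for R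
    proof -
      interpret R: finite_measure R by fact
      have aR: "a i \<in> sets R" and CRs: "C i \<in> sets R" for i
        using a_sets G_P[OF C(1)] sets_R by auto
      have "measure R (sym_diff ?A (\<Union>i<n. C i)) \<le> measure R ((?A - ?U n) \<union> (\<Union>i<n. sym_diff (a i) (C i)))"
        using aR CRs by (intro R.finite_measure_mono) auto
      also have "\<dots> \<le> measure R (?A - ?U n) + measure R (\<Union>i<n. sym_diff (a i) (C i))"
        using aR CRs by (intro measure_subadditive) (auto simp: R.emeasure_eq_measure)
      also have "measure R (?A - ?U n) = measure R ?A - measure R (?U n)"
        using aR by (intro R.finite_measure_Diff) auto
      also have "measure R (\<Union>i<n. sym_diff (a i) (C i)) \<le> (\<Sum>i<n. measure R (sym_diff (a i) (C i)))"
        using aR CRs by (intro R.finite_measure_subadditive_finite) auto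
      also have "\<dots> \<le> (\<Sum>i<n. d)"
        using CR by (intro sum_mono) (auto intro: less_imp_le)
      finally show ?thesis
        using nR d by simp
    qed
    have "(\<Union>i<n. C i) \<in> G"
      using C(1) by (intro finite_UN) auto
    then show ?case
      using bound[OF P refl n(1) C(2)] bound[OF Q sets_Q n(2) C(3)] by blast
  qed
qed

context gaussian_pair
begin

text \<open>The product is indexed by the functionals themselves rather than by an enumeration, so
  two cylinders are brought to a common base by taking the union of their index sets.\<close>

definition cylinders :: "'a set set" where
  "cylinders = {{x\<in>space P. (\<lambda>Z\<in>F. Z x) \<in> S} | F S. finite F \<and> F \<subseteq> V \<and> S \<in> sets (\<Pi>\<^sub>M Z\<in>F. borel)}"

lemma cylindersI:
  "finite F \<Longrightarrow> F \<subseteq> V \<Longrightarrow> S \<in> sets (\<Pi>\<^sub>M Z\<in>F. borel) \<Longrightarrow> {x\<in>space P. (\<lambda>Z\<in>F. Z x) \<in> S} \<in> cylinders"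
  unfolding cylinders_def by blast

lemma algebra_cylinders: "algebra (space P) cylinders"
  unfolding algebra_iff_Un
proof (intro conjI ballI)
  show "cylinders \<subseteq> Pow (space P)"
    by (auto simp: cylinders_def)
  show "{} \<in> cylinders"
    using cylindersI[of "{}" "{}"] by simp
next
  fix A assume "A \<in> cylinders"
  then obtain F S where F: "finite F" "F \<subseteq> V" "S \<in> sets (\<Pi>\<^sub>M Z\<in>F. borel)" and A: "A = {x\<in>space P. (\<lambda>Z\<in>F. Z x) \<in> S}"
    by (auto simp: cylinders_def)
  have "space P - A = {x\<in>space P. (\<lambda>Z\<in>F. Z x) \<in> space (\<Pi>\<^sub>M Z\<in>F. borel) - S}"
    by (auto simp: A space_PiM)
  moreover have "\<dots> \<in> cylinders"
    using F by (intro cylindersI sets.Diff sets.top)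
  ultimately show "space P - A \<in> cylinders"
    by (simp only:)
next
  fix A A' assume "A \<in> cylinders" "A' \<in> cylinders"
  then obtain F S F' S' where F: "finite F" "F \<subseteq> V" "S \<in> sets (\<Pi>\<^sub>M Z\<in>F. borel)" and A: "A = {x\<in>space P. (\<lambda>Z\<in>F. Z x) \<in> S}"
    and F': "finite F'" "F' \<subseteq> V" "S' \<in> sets (\<Pi>\<^sub>M Z\<in>F'. borel)" and A': "A' = {x\<in>space P. (\<lambda>Z\<in>F'. Z x) \<in> S'}"
    by (auto simp: cylinders_def)
  let ?N = "\<Pi>\<^sub>M Z\<in>F \<union> F'. borel :: real measure"
  let ?S = "((\<lambda>t. restrict t F) -` S \<inter> space ?N) \<union> ((\<lambda>t. restrict t F') -` S' \<inter> space ?N)"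
  have "?S \<in> sets ?N"
    using F F' by (intro sets.Un measurable_sets[OF measurable_restrict_subset]) auto
  moreover have "A \<union> A' = {x\<in>space P. (\<lambda>Z\<in>F \<union> F'. Z x) \<in> ?S}"
  proof -
    have "(F \<union> F') \<inter> F = F" "(F \<union> F') \<inter> F' = F'" by auto
    then show ?thesis by (auto simp: A A' space_PiM restrict_restrict)
  qed
  moreover have "\<dots> \<in> cylinders"
    using F F' calculation(1) by (intro cylindersI) auto
  ultimately show "A \<union> A' \<in> cylinders"
    by (simp only:)
qed

text \<open>The event is rewritten, up to sets null under both measures, in terms of an orthonormal
  system. The length of that system disappears from the estimate because \<open>B\<close> bounds
  every system.\<close>

lemma cylinder_bound:
  assumes "A \<in> cylinders" and r: "0 < r"
  shows "measure Q A \<le> exp r * measure P A + ((1 / c + 1 / c ^ 3) * B + 1) / r"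
proof -
  obtain F S where F: "finite F" "F \<subseteq> V" and S: "S \<in> sets (\<Pi>\<^sub>M Z\<in>F. borel)"
    and A: "A = {x\<in>space P. (\<lambda>Z\<in>F. Z x) \<in> S}"
    using assms by (auto simp: cylinders_def)
  have sp: "space Q = space P"
    using sets_Q by (rule sets_eq_imp_space_eq)
  obtain n :: nat and X where basis: "\<forall>k<n. X k \<in> V" "\<forall>k<n. \<forall>l<n. P.cov (X k) (X l) = of_bool (k = l)"
    "\<forall>Z\<in>F. \<exists>b. P.cov (\<lambda>x. Z x - (\<Sum>k<n. b k * X k x)) (\<lambda>x. Z x - (\<Sum>k<n. b k * X k x)) = 0"
    using P.V_orthonormal_basis[OF F] by blast
  then obtain b where b: "\<And>Z. Z \<in> F \<Longrightarrow> P.cov (\<lambda>x. Z x - (\<Sum>k<n. b Z k * X k x)) (\<lambda>x. Z x - (\<Sum>k<n. b Z k * X k x)) = 0"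
    using bchoice[OF basis(3)] by blast
  have XV: "X k \<in> V" if "k < n" for k using basis that by blast
  have orth: "P.cov (X k) (X l) = of_bool (k = l)" if "k < n" "l < n" for k l using basis that by blast
  define N where "N = (\<Pi>\<^sub>M k\<in>{..<n}. borel :: real measure)"
  define T where "T x = (\<lambda>k\<in>{..<n}. X k x)" for x
  define W where "W t = (\<lambda>Z\<in>F. \<Sum>k<n. b Z k * t k)" for t :: "nat \<Rightarrow> real"
  have W: "W \<in> N \<rightarrow>\<^sub>M (\<Pi>\<^sub>M Z\<in>F. borel)"
    unfolding W_def N_def by (intro measurable_restrict borel_measurable_sum borel_measurable_times) auto
  define S' where "S' = W -` S \<inter> space N"
  have S': "S' \<in> sets N"
    unfolding S'_def using W S by (rule measurable_sets)
  have TP: "T \<in> P \<rightarrow>\<^sub>M N" and TQ: "T \<in> Q \<rightarrow>\<^sub>M N"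
    unfolding T_def N_def using P.V_measurable[OF XV] Q.V_measurable[OF XV] by (auto intro!: measurable_restrict)
  let ?A' = "{x\<in>space P. T x \<in> S'}"
  \<comment> \<open>The remainders have zero variance under \<open>P\<close>, hence under
    \<open>Q\<close> by comparability, so the expansions hold almost surely for both
    measures.\<close>
  have AE: "AE x in P. \<forall>Z\<in>F. Z x = (\<Sum>k<n. b Z k * X k x)" "AE x in Q. \<forall>Z\<in>F. Z x = (\<Sum>k<n. b Z k * X k x)"
  proof -
    have "AE x in P. Z x = (\<Sum>k<n. b Z k * X k x)" "AE x in Q. Z x = (\<Sum>k<n. b Z k * X k x)" if "Z \<in> F" for Z
    proof -
      let ?R = "\<lambda>x. Z x - (\<Sum>k<n. b Z k * X k x)"
      have R: "?R \<in> V" using that F XV by (intro P.V_diff P.V_sum) auto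
      have "c * Q.cov ?R ?R \<le> 0"
        using cov_le2[OF R] b[OF that] by simp
      then have "Q.cov ?R ?R = 0"
        using Q.cov_self_nonneg[of ?R] c_pos by (simp add: mult_le_0_iff)
      then show "AE x in P. Z x = (\<Sum>k<n. b Z k * X k x)" "AE x in Q. Z x = (\<Sum>k<n. b Z k * X k x)"
        using P.cov_self_eq_zeroD[OF R b[OF that]] Q.cov_self_eq_zeroD[OF R] by auto
    qed
    then show "AE x in P. \<forall>Z\<in>F. Z x = (\<Sum>k<n. b Z k * X k x)" "AE x in Q. \<forall>Z\<in>F. Z x = (\<Sum>k<n. b Z k * X k x)"
      using F by (auto intro!: AE_finite_allI)
  qed
  have mem: "x \<in> A \<longleftrightarrow> x \<in> ?A'" if "\<forall>Z\<in>F. Z x = (\<Sum>k<n. b Z k * X k x)" "x \<in> space P" for x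
  proof -
    have "(\<lambda>Z\<in>F. Z x) = W (T x)"
      using that unfolding W_def T_def by (intro restrict_ext) auto
    then show ?thesis
      using measurable_space[OF TP that(2)] that(2) by (simp add: A S'_def)
  qed
  have meas: "A \<in> sets P" "?A' \<in> sets P"
  proof -
    have "(\<lambda>x. \<lambda>Z\<in>F. Z x) \<in> P \<rightarrow>\<^sub>M (\<Pi>\<^sub>M Z\<in>F. borel)"
      using F P.V_measurable by (intro measurable_restrict) auto
    from measurable_sets[OF this S] show "A \<in> sets P"
      by (simp add: A vimage_def Int_def conj_commute)
    from measurable_sets[OF TP S'] show "?A' \<in> sets P"
      by (simp add: vimage_def Int_def conj_commute)
  qed
  have "AE x in P. x \<in> A \<longleftrightarrow> x \<in> ?A'"
    using AE(1) AE_space by eventually_elim (rule mem)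
  then have eqP: "measure P A = measure P ?A'"
    using meas by (rule measure_eq_AE)
  have "AE x in Q. x \<in> A \<longleftrightarrow> x \<in> ?A'"
    using AE(2) AE_space[of Q, unfolded sp] by eventually_elim (rule mem)
  then have eqQ: "measure Q A = measure Q ?A'"
    using meas[folded sets_Q] by (rule measure_eq_AE)
  obtain u where u: "u \<in> borel_measurable N"
    and dens: "\<And>h. h \<in> borel_measurable N \<Longrightarrow>
      (\<integral>\<^sup>+x. h (T x) \<partial>Q) = (\<integral>\<^sup>+x. ennreal (exp (u (T x))) * h (T x) \<partial>P)"
    and uint: "integrable Q (\<lambda>x. u (T x))"
    and umean: "(LINT x|Q. u (T x))
      \<le> (1 / c + 1 / c ^ 3) * (\<Sum>k<n. (Q.cov (X k) (X k) - 1)\<^sup>2 + (\<Sum>l<k. (Q.cov (X k) (X l))\<^sup>2))"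
    using log_density[of n X, OF XV orth, folded N_def T_def] by blast
  \<comment> \<open>The entropy bound involves the diagonal and the entries below it, a part of the
    full Hilbert-Schmidt sum.\<close>
  have "(\<Sum>k<n. (Q.cov (X k) (X k) - 1)\<^sup>2 + (\<Sum>l<k. (Q.cov (X k) (X l))\<^sup>2))
    \<le> (\<Sum>k<n. \<Sum>l<n. (Q.cov (X k) (X l) - of_bool (k = l))\<^sup>2)"
  proof (rule sum_mono)
    fix k assume "k \<in> {..<n}"
    then have "(\<Sum>l\<in>insert k {..<k}. (Q.cov (X k) (X l) - of_bool (k = l))\<^sup>2)
      \<le> (\<Sum>l<n. (Q.cov (X k) (X l) - of_bool (k = l))\<^sup>2)"
      by (intro sum_mono2) auto
    then show "(Q.cov (X k) (X k) - 1)\<^sup>2 + (\<Sum>l<k. (Q.cov (X k) (X l))\<^sup>2)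
      \<le> (\<Sum>l<n. (Q.cov (X k) (X l) - of_bool (k = l))\<^sup>2)"
      by simp
  qed
  also have "\<dots> \<le> B"
    using hs[of n X] XV orth by simp
  finally have "(1 / c + 1 / c ^ 3) * (\<Sum>k<n. (Q.cov (X k) (X k) - 1)\<^sup>2 + (\<Sum>l<k. (Q.cov (X k) (X l))\<^sup>2))
      \<le> (1 / c + 1 / c ^ 3) * B"
    using c_pos by (intro mult_left_mono) auto
  then have mean: "(LINT x|Q. u (T x)) \<le> (1 / c + 1 / c ^ 3) * B"
    using umean by linarith
  show ?thesis
    unfolding eqP eqQ
    by (rule prob_le_of_log_density[OF P.prob_space_axioms Q.prob_space_axioms sets_Q u TP dens uint mean S' r])
qed

text \<open>The order of choices matters: \<open>r\<close> is fixed first so that the entropy term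
  is small, and only then is the approximation made fine enough to outweigh the factor
  \<open>exp r\<close>.\<close>

theorem absolutely_continuous_if_generated:
  assumes gen: "sets P \<subseteq> sigma_sets (space P) cylinders"
  shows "absolutely_continuous P Q"
  unfolding absolutely_continuous_def
proof
  have cyl_sets: "cylinders \<subseteq> sets P"
  proof
    fix A assume "A \<in> cylinders"
    then obtain F S where F: "finite F" "F \<subseteq> V" and S: "S \<in> sets (\<Pi>\<^sub>M Z\<in>F. borel)"
      and A: "A = {x\<in>space P. (\<lambda>Z\<in>F. Z x) \<in> S}"
      by (auto simp: cylinders_def)
    have "(\<lambda>x. \<lambda>Z\<in>F. Z x) \<in> P \<rightarrow>\<^sub>M (\<Pi>\<^sub>M Z\<in>F. borel)"
      using F P.V_measurable by (intro measurable_restrict) auto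
    from measurable_sets[OF this S] show "A \<in> sets P"
      by (simp add: A vimage_def Int_def conj_commute)
  qed
  have sets_P: "sets P = sigma_sets (space P) cylinders"
    using gen sets.sigma_sets_subset[OF cyl_sets] by blast
  fix A assume "A \<in> null_sets P"
  then have A: "A \<in> sets P" "measure P A = 0"
    by (auto simp: measure_def)
  \<comment> \<open>The absolute value plus one makes \<open>K\<close> positive and at least the
    numerator of the entropy term.\<close>
  define K where "K = \<bar>(1 / c + 1 / c ^ 3) * B + 1\<bar> + 1"
  have "measure Q A \<le> 3 * e" if e: "0 < e" for e :: real
  proof -
    define r where "r = K / e"
    have r: "0 < r" using e by (simp add: r_def K_def)
    have Kr: "((1 / c + 1 / c ^ 3) * B + 1) / r \<le> e"
      using e r by (simp add: divide_le_eq) (simp add: r_def K_def)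
    define d where "d = min e (e / exp r)"
    have d: "0 < d" "d \<le> e" "exp r * d \<le> e"
      using e by (auto simp: d_def min_def field_simps)
    obtain C where C: "C \<in> cylinders" "measure P (sym_diff A C) < d" "measure Q (sym_diff A C) < d"
      using sigma_sets_approx[OF algebra_cylinders P.finite_measure_axioms Q.finite_measure_axioms sets_P sets_Q A(1) d(1)]
      by blast
    have [measurable]: "A \<in> sets P" "C \<in> sets P" "A \<in> sets Q" "C \<in> sets Q"
      using A C cyl_sets sets_Q by auto
    have "measure P C \<le> measure P (A \<union> sym_diff A C)"
      by (intro P.finite_measure_mono) auto
    also have "\<dots> \<le> measure P A + measure P (sym_diff A C)"
      by (intro measure_subadditive) (auto simp: P.emeasure_eq_measure)
    finally have "measure P C \<le> d" using A C by simp
    then have "exp r * measure P C \<le> e"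
      using d by (meson exp_ge_zero mult_left_mono order_trans)
    then have QC: "measure Q C \<le> e + e"
      using cylinder_bound[OF C(1) r] Kr by linarith
    have "measure Q A \<le> measure Q (C \<union> sym_diff A C)"
      by (intro Q.finite_measure_mono) auto
    also have "\<dots> \<le> measure Q C + measure Q (sym_diff A C)"
      by (intro measure_subadditive) (auto simp: Q.emeasure_eq_measure)
    finally show ?thesis using QC C d by linarith
  qed
  \<comment> \<open>A positive value would be at most three quarters of itself.\<close>
  from this[of "measure Q A / 4"] have "measure Q A = 0"
    using measure_nonneg[of Q A] by (cases "measure Q A = 0") auto
  then show "A \<in> null_sets Q"
    using A sets_Q by (auto simp: null_sets_def Q.emeasure_eq_measure)
qed

end

section \<open>Gaussian random fields\<close>

definition linear_functional :: "(real^'d) set \<Rightarrow> (real^'d \<Rightarrow> 'p \<Rightarrow> real) \<Rightarrow> (real^'d \<Rightarrow> real^'p) \<Rightarrow> real" where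
  "linear_functional S a z = (\<Sum>s\<in>S. \<Sum>j\<in>UNIV. a s j * z s $ j)"

definition linear_functionals :: "(real^'d) set \<Rightarrow> ((real^'d \<Rightarrow> real^'p) \<Rightarrow> real) set" where
  "linear_functionals D = {linear_functional S a | S a. finite S \<and> S \<subseteq> D}"

text \<open>The sign is chosen so that conjugation in the first argument of \<open>hform\<close>
  produces the lag \<open>s - t\<close> of the covariance, and so that multiplication by a Fourier
  transform adds \<open>s\<close> to its frequencies.\<close>

definition trig_poly :: "(real^'d) set \<Rightarrow> (real^'d \<Rightarrow> 'p \<Rightarrow> real) \<Rightarrow> real^'d \<Rightarrow> complex^'p" where
  "trig_poly S a \<omega> = (\<chi> j. \<Sum>s\<in>S. complex_of_real (a s j) * exp (- \<i> * complex_of_real (s \<bullet> \<omega>)))"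

lemma linear_functional_extend:
  assumes "finite S'" "S \<subseteq> S'"
  shows "linear_functional S a = linear_functional S' (\<lambda>s j. if s \<in> S then a s j else 0)"
proof
  fix z
  have "linear_functional S' (\<lambda>s j. if s \<in> S then a s j else 0) z = (\<Sum>s\<in>S'. if s \<in> S then \<Sum>j\<in>UNIV. a s j * z s $ j else 0)"
    unfolding linear_functional_def by (intro sum.cong) auto
  also have "\<dots> = (\<Sum>s\<in>S' \<inter> S. \<Sum>j\<in>UNIV. a s j * z s $ j)"
    using assms by (intro sum.inter_restrict[symmetric])
  finally show "linear_functional S a z = linear_functional S' (\<lambda>s j. if s \<in> S then a s j else 0) z"
    using assms by (simp add: linear_functional_def Int_absorb1)
qed

lemma linear_functional_coordinate:
  fixes s :: "real^'d" and j :: "'p::finite"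
  shows "linear_functional {s} (\<lambda>_ k. of_bool (k = j)) = (\<lambda>z. z s $ j)"
proof
  fix z :: "real^'d \<Rightarrow> real^'p"
  have "(\<Sum>k\<in>UNIV. of_bool (k = j) * z s $ k) = (\<Sum>k\<in>UNIV. if k = j then z s $ j else 0)"
    by (intro sum.cong) auto
  then show "linear_functional {s} (\<lambda>_ k. of_bool (k = j)) z = z s $ j"
    by (simp add: linear_functional_def)
qed

lemma coordinate_in_linear_functionals: "s \<in> D \<Longrightarrow> (\<lambda>z. z s $ j) \<in> linear_functionals D"
  unfolding linear_functionals_def linear_functional_coordinate[symmetric] by blast

lemma gaussian_space_linear_functionals:
  fixes P :: "(real^'d \<Rightarrow> real^'p) measure"
  assumes P: "stationary_zero_mean_gaussian_field D P C"
  shows "gaussian_space P (linear_functionals D)"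
proof -
  have fld: "gaussian_field D P" and zm: "zero_mean D P"
    using P by (auto simp: stationary_zero_mean_gaussian_field_def)
  have prob: "prob_space P"
    using fld by (simp add: gaussian_field_def)
  have gauss: "gaussian_rv P X" if "X \<in> linear_functionals D" for X
    using that fld by (auto simp: linear_functionals_def gaussian_field_def linear_functional_def[abs_def])
  have mean0: "(LINT z|P. z s $ j) = 0" if "s \<in> D" for s j
    using zm that by (simp add: zero_mean_def)
  have int: "integrable P (\<lambda>z. z s $ j)" if "s \<in> D" for s j
    by (rule gaussian_rv_moments(1)[OF prob gauss[OF coordinate_in_linear_functionals[OF that]] mean0[OF that]])
  show ?thesis
  proof (intro gaussian_space.intro gaussian_space_axioms.intro prob gauss)
    fix X :: "(real^'d \<Rightarrow> real^'p) \<Rightarrow> real" assume "X \<in> linear_functionals D"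
    then obtain S a where S: "finite S" "S \<subseteq> D" and X: "X = linear_functional S a"
      by (auto simp: linear_functionals_def)
    have "(LINT z|P. (\<Sum>s\<in>S. \<Sum>j\<in>UNIV. a s j * z s $ j)) = (\<Sum>s\<in>S. \<Sum>j\<in>UNIV. a s j * (LINT z|P. z s $ j))"
      using S int by (subst Bochner_Integration.integral_sum) (auto intro!: sum.cong)
    then show "(LINT z|P. X z) = 0"
      using S mean0 by (auto simp: X linear_functional_def intro!: sum.neutral)
  next
    show "(\<lambda>z. 0) \<in> linear_functionals D"
      unfolding linear_functionals_def
      by (rule CollectI, rule exI[of _ "{}"]) (auto simp: linear_functional_def fun_eq_iff)
  next
    fix X Y :: "(real^'d \<Rightarrow> real^'p) \<Rightarrow> real" assume "X \<in> linear_functionals D" "Y \<in> linear_functionals D"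
    then obtain S a S' a' where S: "finite S" "S \<subseteq> D" and X: "X = linear_functional S a"
      and S': "finite S'" "S' \<subseteq> D" and Y: "Y = linear_functional S' a'"
      by (auto simp: linear_functionals_def)
    have "(\<lambda>z. X z + Y z) = linear_functional (S \<union> S')
      (\<lambda>s j. (if s \<in> S then a s j else 0) + (if s \<in> S' then a' s j else 0))"
      using S S' linear_functional_extend[of "S \<union> S'" S a] linear_functional_extend[of "S \<union> S'" S' a']
      by (simp add: X Y linear_functional_def fun_eq_iff distrib_right sum.distrib)
    then show "(\<lambda>z. X z + Y z) \<in> linear_functionals D"
      unfolding linear_functionals_def using S S' by blast
  next
    fix X :: "(real^'d \<Rightarrow> real^'p) \<Rightarrow> real" and c assume "X \<in> linear_functionals D"
    then obtain S a where S: "finite S" "S \<subseteq> D" and X: "X = linear_functional S a"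
      by (auto simp: linear_functionals_def)
    have "(\<lambda>z. c * X z) = linear_functional S (\<lambda>s j. c * a s j)"
      by (simp add: X linear_functional_def fun_eq_iff sum_distrib_left mult.assoc)
    then show "(\<lambda>z. c * X z) \<in> linear_functionals D"
      unfolding linear_functionals_def using S by blast
  qed
qed

section \<open>Spectral representation of the covariance\<close>

lemma cov_linear_functional:
  fixes P :: "(real^'d \<Rightarrow> real^'p) measure"
  assumes P: "stationary_zero_mean_gaussian_field D P C"
    and S: "finite S" "S \<subseteq> D" and S': "finite S'" "S' \<subseteq> D"
  shows "gaussian_space.cov P (linear_functional S a) (linear_functional S' b)
    = (\<Sum>s\<in>S. \<Sum>j\<in>UNIV. \<Sum>t\<in>S'. \<Sum>k\<in>UNIV. a s j * (b t k * C (s - t) $ j $ k))"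
proof -
  interpret gaussian_space P "linear_functionals D"
    using P by (rule gaussian_space_linear_functionals)
  have covC: "cov (\<lambda>z. z s $ j) (\<lambda>z. z t $ k) = C (s - t) $ j $ k" if "s \<in> D" "t \<in> D" for s t j k
    using P that by (auto simp: stationary_zero_mean_gaussian_field_def stationary_covariance_def
        covariance_def zero_mean_def cov_def)
  have pair: "linear_functional S a = (\<lambda>z. \<Sum>q\<in>S \<times> UNIV. a (fst q) (snd q) * z (fst q) $ snd q)" for S and a :: "real^'d \<Rightarrow> 'p \<Rightarrow> real"
    by (simp add: linear_functional_def fun_eq_iff sum.cartesian_product case_prod_unfold)
  have "cov (linear_functional S a) (linear_functional S' b)
    = (\<Sum>q\<in>S \<times> UNIV. a (fst q) (snd q) * cov (\<lambda>z. z (fst q) $ snd q) (linear_functional S' b))"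
  proof -
    have "linear_functional S' b \<in> linear_functionals D"
      using S' by (auto simp: linear_functionals_def)
    then show ?thesis
      unfolding pair[of S a] using S by (intro cov_sum) (auto intro!: coordinate_in_linear_functionals)
  qed
  also have "\<dots> = (\<Sum>q\<in>S \<times> UNIV. a (fst q) (snd q) * (\<Sum>r\<in>S' \<times> UNIV. b (fst r) (snd r) * C (fst q - fst r) $ snd q $ snd r))"
  proof (intro sum.cong refl arg_cong2[where f="(*)"])
    fix q :: "(real^'d) \<times> 'p" assume q: "q \<in> S \<times> UNIV"
    have "cov (\<lambda>z. z (fst q) $ snd q) (linear_functional S' b)
      = (\<Sum>r\<in>S' \<times> UNIV. b (fst r) (snd r) * cov (\<lambda>z. z (fst q) $ snd q) (\<lambda>z. z (fst r) $ snd r))"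
      unfolding pair[of S' b] using S S' q
      by (intro cov_sum_right) (auto intro!: coordinate_in_linear_functionals)
    also have "\<dots> = (\<Sum>r\<in>S' \<times> UNIV. b (fst r) (snd r) * C (fst q - fst r) $ snd q $ snd r)"
      using S S' q by (intro sum.cong refl) (subst covC, auto)
    finally show "cov (\<lambda>z. z (fst q) $ snd q) (linear_functional S' b)
      = (\<Sum>r\<in>S' \<times> UNIV. b (fst r) (snd r) * C (fst q - fst r) $ snd q $ snd r)" .
  qed
  finally show ?thesis
    by (simp add: sum_distrib_left sum.cartesian_product')
qed

text \<open>The isometry between linear functionals and trigonometric polynomials in the space
  weighted by \<open>F\<close>. For finite sums it follows term by term from the integral for
  \<open>C (s - t)\<close>.\<close>

lemma cov_spectral:
  assumes P: "stationary_zero_mean_gaussian_field D P C" and F: "spectral_density_matrix C F"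
    and S: "finite S" "S \<subseteq> D" and S': "finite S'" "S' \<subseteq> D"
  shows "has_bochner_integral lebesgue (\<lambda>\<omega>. hform (F \<omega>) (trig_poly S a \<omega>) (trig_poly S' b \<omega>))
    (complex_of_real (gaussian_space.cov P (linear_functional S a) (linear_functional S' b)))"
proof -
  let ?e = "\<lambda>h \<omega>. exp (\<i> * complex_of_real (h \<bullet> \<omega>))"
  have basic: "has_bochner_integral lebesgue (\<lambda>\<omega>. ?e h \<omega> * F \<omega> $ j $ k) (complex_of_real (C h $ j $ k))" for h j k
  proof -
    have Fi: "integrable lebesgue (\<lambda>\<omega>. F \<omega> $ j $ k)"
      using F by (simp add: spectral_density_matrix_def)
    have e: "?e h \<in> borel_measurable lebesgue"
      by (rule borel_imp_lebesgue_measurable) simp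
    have "integrable lebesgue (\<lambda>\<omega>. ?e h \<omega> * F \<omega> $ j $ k)"
      by (rule Bochner_Integration.integrable_bound[OF Fi])
        (use e borel_measurable_integrable[OF Fi] in \<open>auto simp: norm_mult intro!: borel_measurable_times\<close>)
    then show ?thesis
      using F by (simp add: has_bochner_integral_iff spectral_density_matrix_def)
  qed
  have "has_bochner_integral lebesgue
     (\<lambda>\<omega>. \<Sum>s\<in>S. \<Sum>j\<in>UNIV. \<Sum>t\<in>S'. \<Sum>k\<in>UNIV. complex_of_real (a s j) * (complex_of_real (b t k) * (?e (s - t) \<omega> * F \<omega> $ j $ k)))
     (\<Sum>s\<in>S. \<Sum>j\<in>UNIV. \<Sum>t\<in>S'. \<Sum>k\<in>UNIV. complex_of_real (a s j) * (complex_of_real (b t k) * complex_of_real (C (s - t) $ j $ k)))"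
    by (intro has_bochner_integral_sum has_bochner_integral_mult_right basic)
  moreover have "(\<Sum>s\<in>S. \<Sum>j\<in>UNIV. \<Sum>t\<in>S'. \<Sum>k\<in>UNIV. complex_of_real (a s j) * (complex_of_real (b t k) * complex_of_real (C (s - t) $ j $ k)))
    = complex_of_real (gaussian_space.cov P (linear_functional S a) (linear_functional S' b))"
    by (simp add: cov_linear_functional[OF P S S'])
  moreover have "(\<Sum>s\<in>S. \<Sum>j\<in>UNIV. \<Sum>t\<in>S'. \<Sum>k\<in>UNIV. complex_of_real (a s j) * (complex_of_real (b t k) * (?e (s - t) \<omega> * F \<omega> $ j $ k)))
    = hform (F \<omega>) (trig_poly S a \<omega>) (trig_poly S' b \<omega>)" for \<omega>
  proof -
    have e: "?e (s - t) \<omega> = cnj (exp (- \<i> * complex_of_real (s \<bullet> \<omega>))) * exp (- \<i> * complex_of_real (t \<bullet> \<omega>))" for s t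
      by (simp add: exp_cnj inner_diff_left right_diff_distrib exp_add[symmetric])
    have "hform (F \<omega>) (trig_poly S a \<omega>) (trig_poly S' b \<omega>)
      = (\<Sum>j\<in>UNIV. \<Sum>k\<in>UNIV. \<Sum>s\<in>S. \<Sum>t\<in>S'. complex_of_real (a s j) * (complex_of_real (b t k) * (?e (s - t) \<omega> * F \<omega> $ j $ k)))"
      unfolding hform_def trig_poly_def vec_lambda_beta e
      by (intro sum.cong refl) (simp add: cnj_sum sum_distrib_left sum_distrib_right mult_ac)
    also have "\<dots> = (\<Sum>j\<in>UNIV. \<Sum>s\<in>S. \<Sum>k\<in>UNIV. \<Sum>t\<in>S'. complex_of_real (a s j) * (complex_of_real (b t k) * (?e (s - t) \<omega> * F \<omega> $ j $ k)))"
      by (intro sum.cong refl, rule sum.swap)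
    also have "\<dots> = (\<Sum>s\<in>S. \<Sum>j\<in>UNIV. \<Sum>k\<in>UNIV. \<Sum>t\<in>S'. complex_of_real (a s j) * (complex_of_real (b t k) * (?e (s - t) \<omega> * F \<omega> $ j $ k)))"
      by (rule sum.swap)
    also have "\<dots> = (\<Sum>s\<in>S. \<Sum>j\<in>UNIV. \<Sum>t\<in>S'. \<Sum>k\<in>UNIV. complex_of_real (a s j) * (complex_of_real (b t k) * (?e (s - t) \<omega> * F \<omega> $ j $ k)))"
      by (intro sum.cong refl, rule sum.swap)
    finally show ?thesis by simp
  qed
  ultimately show ?thesis by simp
qed

lemma has_bochner_integral_mono:
  fixes f g :: "'a \<Rightarrow> real"
  assumes "has_bochner_integral M f x" "has_bochner_integral M g y" "\<And>t. f t \<le> g t"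
  shows "x \<le> y"
  using assms integral_mono[of M f g] by (auto simp: has_bochner_integral_iff)

lemma matrix_norm_uminus: "matrix_norm (- A) = matrix_norm A"
proof -
  have "(\<lambda>x. - A *v x) = (\<lambda>x. - (A *v x))"
    by (simp add: matrix_vector_mult_def vec_eq_iff fun_eq_iff sum_negf)
  then show ?thesis
    by (simp add: matrix_norm_def onorm_neg)
qed

section \<open>Two fields with comparable spectral densities\<close>

text \<open>One direction is enough, because exchanging the two fields changes only the sign of the
  difference of the spectral densities.\<close>

lemma absolutely_continuous_fields:
  fixes T c\<^sub>1 c\<^sub>2 :: real
    and D :: "(real^'d) set"
    and P\<^sub>0 P\<^sub>1 :: "(real^'d \<Rightarrow> real^'p) measure"
    and C\<^sub>0 C\<^sub>1 :: "real^'d \<Rightarrow> real^'p^'p"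
    and F\<^sub>0 F\<^sub>1 :: "real^'d \<Rightarrow> complex^'p^'p"
    and \<phi> :: "real^'d \<Rightarrow> real^'p"
  assumes T: "T > 0" and D: "D = {s. \<forall>i. s $ i \<in> {-T..T}}"
    and P0: "stationary_zero_mean_gaussian_field D P\<^sub>0 C\<^sub>0" and S0: "spectral_density_matrix C\<^sub>0 F\<^sub>0"
    and P1: "stationary_zero_mean_gaussian_field D P\<^sub>1 C\<^sub>1" and S1: "spectral_density_matrix C\<^sub>1 F\<^sub>1"
    and c: "c\<^sub>1 > 0" "c\<^sub>2 > 0"
    and pos: "\<And>\<omega> j. \<phi> \<omega> $ j > 0"
    and W: "(\<lambda>\<omega>. \<chi> j. complex_of_real (\<phi> \<omega> $ j)) \<in> W_space D"
    and L0: "\<And>\<omega>. loewner_le (c\<^sub>1 *\<^sub>R Phi \<phi> \<omega>) (F\<^sub>0 \<omega>) \<and> loewner_le (F\<^sub>0 \<omega>) (c\<^sub>2 *\<^sub>R Phi \<phi> \<omega>)"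
    and L1: "\<And>\<omega>. loewner_le (c\<^sub>1 *\<^sub>R Phi \<phi> \<omega>) (F\<^sub>1 \<omega>) \<and> loewner_le (F\<^sub>1 \<omega>) (c\<^sub>2 *\<^sub>R Phi \<phi> \<omega>)"
    and fin: "(\<integral>\<^sup>+\<omega>. ennreal ((matrix_norm (Phi_inv_sqrt \<phi> \<omega> ** (F\<^sub>1 \<omega> - F\<^sub>0 \<omega>) ** Phi_inv_sqrt \<phi> \<omega>))\<^sup>2)
            \<partial>lebesgue) < \<infinity>"
  shows "absolutely_continuous P\<^sub>0 P\<^sub>1"
proof -
  let ?V = "linear_functionals D :: ((real^'d \<Rightarrow> real^'p) \<Rightarrow> real) set"
  interpret P: gaussian_space P\<^sub>0 ?V using P0 by (rule gaussian_space_linear_functionals)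
  interpret Q: gaussian_space P\<^sub>1 ?V using P1 by (rule gaussian_space_linear_functionals)
  obtain g where g: "\<And>j. square_integrable (g j)" "\<And>j h. h \<notin> D \<Longrightarrow> g j h = 0"
    and \<phi>g: "\<And>j \<omega>. complex_of_real (\<phi> \<omega> $ j) = fourier (g j) \<omega>"
    using W unfolding W_space_def by simp metis
  have zero_D: "0 \<in> D" using T by (simp add: D)
  have \<phi>_meas: "(\<lambda>\<omega>. \<phi> \<omega> $ j) \<in> borel_measurable borel" for j
  proof -
    have "(\<lambda>\<omega>. Re (fourier (g j) \<omega>)) \<in> borel_measurable borel"
      using reproduced_fourier_exp(1)[OF g D T zero_D] by measurable
    then show ?thesis by (simp flip: \<phi>g)
  qed
  have trig_meas: "(\<lambda>\<omega>. trig_poly S a \<omega> $ j) \<in> borel_measurable borel" for S and a :: "_ \<Rightarrow> 'p \<Rightarrow> real" and j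
    unfolding trig_poly_def vec_lambda_beta by measurable
  have rep: "reproduced (2 * T) (\<lambda>\<omega>. complex_of_real (\<phi> \<omega> $ j) * trig_poly S a \<omega> $ j)" if "S \<subseteq> D" for S a j
  proof -
    have "reproduced (2 * T) (\<lambda>\<omega>. \<Sum>s\<in>S. complex_of_real (a s j) * (fourier (g j) \<omega> * exp (- \<i> * complex_of_real (s \<bullet> \<omega>))))"
      using that by (intro reproduced_lincomb reproduced_fourier_exp(2)[OF g D T]) auto
    then show ?thesis
      by (simp add: trig_poly_def \<phi>g sum_distrib_left mult.left_commute)
  qed
  define I where "I = enn2real (\<integral>\<^sup>+\<omega>. ennreal ((matrix_norm (Phi_inv_sqrt \<phi> \<omega> ** (F\<^sub>1 \<omega> - F\<^sub>0 \<omega>) ** Phi_inv_sqrt \<phi> \<omega>))\<^sup>2) \<partial>lebesgue)"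
  have I: "(\<integral>\<^sup>+\<omega>. ennreal ((matrix_norm (Phi_inv_sqrt \<phi> \<omega> ** (F\<^sub>1 \<omega> - F\<^sub>0 \<omega>) ** Phi_inv_sqrt \<phi> \<omega>))\<^sup>2) \<partial>lebesgue) \<le> ennreal I"
    "0 \<le> I"
    using fin by (auto simp: I_def)
  have F_meas: "(\<lambda>\<omega>. F\<^sub>0 \<omega> $ j $ k) \<in> borel_measurable lebesgue" "(\<lambda>\<omega>. F\<^sub>1 \<omega> $ j $ k) \<in> borel_measurable lebesgue" for j k
  proof -
    have "integrable lebesgue (\<lambda>\<omega>. F\<^sub>0 \<omega> $ j $ k)" "integrable lebesgue (\<lambda>\<omega>. F\<^sub>1 \<omega> $ j $ k)"
      using S0 S1 by (auto simp: spectral_density_matrix_def)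
    then show "(\<lambda>\<omega>. F\<^sub>0 \<omega> $ j $ k) \<in> borel_measurable lebesgue" "(\<lambda>\<omega>. F\<^sub>1 \<omega> $ j $ k) \<in> borel_measurable lebesgue"
      by (auto dest: borel_measurable_integrable)
  qed
  \<comment> \<open>The constant of the Hilbert-Schmidt bound, with lower Loewner constant
    \<open>c\<^sub>1\<close> and half-width \<open>2 * T\<close> of the band.\<close>
  define B where "B = (1 / c\<^sub>1) * ((real CARD('p) * (LINT \<omega>::real^'d|lborel. (vp_kernel_prod (2 * T) \<omega>)\<^sup>2) / c\<^sub>1) * I)"
  \<comment> \<open>One density is at most \<open>c\<^sub>2\<close> times the weight and the other
    at least \<open>c\<^sub>1\<close> times it, whence the ratio
    \<open>c\<^sub>1 / c\<^sub>2\<close> in both directions.\<close>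
  have compare: "(c\<^sub>1 / c\<^sub>2) * P.cov X X \<le> Q.cov X X" "(c\<^sub>1 / c\<^sub>2) * Q.cov X X \<le> P.cov X X" if XV: "X \<in> ?V" for X
  proof -
    obtain S a where S: "finite S" "S \<subseteq> D" and X: "X = linear_functional S a"
      using XV by (auto simp: linear_functionals_def)
    let ?h = "\<lambda>F \<omega>. hform (F \<omega>) (trig_poly S a \<omega>) (trig_poly S a \<omega>)"
    have Re_int: "has_bochner_integral lebesgue (\<lambda>\<omega>. Re (?h F\<^sub>0 \<omega>)) (P.cov X X)"
      "has_bochner_integral lebesgue (\<lambda>\<omega>. Re (?h F\<^sub>1 \<omega>)) (Q.cov X X)"
      using has_bochner_integral_Re[OF cov_spectral[OF P0 S0 S S, of a a]]
        has_bochner_integral_Re[OF cov_spectral[OF P1 S1 S S, of a a]] by (simp_all add: X)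
    have pt: "(c\<^sub>1 / c\<^sub>2) * Re (?h F \<omega>) \<le> Re (?h F' \<omega>)"
      if "loewner_le (F \<omega>) (c\<^sub>2 *\<^sub>R Phi \<phi> \<omega>)" "loewner_le (c\<^sub>1 *\<^sub>R Phi \<phi> \<omega>) (F' \<omega>)" for F F' \<omega>
    proof -
      let ?s = "\<Sum>j\<in>UNIV. (\<phi> \<omega> $ j * norm (trig_poly S a \<omega> $ j))\<^sup>2"
      have "(c\<^sub>1 / c\<^sub>2) * Re (?h F \<omega>) \<le> (c\<^sub>1 / c\<^sub>2) * (c\<^sub>2 * ?s)"
        using loewner_le_hform(2)[OF that(1)] c by (intro mult_left_mono) auto
      also have "\<dots> = c\<^sub>1 * ?s" using c by simp
      also have "\<dots> \<le> Re (?h F' \<omega>)"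
        by (rule loewner_le_hform(1)[OF that(2)])
      finally show ?thesis .
    qed
    show "(c\<^sub>1 / c\<^sub>2) * P.cov X X \<le> Q.cov X X"
      by (rule has_bochner_integral_mono[OF has_bochner_integral_mult_right[OF Re_int(1)] Re_int(2)])
        (use pt L0 L1 in blast)
    show "(c\<^sub>1 / c\<^sub>2) * Q.cov X X \<le> P.cov X X"
      by (rule has_bochner_integral_mono[OF has_bochner_integral_mult_right[OF Re_int(2)] Re_int(1)])
        (use pt L0 L1 in blast)
  qed
  have hs: "(\<Sum>k<n. \<Sum>l<n. (Q.cov (Z k) (Z l) - of_bool (k = l))\<^sup>2) \<le> B"
    if Z: "\<And>k. k < n \<Longrightarrow> Z k \<in> ?V" and orth: "\<And>k l. k < n \<Longrightarrow> l < n \<Longrightarrow> P.cov (Z k) (Z l) = of_bool (k = l)"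
    for n :: nat and Z
  proof -
    have "\<forall>k. \<exists>S a. k < n \<longrightarrow> finite S \<and> S \<subseteq> D \<and> Z k = linear_functional S a"
      using Z unfolding linear_functionals_def by blast
    then obtain S a where Sa: "\<And>k. k < n \<Longrightarrow> finite (S k) \<and> S k \<subseteq> D \<and> Z k = linear_functional (S k) (a k)"
      by metis
    define v where "v k = trig_poly (S k) (a k)" for k
    have sp0: "has_bochner_integral lebesgue (\<lambda>\<omega>. hform (F\<^sub>0 \<omega>) (v k \<omega>) (v l \<omega>)) (of_bool (k = l))"
      if "k < n" "l < n" for k l
    proof -
      have "complex_of_real (of_bool (k = l)) = of_bool (k = l)" by simp
      then show ?thesis
        using cov_spectral[OF P0 S0, of "S k" "S l" "a k" "a l"] Sa[OF that(1)] Sa[OF that(2)] orth[OF that]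
        unfolding v_def by metis
    qed
    have diff: "(Q.cov (Z k) (Z l) - of_bool (k = l))\<^sup>2
      = (norm (LINT \<omega>|lebesgue. hform (F\<^sub>1 \<omega> - F\<^sub>0 \<omega>) (v k \<omega>) (v l \<omega>)))\<^sup>2" if "k < n" "l < n" for k l
    proof -
      have "has_bochner_integral lebesgue (\<lambda>\<omega>. hform (F\<^sub>1 \<omega>) (v k \<omega>) (v l \<omega>)) (complex_of_real (Q.cov (Z k) (Z l)))"
        using cov_spectral[OF P1 S1, of "S k" "S l" "a k" "a l"] Sa[OF that(1)] Sa[OF that(2)]
        unfolding v_def by metis
      from has_bochner_integral_diff[OF this sp0[OF that]]
      have "(LINT \<omega>|lebesgue. hform (F\<^sub>1 \<omega> - F\<^sub>0 \<omega>) (v k \<omega>) (v l \<omega>)) = complex_of_real (Q.cov (Z k) (Z l) - of_bool (k = l))"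
        by (simp add: hform_diff has_bochner_integral_integral_eq)
      then show ?thesis by (simp only: norm_of_real power2_abs)
    qed
    have "(\<Sum>k<n. \<Sum>l<n. (Q.cov (Z k) (Z l) - of_bool (k = l))\<^sup>2)
      = (\<Sum>k<n. \<Sum>l<n. (norm (LINT \<omega>|lebesgue. hform (F\<^sub>1 \<omega> - F\<^sub>0 \<omega>) (v k \<omega>) (v l \<omega>)))\<^sup>2)"
      by (intro sum.cong refl) (simp add: diff)
    also have "\<dots> \<le> B"
      unfolding B_def
    proof (rule hilbert_schmidt_bound[OF pos \<phi>_meas c(1) conjunct1[OF L0] F_meas _ _ sp0 I])
      show "(\<lambda>\<omega>. v k \<omega> $ j) \<in> borel_measurable borel" if "k < n" for k j
        unfolding v_def by (rule trig_meas)
      show "reproduced (2 * T) (\<lambda>\<omega>. complex_of_real (\<phi> \<omega> $ j) * v k \<omega> $ j)" if "k < n" for k j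
        unfolding v_def using Sa[OF that] by (intro rep) auto
    qed
    finally show ?thesis .
  qed
  have sets0: "sets P\<^sub>0 = sets (path_space D)" and sets1: "sets P\<^sub>1 = sets (path_space D)"
    using P0 P1 by (auto simp: stationary_zero_mean_gaussian_field_def gaussian_field_def)
  interpret GP: gaussian_pair P\<^sub>0 P\<^sub>1 ?V "c\<^sub>1 / c\<^sub>2" B
    using compare hs c sets0 sets1 by unfold_locales auto
  show ?thesis
  proof (rule GP.absolutely_continuous_if_generated)
    have sp: "space P\<^sub>0 = (\<Pi>\<^sub>E s\<in>D. UNIV)"
      using sets_eq_imp_space_eq[OF sets0] by (simp add: path_space_def space_PiM)
    have "{f \<in> \<Pi>\<^sub>E s\<in>D. space borel. f s \<in> A} \<in> GP.cylinders" if s: "s \<in> D" and A: "A \<in> sets (borel :: (real^'p) measure)" for s A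
    proof -
      let ?Z = "\<lambda>j z::real^'d \<Rightarrow> real^'p. z s $ j"
      \<comment> \<open>Events are generated by the vector values \<open>z s\<close>, whereas
        cylinders use scalar functionals; \<open>?g\<close> reassembles the vector from its
        coordinates.\<close>
      let ?F = "range ?Z" and ?g = "\<lambda>t. (\<chi> j. t (?Z j)) :: real^'p"
      let ?N = "\<Pi>\<^sub>M Z\<in>?F. borel :: real measure"
      have "?g \<in> borel_measurable ?N"
      proof (subst borel_measurable_euclidean_space, intro ballI)
        fix b :: "real^'p" assume "b \<in> Basis"
        then obtain j where b: "b = axis j 1" by (auto simp: Basis_vec_def)
        show "(\<lambda>t. ?g t \<bullet> b) \<in> borel_measurable ?N"
          unfolding b inner_axis vec_lambda_beta inner_real_def mult_1_right
          by (intro measurable_component_singleton) auto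
      qed
      from measurable_sets[OF this A] have "?g -` A \<inter> space ?N \<in> sets ?N" .
      then have "{z\<in>space P\<^sub>0. (\<lambda>Z\<in>?F. Z z) \<in> ?g -` A \<inter> space ?N} \<in> GP.cylinders"
        using coordinate_in_linear_functionals[OF s] by (intro GP.cylindersI) auto
      moreover have "{z\<in>space P\<^sub>0. (\<lambda>Z\<in>?F. Z z) \<in> ?g -` A \<inter> space ?N} = {f \<in> \<Pi>\<^sub>E s\<in>D. space borel. f s \<in> A}"
        unfolding sp by (auto simp: space_PiM)
      ultimately show ?thesis by (simp only:)
    qed
    then show "sets P\<^sub>0 \<subseteq> sigma_sets (space P\<^sub>0) GP.cylinders"
      unfolding sets0 path_space_def sets_PiM_single sp space_borel by (intro sigma_sets_mono') auto
  qed
qed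

theorem theorem4:
  fixes T c\<^sub>1 c\<^sub>2 M :: real
    and D :: "(real^'d) set"
    and P\<^sub>0 P\<^sub>1 :: "(real^'d \<Rightarrow> real^'p) measure"
    and C\<^sub>0 C\<^sub>1 :: "real^'d \<Rightarrow> real^'p^'p"
    and F\<^sub>0 F\<^sub>1 :: "real^'d \<Rightarrow> complex^'p^'p"
    and \<phi> :: "real^'d \<Rightarrow> real^'p"
  assumes "T > 0" and D: "D = {s. \<forall>i. s $ i \<in> {-T..T}}"
    and "stationary_zero_mean_gaussian_field D P\<^sub>0 C\<^sub>0" and "spectral_density_matrix C\<^sub>0 F\<^sub>0"
    and "stationary_zero_mean_gaussian_field D P\<^sub>1 C\<^sub>1" and "spectral_density_matrix C\<^sub>1 F\<^sub>1"
    and "c\<^sub>1 > 0" and "c\<^sub>2 > 0"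
    and "\<And>\<omega> j. \<phi> \<omega> $ j > 0"
    and "(\<lambda>\<omega>. \<chi> j. complex_of_real (\<phi> \<omega> $ j)) \<in> W_space D"
    and "M > 0" and "\<And>\<omega> j. \<phi> \<omega> $ j \<le> M"
    and "\<And>\<omega>. loewner_le (c\<^sub>1 *\<^sub>R Phi \<phi> \<omega>) (F\<^sub>0 \<omega>) \<and> loewner_le (F\<^sub>0 \<omega>) (c\<^sub>2 *\<^sub>R Phi \<phi> \<omega>)"
    and "\<And>\<omega>. loewner_le (c\<^sub>1 *\<^sub>R Phi \<phi> \<omega>) (F\<^sub>1 \<omega>) \<and> loewner_le (F\<^sub>1 \<omega>) (c\<^sub>2 *\<^sub>R Phi \<phi> \<omega>)"
    and "(\<integral>\<^sup>+\<omega>. ennreal ((matrix_norm (Phi_inv_sqrt \<phi> \<omega> ** (F\<^sub>1 \<omega> - F\<^sub>0 \<omega>) ** Phi_inv_sqrt \<phi> \<omega>))\<^sup>2)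
            \<partial>lebesgue) < \<infinity>"
  shows "equivalent_measures P\<^sub>0 P\<^sub>1"
proof -
  have "Phi_inv_sqrt \<phi> \<omega> ** (F\<^sub>0 \<omega> - F\<^sub>1 \<omega>) ** Phi_inv_sqrt \<phi> \<omega>
    = - (Phi_inv_sqrt \<phi> \<omega> ** (F\<^sub>1 \<omega> - F\<^sub>0 \<omega>) ** Phi_inv_sqrt \<phi> \<omega>)" for \<omega>
  proof -
    have "A ** (- B) = - (A ** B)" "(- A) ** B = - (A ** B)" for A B :: "complex^'p^'p"
      by (simp_all add: matrix_matrix_mult_def vec_eq_iff sum_negf)
    then show ?thesis
      by (simp only: minus_diff_eq[of "F\<^sub>1 \<omega>" "F\<^sub>0 \<omega>", symmetric])
  qed
  \<comment> \<open>Exchanging the fields negates the normalised difference, and the operator norm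
    ignores the sign.\<close>
  then have swapped: "(\<integral>\<^sup>+\<omega>. ennreal ((matrix_norm (Phi_inv_sqrt \<phi> \<omega> ** (F\<^sub>0 \<omega> - F\<^sub>1 \<omega>) ** Phi_inv_sqrt \<phi> \<omega>))\<^sup>2)
            \<partial>lebesgue) < \<infinity>"
    using assms(15) by (simp add: matrix_norm_uminus)
  have "sets P\<^sub>0 = sets P\<^sub>1"
    using assms(3,5) by (simp add: stationary_zero_mean_gaussian_field_def gaussian_field_def)
  moreover have "absolutely_continuous P\<^sub>0 P\<^sub>1"
    by (rule absolutely_continuous_fields[OF assms(1-10,13-15)])
  moreover have "absolutely_continuous P\<^sub>1 P\<^sub>0"
    by (rule absolutely_continuous_fields[OF assms(1,2,5,6,3,4,7-10,14,13) swapped])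
  ultimately show ?thesis
    by (simp add: equivalent_measures_def)
qed

end
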